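(* Let $p$ and $q$ be positive constants, let $m$ be an even integer greater than two, and let $\mathcal F_{\pm}$ denote either one of the two Clifford–Fourier transforms $\mathcal F_{+},\mathcal F_{-}$ on $\mathbb R^m$. Assume $f\in B(\mathbb R^m)\otimes Cl_{0,m}$ is such that $$\|f(x)\|_c\le C e^{-p\|x\|_c^2},\quad x\in\mathbb R^m,\qquad\text{and}\qquad \|\mathcal F_{\pm}(f)(\lambda)\|_c\le C e^{-q\|\lambda\|_c^2},\quad\lambda\in\mathbb R^m,$$ for some positive constant $C$. Then three cases can occur: (i) If $pq>\frac14$, then $f=0$. (ii) If $pq=\frac14$, then $f(x)=A\,e^{-\frac{\|x\|_c^2}{2}}$, where $A$ is a constant. (iii) If $pq<\frac14$, then there are many $f$ (satisfying these two bounds).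
   Context: $Cl_{0,m}$ is the real Clifford algebra generated by $e_1,\dots,e_m$ with $e_ie_j=-e_je_i$ for $i\ne j$ and $e_i^2=-1$. It has the basis $e_A=e_{i_1}\cdots e_{i_k}$, $A=\{i_1<\dots<i_k\}\subseteq\{1,\dots,m\}$ (with $e_\emptyset=1$). For $x=\sum_A x_Ae_A$ put $\|x\|_c=(\sum_A|x_A|^2)^{1/2}$; the same formula is used for complex coefficients, i.e. on $Cl_{0,m}\otimes\mathbb C$. A vector $x=(x_1,\dots,x_m)\in\mathbb R^m$ is identified with $\sum_i x_ie_i$, so $\|x\|_c$ is its Euclidean norm; $\langle x,y\rangle=\sum_j x_jy_j$. Gamma operator: $\Gamma_y=-\sum_{j<k}e_je_k(y_j\partial_{y_k}-y_k\partial_{y_j})$. It maps the (finite-dimensional) space of homogeneous Clifford-valued polynomials in $y$ of a given degree to itself. Kernel: $K_{\pm}(x,y)=e^{\mp i\frac{\pi}{2}\Gamma_y}e^{-i\langle x,y\rangle}$, meaning $K_{\pm}(x,y)=\sum_{n\ge0}\frac{(-i)^n}{n!}\,e^{\mp i\frac{\pi}{2}\Gamma_y}\big(\langle x,y\rangle^n\big)$, where in each term the exponential of $\Gamma_y$ acts on homogeneous polynomials of degree $n$ in $y$ ($x$ being a parameter). $B(\mathbb R^m)\otimes Cl_{0,m}$ is the class of integrable functions $f:\mathbb R^m\to Cl_{0,m}$ with $\int_{\mathbb R^m}(1+\|y\|_c)^{\frac{m-2}{2}}\|f(y)\|_c\,dy<\infty$. For $f$ in this class the Clifford–Fourier transform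 is $\mathcal F_{\pm}(f)(y)=(2\pi)^{-m/2}\int_{\mathbb R^m}K_{\pm}(x,y)f(x)\,dx$.
   Formalization: In (ii) the conclusion is f(x) = A e^{-p‖x‖²} instead of A e^{-‖x‖²/2}, which is false for p ≠ 1/2 (p=1, q=1/4, f = c e^{-‖x‖²}); equalities in (i), (ii) hold almost everywhere; "many f" in (iii) means an infinite linearly independent sequence. *)

theory Defs
  imports "HOL-Analysis.Analysis"
begin

text \<open>
  The Clifford algebra with coefficients in \<open>'a\<close> on the generators \<open>e\<^sub>i\<close>, \<open>i :: 'n\<close>, is modelled on
  its basis \<open>e\<^sub>A\<close>: the \<open>A\<close>-component of \<open>x\<close> is the coefficient of \<open>e\<^sub>A\<close>.  The dimension \<open>m\<close> is
  \<open>CARD('n)\<close>.  For \<open>'a = real\<close> this is the real algebra, for \<open>'a = complex\<close> its complexification,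
  and in both cases the library norm of the vector type is the norm \<open>(\<Sum>\<^sub>A \<bar>x\<^sub>A\<bar>\<^sup>2)\<^sup>1\<^sup>/\<^sup>2\<close>.
  The vector type already carries a componentwise \<open>*\<close>, which is not the Clifford product.
\<close>

type_synonym ('a, 'n) clifford = "('a, 'n set) vec"

definition cl_basis :: "'n set \<Rightarrow> ('a::comm_ring_1, 'n::{finite,linorder}) clifford"
  where "cl_basis A = axis A 1"

abbreviation cl_one :: "('a::comm_ring_1, 'n::{finite,linorder}) clifford"
  where "cl_one \<equiv> cl_basis {}"

abbreviation cl_gen :: "'n \<Rightarrow> ('a::comm_ring_1, 'n::{finite,linorder}) clifford"
  where "cl_gen i \<equiv> cl_basis {i}"

text \<open>
  \<open>e\<^sub>A e\<^sub>B = \<plusminus> e\<^bsub>A \<triangle> B\<^esub>\<close>: sorting the concatenated word contributes one factor \<open>-1\<close> for every pair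
  \<open>b < a\<close>, and cancelling \<open>e\<^sub>i e\<^sub>i = -1\<close> one for every pair \<open>b = a\<close>.
\<close>

definition cl_sign :: "'n::{finite,linorder} set \<Rightarrow> 'n set \<Rightarrow> 'a::comm_ring_1"
  where "cl_sign A B = (\<Prod>a\<in>A. \<Prod>b\<in>B. if b \<le> a then -1 else 1)"

definition cl_mult ::
    "('a::comm_ring_1, 'n::{finite,linorder}) clifford \<Rightarrow> ('a, 'n) clifford \<Rightarrow> ('a, 'n) clifford"
    (infixl \<open>\<odot>\<close> 70)
  where "x \<odot> y = (\<Sum>A\<in>UNIV. \<Sum>B\<in>UNIV. (cl_sign A B * x $ A * y $ B) *s cl_basis (sym_diff A B))"

text \<open>The model satisfies the defining properties of the Clifford algebra.\<close>

lemma cl_mult_basis: "cl_basis A \<odot> cl_basis B = cl_sign A B *s cl_basis (sym_diff A B)"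
proof -
  have "cl_basis A \<odot> cl_basis B =
      (\<Sum>A'\<in>UNIV. \<Sum>B'\<in>UNIV. if B' = B then if A' = A
        then cl_sign A B *s cl_basis (sym_diff A B) else 0 else 0)"
    unfolding cl_mult_def by (intro sum.cong) (auto simp: cl_basis_def axis_def)
  also have "\<dots> = cl_sign A B *s cl_basis (sym_diff A B)"
    by simp
  finally show ?thesis .
qed

lemma cl_gen_square: "cl_gen i \<odot> cl_gen i = - cl_one"
  by (simp add: cl_mult_basis cl_sign_def vector_sneg_minus1[symmetric])

lemma cl_gen_anticommute: "i \<noteq> j \<Longrightarrow> cl_gen i \<odot> cl_gen j = - (cl_gen j \<odot> cl_gen i)"
  by (cases "i < j") (auto simp: cl_mult_basis cl_sign_def Un_commute insert_commute
      vector_sneg_minus1[symmetric])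

lemma cl_basis_insert_greater:
  fixes A :: "'n::{finite,linorder} set"
  assumes "\<And>a. a \<in> A \<Longrightarrow> a < i"
  shows "(cl_basis (insert i A) :: ('a::comm_ring_1, 'n) clifford) = cl_basis A \<odot> cl_gen i"
proof -
  have "cl_sign A {i} = (1 :: 'a)"
    using assms by (fastforce simp: cl_sign_def intro!: prod.neutral)
  moreover have "sym_diff A {i} = insert i A"
    using assms by fastforce
  ultimately show ?thesis
    by (simp add: cl_mult_basis)
qed

lemma cl_basis_eq_sorted_product:
  "cl_basis A = foldl (\<odot>) cl_one (map cl_gen (sorted_list_of_set A))"
proof (induction "card A" arbitrary: A)
  case 0
  then show ?case by simp
next
  case (Suc n)
  define i where "i = Max A"
  define A' where "A' = A - {i}"
  have "A \<noteq> {}" using Suc by auto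
  then have i: "i \<in> A" by (simp add: i_def)
  then have A: "A = insert i A'" and card: "n = card A'"
    using Suc by (auto simp: A'_def)
  have less: "a < i" if "a \<in> A'" for a
    using that by (auto simp: A'_def i_def order.not_eq_order_implies_strict)
  have "i \<notin> A'" by (simp add: A'_def)
  have "sorted_list_of_set A = sorted_list_of_set A' @ [i]"
  proof (rule sorted_distinct_set_unique)
    show "sorted (sorted_list_of_set A' @ [i])"
      using less by (auto simp: sorted_append intro: less_imp_le)
    show "distinct (sorted_list_of_set A' @ [i])"
      using \<open>i \<notin> A'\<close> by simp
    show "set (sorted_list_of_set A) = set (sorted_list_of_set A' @ [i])"
      by (simp add: A del: sorted_list_of_set_insert_remove)
  qed simp_all
  then show ?case
    using Suc(1)[OF card]
    by (simp add: A cl_basis_insert_greater[of A' i, OF less] del: sorted_list_of_set_insert_remove)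
qed

lemma cl_sign_sym_diff_left:
  fixes A B C :: "'n::{finite,linorder} set"
  shows "(cl_sign (sym_diff A B) C :: 'a::comm_ring_1) = cl_sign A C * cl_sign B C"
proof -
  define g :: "'n \<Rightarrow> 'a" where "g a = (\<Prod>c\<in>C. if c \<le> a then -1 else 1)" for a
  have sq: "g a * g a = 1" for a
    unfolding g_def prod.distrib[symmetric] by (intro prod.neutral) auto
  have A: "prod g A = prod g (A - B) * prod g (A \<inter> B)" for A B
    by (subst prod.union_disjoint[symmetric]) (auto intro: prod.cong)
  have "prod g A * prod g B = prod g (A - B) * prod g (B - A) * (prod g (A \<inter> B) * prod g (A \<inter> B))"
    using A[of A B] A[of B A] by (simp add: Int_commute mult_ac)
  also have "prod g (A \<inter> B) * prod g (A \<inter> B) = 1"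
    unfolding prod.distrib[symmetric] by (simp add: sq)
  also have "prod g (A - B) * prod g (B - A) = prod g (sym_diff A B)"
    by (subst prod.union_disjoint) auto
  finally show ?thesis
    by (simp add: cl_sign_def g_def)
qed

lemma cl_sign_sym_diff_right:
  fixes A B C :: "'n::{finite,linorder} set"
  shows "(cl_sign C (sym_diff A B) :: 'a::comm_ring_1) = cl_sign C A * cl_sign C B"
proof -
  define g :: "'n \<Rightarrow> 'a" where "g b = (\<Prod>c\<in>C. if b \<le> c then -1 else 1)" for b
  have sq: "g a * g a = 1" for a
    unfolding g_def prod.distrib[symmetric] by (intro prod.neutral) auto
  have A: "prod g A = prod g (A - B) * prod g (A \<inter> B)" for A B
    by (subst prod.union_disjoint[symmetric]) (auto intro: prod.cong)
  have "prod g A * prod g B = prod g (A - B) * prod g (B - A) * (prod g (A \<inter> B) * prod g (A \<inter> B))"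
    using A[of A B] A[of B A] by (simp add: Int_commute mult_ac)
  also have "prod g (A \<inter> B) * prod g (A \<inter> B) = 1"
    unfolding prod.distrib[symmetric] by (simp add: sq)
  also have "prod g (A - B) * prod g (B - A) = prod g (sym_diff A B)"
    by (subst prod.union_disjoint) auto
  finally show ?thesis
    unfolding cl_sign_def g_def by (subst (1 2 3) prod.swap) simp
qed

lemma cl_mult_basis_assoc:
  fixes A B C :: "'n::{finite,linorder} set"
  shows "((cl_basis A :: ('a::comm_ring_1, 'n) clifford) \<odot> cl_basis B) \<odot> cl_basis C =
    cl_basis A \<odot> (cl_basis B \<odot> cl_basis C)"
proof -
  have scaleL: "(c *s x) \<odot> y = c *s (x \<odot> y)" and scaleR: "x \<odot> (c *s y) = c *s (x \<odot> y)"
    for c and x y :: "('a, 'n) clifford"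
    by (simp_all add: cl_mult_def vec_eq_iff sum_distrib_left mult_ac)
  have "sym_diff (sym_diff A B) C = sym_diff A (sym_diff B C)"
    by blast
  then show ?thesis
    by (simp add: cl_mult_basis scaleL scaleR cl_sign_sym_diff_left cl_sign_sym_diff_right
        vector_smult_assoc mult_ac)
qed

lemma cl_mult_one: "cl_one \<odot> cl_basis A = cl_basis A" "cl_basis A \<odot> cl_one = cl_basis A"
  by (simp_all add: cl_mult_basis cl_sign_def)

definition cl_of_real :: "(real, 'n::{finite,linorder}) clifford \<Rightarrow> (complex, 'n) clifford"
  where "cl_of_real x = (\<chi> A. of_real (x $ A))"

definition partial_deriv ::
    "'n \<Rightarrow> (real ^ 'n::finite \<Rightarrow> 'b::real_normed_vector) \<Rightarrow> real ^ 'n::finite \<Rightarrow> 'b"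
  where "partial_deriv k P y = frechet_derivative P (at y) (axis k 1)"

definition cl_Gamma ::
    "(real ^ 'n::{finite,linorder} \<Rightarrow> (complex, 'n) clifford) \<Rightarrow> real ^ 'n::{finite,linorder} \<Rightarrow> (complex, 'n) clifford"
  where "cl_Gamma P y =
    - (\<Sum>(j, k)\<in>{(j, k). j < k}.
         cl_gen j \<odot> cl_gen k \<odot> (y $ j *\<^sub>R partial_deriv k P y - y $ k *\<^sub>R partial_deriv j P y))"

text \<open>
  \<open>e\<^bsup>t\<Gamma>\<^esup> P\<close>, only used for homogeneous polynomials \<open>P\<close>: the iterates of \<open>\<Gamma>\<close> then stay in a
  finite-dimensional space, on which pointwise convergence of the exponential series is convergence
  of the operator exponential.
\<close>

definition cl_exp_Gamma ::
    "complex \<Rightarrow> (real ^ 'n::{finite,linorder} \<Rightarrow> (complex, 'n) clifford)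
      \<Rightarrow> real ^ 'n::{finite,linorder} \<Rightarrow> (complex, 'n) clifford"
  where "cl_exp_Gamma t P y = (\<Sum>k. (t ^ k / fact k) *s (cl_Gamma ^^ k) P y)"

text \<open>The sign \<open>s = 1\<close> gives \<open>K\<^sub>+\<close>, \<open>\<F>\<^sub>+\<close>, and \<open>s = -1\<close> gives \<open>K\<^sub>-\<close>, \<open>\<F>\<^sub>-\<close>.\<close>

definition cl_kernel ::
    "real \<Rightarrow> real ^ 'n::{finite,linorder} \<Rightarrow> real ^ 'n::{finite,linorder} \<Rightarrow> (complex, 'n) clifford"
  where "cl_kernel s x y =
    (\<Sum>n. ((- \<i>) ^ n / fact n) *s
       cl_exp_Gamma (- of_real s * \<i> * of_real pi / 2) (\<lambda>y. of_real ((x \<bullet> y) ^ n) *s cl_one) y)"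

definition cl_B :: "(real ^ 'n::{finite,linorder} \<Rightarrow> (real, 'n) clifford) set"
  where "cl_B = {f. integrable lebesgue f \<and>
    integrable lebesgue (\<lambda>y. (1 + norm y) powr ((real CARD('n) - 2) / 2) * norm (f y))}"

definition cl_Fourier ::
    "real \<Rightarrow> (real ^ 'n::{finite,linorder} \<Rightarrow> (real, 'n) clifford)
      \<Rightarrow> real ^ 'n::{finite,linorder} \<Rightarrow> (complex, 'n) clifford"
  where "cl_Fourier s f y =
    (2 * pi) powr (- real CARD('n) / 2) *\<^sub>R
      (\<integral>x. cl_kernel s x y \<odot> cl_of_real (f x) \<partial>lebesgue)"

definition hardy_class ::
    "real \<Rightarrow> real \<Rightarrow> real \<Rightarrow> real \<Rightarrow> (real ^ 'n::{finite,linorder} \<Rightarrow> (real, 'n) clifford) set"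
  where "hardy_class s p q C = {f \<in> cl_B.
    (\<forall>x. norm (f x) \<le> C * exp (- p * (norm x)\<^sup>2)) \<and>
    (\<forall>y. norm (cl_Fourier s f y) \<le> C * exp (- q * (norm y)\<^sup>2))}"

end

theory Submission
  imports Defs "HOL-Complex_Analysis.Complex_Analysis" "HOL-Real_Asymp.Real_Asymp"
    "HOL-Probability.Distributions"
begin

text \<open>
  Homogeneous polynomials of degree \<open>n\<close> are represented by tensors of rank \<open>n\<close>.  There \<open>\<Gamma>\<close> becomes a
  hermitian operator, so \<open>e\<^bsup>\<mp>i\<pi>\<Gamma>/2\<^esub>\<close> is unitary and the degree \<open>n\<close> part of the kernel is bounded by
  \<open>\<parallel>x\<parallel>\<^sup>n \<parallel>y\<parallel>\<^sup>n / n!\<close>, exactly as for \<open>e\<^bsup>-i\<langle>x,y\<rangle>\<^esub>\<close>.  If \<open>\<parallel>f(x)\<parallel> \<le> C e\<^bsup>-p\<parallel>x\<parallel>\<^sup>2\<^esub>\<close>, then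
  \<open>z \<mapsto> \<F>f(zy)\<close> is therefore entire and \<open>O((1 + \<bar>z\<bar>\<^sup>m) e\<^bsup>a\<bar>z\<bar>\<^sup>2\<^esub>)\<close> with \<open>a = \<parallel>y\<parallel>\<^sup>2/4p\<close>.
  When it is also \<open>O(e\<^bsup>-az\<^sup>2\<^esub>)\<close> on the real line, a Phragmen-Lindeloef argument in each quadrant forces it to be a
  multiple of \<open>e\<^bsup>-az\<^sup>2\<^esub>\<close>.  Hence all homogeneous parts of \<open>\<F>f\<close> are radial and annihilated by \<open>\<Gamma>\<close>, so
  \<open>e\<^bsup>\<mp>i\<pi>\<Gamma>/2\<^esub>\<close> fixes them and \<open>\<F>f\<close> coincides with the ordinary Fourier transform of \<open>f\<close>.  Injectivity of
  the latter identifies \<open>f\<close> with a Gaussian.  Conversely \<open>\<F>\<close> maps Gaussians to Gaussians, which gives an infinite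
  linearly independent family when \<open>pq < 1/4\<close>.
\<close>

text \<open>The obstacle is sharpness: the argument works only if the growth rate in complex
  directions is exactly the rate of decay on the real line, so the kernel bound may lose no
  exponential factor. Over ordered index tuples the coefficients of <x,y>^n form the n-th tensor
  power of x, whose Euclidean norm is exactly |x|^n, and evaluation at y is the pairing with the
  n-th tensor power of y. A unitary operator placed between the two costs no factor depending on n,
  in any dimension. Complex arguments enter only as a scalar power z^n in front of the part of
  degree n, so all vectors stay real. A second obstacle is that a quadrant is the critical angle for
  growth of order 2, where Phragmen-Lindeloef just fails; hence a regularizing factor with a
  parameter \<delta>, and bounds that must not depend on it. Finally, \<Gamma> multiplies from the
  left, so the value f(x) on the right of the kernel can be absorbed into the polynomial on which
  \<Gamma> acts.\<close>

unbundle no fps_syntax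

section \<open>A Phragmen-Lindeloef argument\<close>

lemma phragmen_lindelof_halfstrip:
  fixes \<Phi> :: "complex \<Rightarrow> complex" and \<theta> \<kappa> B D M :: real
  assumes hol: "\<Phi> holomorphic_on UNIV" and \<theta>: "0 < \<theta>" and \<kappa>: "2 < \<kappa>" "\<kappa> * \<theta> < pi" and M: "M > 0"
    and growth: "\<And>z. 0 \<le> Re z \<Longrightarrow> 0 \<le> Im z \<Longrightarrow> Im z \<le> \<theta> \<Longrightarrow> norm (\<Phi> z) \<le> D * exp (B * exp (2 * Re z))"
    and bnd: "\<And>z. 0 \<le> Re z \<Longrightarrow> 0 \<le> Im z \<Longrightarrow> Im z \<le> \<theta> \<Longrightarrow> Re z = 0 \<or> Im z = 0 \<or> Im z = \<theta> \<Longrightarrow> norm (\<Phi> z) \<le> M"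
    and w: "0 \<le> Re w" "0 \<le> Im w" "Im w \<le> \<theta>"
  shows "norm (\<Phi> w) \<le> M"
proof -
  define X where "X = (\<lambda>z. exp (\<kappa> * Re z) * cos (\<kappa> * (Im z - \<theta> / 2)))"
  define c where "c = cos (\<kappa> * \<theta> / 2)"
  have c: "c > 0"
    unfolding c_def using \<theta> \<kappa> by (intro cos_gt_zero) auto
  have X: "X z \<ge> c * exp (\<kappa> * Re z)" if "0 \<le> Im z" "Im z \<le> \<theta>" for z
  proof -
    have "\<bar>\<kappa> * (Im z - \<theta> / 2)\<bar> \<le> \<kappa> * \<theta> / 2"
    proof -
      have "\<bar>Im z - \<theta> / 2\<bar> \<le> \<theta> / 2" using that by (auto simp: abs_if)
      then have "\<kappa> * \<bar>Im z - \<theta> / 2\<bar> \<le> \<kappa> * (\<theta> / 2)" using \<kappa> by (intro mult_left_mono) auto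
      then show ?thesis using \<kappa> by (simp add: abs_mult)
    qed
    then have "cos (\<kappa> * \<theta> / 2) \<le> cos \<bar>\<kappa> * (Im z - \<theta> / 2)\<bar>"
      using \<kappa> \<theta> by (intro cos_monotone_0_pi_le) auto
    then show ?thesis by (simp add: X_def c_def)
  qed
  have key: "norm (\<Phi> w) \<le> M * exp (\<epsilon> * X w)" if \<epsilon>: "\<epsilon> > 0" for \<epsilon>
  proof -
    define \<psi> where "\<psi> = (\<lambda>z. \<Phi> z * exp (- of_real \<epsilon> * exp (of_real \<kappa> * (z - \<i> * of_real (\<theta> / 2)))))"
    have norm\<psi>: "norm (\<psi> z) = norm (\<Phi> z) * exp (- \<epsilon> * X z)" for z
      by (simp add: \<psi>_def norm_mult norm_exp_eq_Re X_def Re_exp algebra_simps)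
    \<comment> \<open>The right edge of the rectangle is placed so far out that the barrier exceeds
      the growth by exp(-exp(2R)), which brings the product below M there.\<close>
    have "filterlim (\<lambda>R. \<epsilon> * c * exp ((\<kappa> - 2) * R)) at_top at_top"
      using \<epsilon> c \<kappa> by real_asymp
    then have 1: "eventually (\<lambda>R. \<epsilon> * c * exp ((\<kappa> - 2) * R) \<ge> B + 1) at_top"
      by (simp add: filterlim_at_top)
    have "((\<lambda>R. D * exp (- exp (2 * R))) \<longlongrightarrow> 0) at_top"
      by real_asymp
    then have 2: "eventually (\<lambda>R. D * exp (- exp (2 * R)) < M) at_top"
      using M by (rule order_tendstoD)
    have "eventually (\<lambda>R. R > max 1 (Re w)) at_top" by (rule eventually_gt_at_top)
    with 1 2 have "eventually (\<lambda>R. \<epsilon> * c * exp ((\<kappa> - 2) * R) \<ge> B + 1 \<and> D * exp (- exp (2 * R)) < M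
        \<and> R > max 1 (Re w)) at_top"
      by eventually_elim auto
    then obtain R where R: "\<epsilon> * c * exp ((\<kappa> - 2) * R) \<ge> B + 1" "D * exp (- exp (2 * R)) < M"
      "R > max 1 (Re w)"
      by (auto simp: eventually_at_top_linorder)
    have D: "D \<ge> 0"
    proof -
      have "0 \<le> D * exp (B * exp (2 * Re w))"
        by (rule order_trans[OF _ growth[OF w]]) simp
      then show ?thesis by (simp add: zero_le_mult_iff)
    qed
    define S where "S = cbox 0 (Complex R \<theta>)"
    have "norm (\<psi> w) \<le> M"
    proof (rule maximum_modulus_frontier[of \<psi> S])
      show "\<psi> holomorphic_on interior S" "continuous_on (closure S) \<psi>"
        unfolding \<psi>_def
        by (intro holomorphic_intros holomorphic_on_imp_continuous_on holomorphic_on_subset[OF hol]; simp)+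
      show "bounded S" by (simp add: S_def)
      show "w \<in> S" using w R by (auto simp: S_def in_cbox_complex_iff)
      fix z assume "z \<in> frontier S"
      then have z: "0 \<le> Re z" "Re z \<le> R" "0 \<le> Im z" "Im z \<le> \<theta>"
        and z': "Re z = 0 \<or> Im z = 0 \<or> Im z = \<theta> \<or> Re z = R"
        by (auto simp: S_def frontier_cbox in_cbox_complex_iff in_box_complex_iff)
      have X0: "X z \<ge> 0"
        by (rule order_trans[OF _ X]) (use c z in auto)
      show "norm (\<psi> z) \<le> M"
      proof (cases "Re z = R")
        case False
        then have "norm (\<Phi> z) \<le> M" using z' z by (intro bnd) auto
        moreover have "exp (- \<epsilon> * X z) \<le> 1" using X0 \<epsilon> by simp
        ultimately show ?thesis
          unfolding norm\<psi> using mult_mono[of "norm (\<Phi> z)" M "exp (- \<epsilon> * X z)" 1] M by simp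
      next
        case True
        have "norm (\<psi> z) \<le> D * exp (B * exp (2 * R)) * exp (- \<epsilon> * (c * exp (\<kappa> * R)))"
          unfolding norm\<psi> using growth[of z] z X[of z] \<epsilon> True D
          by (intro mult_mono) auto
        also have "\<dots> = D * exp (exp (2 * R) * (B - \<epsilon> * c * exp ((\<kappa> - 2) * R)))"
          by (simp add: exp_add[symmetric] algebra_simps flip: exp_add)
        also have "\<dots> \<le> D * exp (- exp (2 * R))"
        proof -
          have "exp (2 * R) * (B - \<epsilon> * c * exp ((\<kappa> - 2) * R)) \<le> exp (2 * R) * (-1)"
            using R by (intro mult_left_mono) auto
          then show ?thesis using D by (intro mult_left_mono) auto
        qed
        finally show ?thesis using R by simp
      qed
    qed
    then show ?thesis
      by (simp add: norm\<psi> exp_minus field_simps)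
  qed
  have lim: "((\<lambda>\<epsilon>. M * exp (\<epsilon> * X w)) \<longlongrightarrow> M * exp (0 * X w)) (at_right 0)"
    by (intro tendsto_intros)
  have ev: "eventually (\<lambda>\<epsilon>. norm (\<Phi> w) \<le> M * exp (\<epsilon> * X w)) (at_right 0)"
    by (rule eventually_at_right_less[of 0, THEN eventually_mono]) (rule key)
  show ?thesis
    using tendsto_lowerbound[OF lim ev] by simp
qed

text \<open>
  The factor \<open>e\<^bsup>i\<delta>z\<^sup>2\<^esub>\<close> absorbs the growth near the imaginary axis, and the remaining sector has opening
  less than \<open>\<pi>/2\<close>, where the previous lemma applies with a bound not depending on \<open>\<delta>\<close>; then \<open>\<delta> \<rightarrow> 0\<close>.
  The substitution \<open>z = e\<^sup>w\<close> turns the part \<open>\<bar>z\<bar> \<ge> 1\<close> of the sector into a half-strip.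
\<close>

lemma poly_growth_quadrant:
  fixes h :: "complex \<Rightarrow> complex" and a C D :: real
  assumes hol: "h holomorphic_on UNIV" and a: "a \<ge> 0" and C: "C > 0" and D: "D \<ge> 0"
    and growth: "\<And>z. norm (h z) \<le> D * (1 + norm z ^ N) * exp (2 * a * (Re z)\<^sup>2)"
    and real: "\<And>r. r \<ge> 0 \<Longrightarrow> norm (h (of_real r)) \<le> C"
  shows "\<exists>K. \<forall>z. 0 \<le> Re z \<longrightarrow> 0 \<le> Im z \<longrightarrow> 1 \<le> norm z \<longrightarrow> norm (h z) \<le> K * norm z ^ N"
proof -
  \<comment> \<open>One constant free of \<delta> for the three sides of the sector: C on the real
    axis, 2D on the slanted ray, 2D exp(2a) on the unit arc.\<close>
  define M where "M = C + 2 * D * exp (2 * a)"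
  have M: "M > 0" "C \<le> M" "2 * D \<le> M" "2 * D * exp (2 * a) \<le> M"
  proof -
    have "2 * D * 1 \<le> 2 * D * exp (2 * a)" using a D by (intro mult_left_mono) auto
    then show "2 * D \<le> M" using C by (simp add: M_def)
    show "M > 0" "C \<le> M" "2 * D * exp (2 * a) \<le> M"
      using C D by (auto simp: M_def intro: add_pos_nonneg)
  qed
  have main: "norm (h (exp w)) \<le> M * norm (exp w) ^ N * exp (\<delta> * Im (exp (2 * w)))"
    if w: "0 \<le> Re w" "0 \<le> Im w" "Im w \<le> pi / 2" and \<delta>: "\<delta> > 0" for w \<delta>
  proof -
    \<comment> \<open>The second factor removes the polynomial growth. The third has modulus
      exp(-\<delta> Im(e^{2z})), at most 1 over the quadrant.\<close>
    define \<Phi> where "\<Phi> = (\<lambda>z. h (exp z) * exp (- of_nat N * z) * exp (\<i> * of_real \<delta> * exp (2 * z)))"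
    have norm\<Phi>: "norm (\<Phi> z) = norm (h (exp z)) * exp (- real N * Re z) * exp (- \<delta> * Im (exp (2 * z)))" for z
      by (simp add: \<Phi>_def norm_mult norm_exp_eq_Re)
    \<comment> \<open>With r = e^{Re z} and angle t = Im z, the combined exponent is 2 r^2 cos t (a
      cos t - \<delta> sin t), which is nonpositive once tan t \<ge> a/\<delta>. Taking a + 1
      instead of a keeps \<theta> positive when a = 0.\<close>
    define \<theta> where "\<theta> = arctan ((a + 1) / \<delta>)"
    have \<theta>: "0 < \<theta>" "\<theta> < pi / 2"
      using a \<delta> arctan_ubound[of "(a + 1) / \<delta>"] by (auto simp: \<theta>_def)
    have tan\<theta>: "(a + 1) * cos \<theta> = \<delta> * sin \<theta>"
    proof -
      have "tan \<theta> = (a + 1) / \<delta>" by (simp add: \<theta>_def tan_arctan)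
      moreover have "cos \<theta> > 0" using \<theta> by (intro cos_gt_zero) auto
      ultimately show ?thesis using \<delta> by (simp add: tan_def field_simps)
    qed
    have hexp: "norm (h (exp z)) * exp (- real N * Re z) \<le> 2 * D * exp (2 * a * (exp (Re z) * cos (Im z))\<^sup>2)"
      if "0 \<le> Re z" for z
    proof -
      have "norm (exp z) ^ N = exp (real N * Re z)"
        by (simp add: norm_exp_eq_Re exp_of_nat_mult)
      moreover have "1 \<le> exp (real N * Re z)" using that by simp
      ultimately have "1 + norm (exp z) ^ N \<le> 2 * exp (real N * Re z)" by linarith
      then have "norm (h (exp z)) \<le> D * (2 * exp (real N * Re z)) * exp (2 * a * (exp (Re z) * cos (Im z))\<^sup>2)"
        by (intro order_trans[OF growth[of "exp z", unfolded Re_exp]] mult_right_mono mult_left_mono) (auto simp: D)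
      then have "norm (h (exp z)) * exp (- real N * Re z) \<le>
          D * (2 * exp (real N * Re z)) * exp (2 * a * (exp (Re z) * cos (Im z))\<^sup>2) * exp (- real N * Re z)"
        by (rule mult_right_mono) simp
      also have "\<dots> = 2 * D * exp (2 * a * (exp (Re z) * cos (Im z))\<^sup>2)"
        by (simp add: exp_minus field_simps)
      finally show ?thesis .
    qed
    have Im2: "Im (exp (2 * z)) = 2 * (exp (Re z))\<^sup>2 * (sin (Im z) * cos (Im z))" for z
      by (simp add: exp_double Im_power2 Re_exp Im_exp power2_eq_square)
    have Imnn: "Im (exp (2 * z)) \<ge> 0" if "0 \<le> Im z" "Im z \<le> pi / 2" for z
      unfolding Im2 using that by (intro mult_nonneg_nonneg) (auto intro: sin_ge_zero cos_ge_zero)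
    have bound1: "norm (\<Phi> z) \<le> 2 * D * exp (2 * a * exp (2 * Re z))"
      if z: "0 \<le> Re z" "0 \<le> Im z" "Im z \<le> pi / 2" for z
    proof -
      have "(cos (Im z))\<^sup>2 \<le> 1" by (simp add: abs_square_le_1)
      then have "2 * a * (exp (Re z) * cos (Im z))\<^sup>2 \<le> 2 * a * exp (2 * Re z)"
        using a by (simp add: power_mult_distrib exp_double mult_left_le mult_left_mono)
      then have 1: "norm (h (exp z)) * exp (- real N * Re z) \<le> 2 * D * exp (2 * a * exp (2 * Re z))"
        using hexp[OF z(1)] D by (elim order_trans) (intro mult_left_mono; simp)
      have "exp (- \<delta> * Im (exp (2 * z))) \<le> 1"
        using Imnn[OF z(2,3)] \<delta> by simp
      then show ?thesis
        unfolding norm\<Phi> using mult_mono[OF 1, of "exp (- \<delta> * Im (exp (2 * z)))" 1] D by simp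
    qed
    have bound2: "norm (\<Phi> z) \<le> M" if z: "0 \<le> Re z" "\<theta> \<le> Im z" "Im z \<le> pi / 2" for z
    proof -
      have cz: "cos (Im z) \<ge> 0" using z \<theta> by (intro cos_ge_zero) auto
      have "a * cos (Im z) \<le> (a + 1) * cos \<theta>"
        using a cz z \<theta> by (intro mult_mono cos_monotone_0_pi_le) auto
      also have "\<dots> \<le> \<delta> * sin (Im z)"
        unfolding tan\<theta> using z \<theta> \<delta> by (intro mult_left_mono sin_monotone_2pi_le) auto
      finally have 1: "a * cos (Im z) - \<delta> * sin (Im z) \<le> 0" by simp
      have "norm (\<Phi> z) \<le> 2 * D * exp (2 * a * (exp (Re z) * cos (Im z))\<^sup>2) * exp (- \<delta> * Im (exp (2 * z)))"
        unfolding norm\<Phi> by (intro mult_right_mono hexp z) auto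
      also have "\<dots> = 2 * D * exp (2 * (exp (Re z))\<^sup>2 * cos (Im z) * (a * cos (Im z) - \<delta> * sin (Im z)))"
        unfolding Im2 by (simp add: exp_add[symmetric] algebra_simps power2_eq_square flip: exp_add)
      also have "\<dots> \<le> 2 * D * 1"
        using mult_nonneg_nonpos[OF _ 1, of "2 * (exp (Re z))\<^sup>2 * cos (Im z)"] cz D
        by (intro mult_left_mono) (simp_all del: exp_le_one_iff add: exp_le_one_iff)
      finally show ?thesis using M by simp
    qed
    have "norm (\<Phi> w) \<le> M"
    proof (cases "\<theta> \<le> Im w")
      case True
      then show ?thesis using bound2 w by blast
    next
      case False
      \<comment> \<open>The midpoint of the interval from 2 to \<pi>/\<theta>, which is nonempty
        because \<theta> < \<pi>/2.\<close>
      define \<kappa> where "\<kappa> = (2 + pi / \<theta>) / 2"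
      have "2 < pi / \<theta>" using \<theta> by (simp add: field_simps)
      moreover have "2 < (2 + u) / 2" "(2 + u) / 2 < u" if "2 < u" for u :: real
        using that by auto
      ultimately have \<kappa>: "2 < \<kappa>" and \<kappa>': "\<kappa> < pi / \<theta>"
        unfolding \<kappa>_def by blast+
      show ?thesis
      proof (rule phragmen_lindelof_halfstrip[where \<Phi> = \<Phi> and w = w and \<theta> = \<theta> and \<kappa> = \<kappa> and B = "2 * a" and D = "2 * D"])
        have "(\<lambda>z. h (exp z)) holomorphic_on UNIV"
          using holomorphic_on_compose_gen[OF holomorphic_on_exp hol] by (simp add: o_def)
        then show "\<Phi> holomorphic_on UNIV"
          unfolding \<Phi>_def by (intro holomorphic_intros)
        show "\<kappa> * \<theta> < pi" using \<kappa>' \<theta> by (simp add: field_simps)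
        show "norm (\<Phi> z) \<le> M"
          if z: "0 \<le> Re z" "0 \<le> Im z" "Im z \<le> \<theta>" "Re z = 0 \<or> Im z = 0 \<or> Im z = \<theta>" for z
        proof -
          consider "Re z = 0" | "Im z = 0" | "Im z = \<theta>" using z by blast
          then show ?thesis
          proof cases
            case 1
            then show ?thesis
              using bound1[of z] z \<theta> M by simp
          next
            case 2
            then have "exp z = of_real (exp (Re z))" by (simp add: exp_eq_polar)
            then have "norm (h (exp z)) \<le> C" by (metis real exp_ge_zero)
            moreover have "exp (- real N * Re z) \<le> 1" using z by simp
            moreover have "exp (- \<delta> * Im (exp (2 * z))) = 1" using 2 by (simp add: Im2)
            then have "norm (\<Phi> z) = norm (h (exp z)) * exp (- real N * Re z)"
              by (simp only: norm\<Phi> mult_1_right)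
            ultimately show ?thesis
              using mult_mono[of "norm (h (exp z))" C "exp (- real N * Re z)" 1] C M by simp
          next
            case 3
            then show ?thesis using bound2[of z] z \<theta> by simp
          qed
        qed
      qed (use \<theta> \<kappa> M w False bound1 in auto)
    qed
    then have "norm (h (exp w)) * exp (- real N * Re w) * exp (- \<delta> * Im (exp (2 * w))) \<le> M"
      by (simp only: norm\<Phi>)
    then show ?thesis
      by (simp add: norm_exp_eq_Re exp_of_nat_mult exp_of_nat2_mult exp_minus field_simps)
  qed
  show ?thesis
  proof (intro exI[of _ M] allI impI)
    fix z :: complex assume z: "0 \<le> Re z" "0 \<le> Im z" "1 \<le> norm z"
    define w where "w = Ln z"
    have z0: "z \<noteq> 0" using z by auto
    have w: "exp w = z" "Re w = ln (norm z)" "Im w = Arg z"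
      using z0 by (auto simp: w_def Arg_def)
    have "0 \<le> Arg z" "Arg z \<le> pi / 2"
      using z z0 Arg_bounded[of z] Im_Ln_pos_le[OF z0] Re_Ln_pos_le[OF z0] by (auto simp: Arg_def)
    then have w': "0 \<le> Re w" "0 \<le> Im w" "Im w \<le> pi / 2"
      using z by (auto simp: w)
    have lim: "((\<lambda>\<delta>. M * norm z ^ N * exp (\<delta> * Im (exp (2 * w)))) \<longlongrightarrow> M * norm z ^ N * exp (0 * Im (exp (2 * w)))) (at_right 0)"
      by (intro tendsto_intros)
    have ev: "eventually (\<lambda>\<delta>. norm (h z) \<le> M * norm z ^ N * exp (\<delta> * Im (exp (2 * w)))) (at_right 0)"
      by (rule eventually_at_right_less[of 0, THEN eventually_mono]) (use main[OF w'] w(1) in simp)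
    show "norm (h z) \<le> M * norm z ^ N"
      using tendsto_lowerbound[OF lim ev] by simp
  qed
qed

text \<open>Multiplication by e^{a z^2} makes g bounded on the real line and turns the growth into
  exp(2a (Re z)^2), which is only polynomial on the imaginary axis. The quadrant estimate then
  bounds h polynomially in the plane, so h is a polynomial by Liouville, and boundedness on the
  reals makes it constant.\<close>

lemma hardy_entire:
  fixes g :: "complex \<Rightarrow> complex" and a C D :: real
  assumes hol: "g holomorphic_on UNIV" and a: "a \<ge> 0" and C: "C > 0" and D: "D \<ge> 0"
    and growth: "\<And>z. norm (g z) \<le> D * (1 + norm z ^ N) * exp (a * (norm z)\<^sup>2)"
    and real: "\<And>r. norm (g (of_real r)) \<le> C * exp (- a * r\<^sup>2)"
  shows "g z = g 0 * exp (- of_real a * z\<^sup>2)"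
proof -
  define h where "h = (\<lambda>z. g z * exp (of_real a * z\<^sup>2))"
  have holh: "h holomorphic_on UNIV"
    unfolding h_def by (intro holomorphic_intros hol)
  have growth_h: "norm (h z) \<le> D * (1 + norm z ^ N) * exp (2 * a * (Re z)\<^sup>2)" for z
  proof -
    have "norm (h z) = norm (g z) * exp (a * ((Re z)\<^sup>2 - (Im z)\<^sup>2))"
      by (simp add: h_def norm_mult norm_exp_eq_Re Re_power2)
    also have "\<dots> \<le> D * (1 + norm z ^ N) * exp (a * (norm z)\<^sup>2) * exp (a * ((Re z)\<^sup>2 - (Im z)\<^sup>2))"
      by (intro mult_right_mono growth) auto
    also have "\<dots> = D * (1 + norm z ^ N) * exp (2 * a * (Re z)\<^sup>2)"
      by (simp add: cmod_power2 algebra_simps flip: exp_add)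
    finally show ?thesis .
  qed
  have real_h: "norm (h (of_real r)) \<le> C" for r
  proof -
    have "norm (h (of_real r)) = norm (g (of_real r)) * exp (a * r\<^sup>2)"
      by (simp add: h_def norm_mult norm_exp_eq_Re Re_power2)
    also have "\<dots> \<le> C * exp (- a * r\<^sup>2) * exp (a * r\<^sup>2)"
      by (intro mult_right_mono real) auto
    finally show ?thesis by (simp add: exp_minus field_simps)
  qed
  have hol_minus: "(\<lambda>z. f (- z)) holomorphic_on UNIV" if "f holomorphic_on UNIV" for f :: "complex \<Rightarrow> complex"
    using holomorphic_on_compose_gen[OF holomorphic_on_minus[OF holomorphic_on_ident] that] by (simp add: o_def)
  \<comment> \<open>Together with z to -z, this reflection carries the first quadrant to the other
    three; growth and real bounds are invariant under both.\<close>
  have hol_cnj: "(\<lambda>z. cnj (f (cnj z))) holomorphic_on UNIV" if "f holomorphic_on UNIV" for f :: "complex \<Rightarrow> complex"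
    using holomorphic_on_compose_cnj_cnj[of f UNIV] that holomorphic_on_subset[OF that, of "range cnj"] by (simp add: o_def)
  note q = poly_growth_quadrant[where N = N and a = a and C = C and D = D, OF _ a C D]
  have minus_real: "h (- of_real r) = h (of_real (- r))" for r by simp
  obtain K1 where K1: "\<And>z. 0 \<le> Re z \<Longrightarrow> 0 \<le> Im z \<Longrightarrow> 1 \<le> norm z \<Longrightarrow> norm (h z) \<le> K1 * norm z ^ N"
    using q[OF holh growth_h real_h] by blast
  obtain K2 where K2: "\<And>z. 0 \<le> Re z \<Longrightarrow> 0 \<le> Im z \<Longrightarrow> 1 \<le> norm z \<Longrightarrow> norm (h (- z)) \<le> K2 * norm z ^ N"
    using q[OF hol_minus[OF holh]] growth_h[of "- _"] real_h[of "- _"] by auto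
  obtain K3 where K3: "\<And>z. 0 \<le> Re z \<Longrightarrow> 0 \<le> Im z \<Longrightarrow> 1 \<le> norm z \<Longrightarrow> norm (h (cnj z)) \<le> K3 * norm z ^ N"
    using q[OF hol_cnj[OF holh]] growth_h[of "cnj _"] real_h by auto
  obtain K4 where K4: "\<And>z. 0 \<le> Re z \<Longrightarrow> 0 \<le> Im z \<Longrightarrow> 1 \<le> norm z \<Longrightarrow> norm (h (- cnj z)) \<le> K4 * norm z ^ N"
    using q[OF hol_minus[OF hol_cnj[OF holh]]] growth_h[of "- cnj _"] real_h[of "- _"] by auto
  define K where "K = max (max K1 K2) (max K3 K4)"
  have K: "norm (h z) \<le> K * norm z ^ N" if "1 \<le> norm z" for z
  proof -
    have "norm (h z) \<le> K1 * norm z ^ N \<or> norm (h z) \<le> K2 * norm z ^ N \<or>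
      norm (h z) \<le> K3 * norm z ^ N \<or> norm (h z) \<le> K4 * norm z ^ N"
      using K1[of z] K2[of "- z"] K3[of "cnj z"] K4[of "- cnj z"] that by (cases "0 \<le> Re z"; cases "0 \<le> Im z") auto
    moreover have "Ki * norm z ^ N \<le> K * norm z ^ N" if "Ki \<le> K" for Ki
      by (rule mult_right_mono[OF that]) simp
    moreover have "K1 \<le> K" "K2 \<le> K" "K3 \<le> K" "K4 \<le> K" by (auto simp: K_def)
    ultimately show ?thesis by (meson order_trans)
  qed
  define c where "c = (\<lambda>k. (deriv ^^ k) h 0 / fact k)"
  have poly: "h z = (\<Sum>k\<le>N. c k * z ^ k)" for z
    using Liouville_polynomial[OF holh, of 1 K N z] K by (simp add: c_def)
  have coeff_0: "\<forall>k. k \<noteq> 0 \<and> k \<le> N \<longrightarrow> c k = 0"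
  proof (rule ccontr)
    assume "\<not> ?thesis"
    then obtain k where k: "k \<noteq> 0" "k \<le> N" "c k \<noteq> 0" by blast
    obtain B where B: "\<And>z. B \<le> norm z \<Longrightarrow> norm (\<Sum>i\<le>N. c i * z ^ i) \<ge> C + 1"
    proof -
      have "eventually (\<lambda>z. norm (\<Sum>i\<le>N. c i * z ^ i) \<ge> C + 1) at_infinity"
        by (rule polyfun_extremal) (use k in blast)
      then show ?thesis using that by (auto simp: eventually_at_infinity)
    qed
    have "norm (h (of_real \<bar>B\<bar>)) \<ge> C + 1"
      unfolding poly by (rule B) simp
    then show False using real_h[of "\<bar>B\<bar>"] by simp
  qed
  then have "h z = (\<Sum>k\<le>N. if k = 0 then c 0 else 0)"
    unfolding poly by (intro sum.cong) auto
  then have hz: "h z = h 0" by (simp add: c_def)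
  then have "g z * exp (of_real a * z\<^sup>2) = g 0" by (simp add: h_def)
  then show ?thesis by (simp add: exp_minus field_simps)
qed

section \<open>Homogeneous polynomials as tensors\<close>

lemma cl_mult_nth:
  fixes x y :: "('a::comm_ring_1, 'n::{finite,linorder}) clifford"
  shows "(x \<odot> y) $ D = (\<Sum>A\<in>UNIV. cl_sign A (sym_diff A D) * x $ A * y $ (sym_diff A D))"
proof -
  have eq: "sym_diff A B = D \<longleftrightarrow> B = sym_diff A D" for A B
    by blast
  have "(x \<odot> y) $ D = (\<Sum>A\<in>UNIV. \<Sum>B\<in>UNIV.
      if B = sym_diff A D then cl_sign A B * x $ A * y $ B else 0)"
    unfolding cl_mult_def sum_component eq[symmetric]
    by (intro sum.cong refl) (auto simp: cl_basis_def axis_def)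
  also have "\<dots> = (\<Sum>A\<in>UNIV. cl_sign A (sym_diff A D) * x $ A * y $ (sym_diff A D))"
    by simp
  finally show ?thesis .
qed

lemma cl_mult_add_left: "(x + y) \<odot> z = x \<odot> z + y \<odot> z"
  and cl_mult_add_right: "x \<odot> (y + z) = x \<odot> y + x \<odot> z"
  and cl_mult_scale_left: "(c *s x) \<odot> y = c *s (x \<odot> y)"
  and cl_mult_scale_right: "x \<odot> (c *s y) = c *s (x \<odot> y)"
  for x y z :: "('a::comm_ring_1, 'n::{finite,linorder}) clifford"
  by (simp_all add: vec_eq_iff cl_mult_nth sum.distrib sum_distrib_left algebra_simps)

lemma scaleR_eq_scalar_mult: "r *\<^sub>R v = complex_of_real r *s v" for v :: "complex ^ 'k"
  by (simp add: vec_eq_iff scaleR_conv_of_real[where 'a = complex])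

lemma norm_scalar_mult: "norm (c *s v) = norm c * norm v" for v :: "complex ^ 'k"
  by (simp add: norm_vec_def L2_set_def norm_mult power_mult_distrib sum_distrib_left[symmetric]
      real_sqrt_mult)

lemma bounded_bilinear_cl_mult:
  "bounded_bilinear ((\<odot>) :: (complex, 'n::{finite,linorder}) clifford \<Rightarrow> _ \<Rightarrow> _)"
  unfolding bilinear_conv_bounded_bilinear[symmetric] bilinear_def
  by (auto intro!: linearI
      simp: cl_mult_add_left cl_mult_add_right cl_mult_scale_left cl_mult_scale_right scaleR_eq_scalar_mult)

interpretation cl_mult: bounded_bilinear
  "(\<odot>) :: (complex, 'n::{finite,linorder}) clifford \<Rightarrow> _ \<Rightarrow> _"
  by (rule bounded_bilinear_cl_mult)

lemma bounded_linear_scalar_mult: "bounded_linear (\<lambda>v :: complex ^ 'k. c *s v)"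
  by (auto intro!: bounded_linear_intro[where K = "norm c"]
      simp: norm_scalar_mult vec_eq_iff algebra_simps)

lemma cl_vector_expansion: "x = (\<Sum>A\<in>UNIV. x $ A *s cl_basis A)"
  for x :: "('a::comm_ring_1, 'n::{finite,linorder}) clifford"
  by (simp add: cl_basis_def basis_expansion)

lemma cl_mult_sum_left: "sum f S \<odot> y = (\<Sum>i\<in>S. f i \<odot> y)"
  and cl_mult_sum_right: "y \<odot> sum f S = (\<Sum>i\<in>S. y \<odot> f i)"
  for y :: "('a::comm_ring_1, 'n::{finite,linorder}) clifford"
  by (simp_all add: vec_eq_iff cl_mult_nth sum_distrib_left sum_distrib_right sum.swap[of _ S])

lemma cl_mult_assoc: "(x \<odot> y) \<odot> z = x \<odot> (y \<odot> z)"
  for x y z :: "('a::comm_ring_1, 'n::{finite,linorder}) clifford"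
proof -
  have 1: "(x \<odot> y) \<odot> z = x \<odot> (y \<odot> z)" if "x = cl_basis A" "y = cl_basis B" for x y z :: "('a, 'n) clifford" and A B
    by (subst (1 2) cl_vector_expansion[of z])
      (simp add: that cl_mult_sum_right cl_mult_scale_right cl_mult_basis_assoc)
  have 2: "(x \<odot> y) \<odot> z = x \<odot> (y \<odot> z)" if "x = cl_basis A" for x y z :: "('a, 'n) clifford" and A
    by (subst (1 2) cl_vector_expansion[of y])
      (simp add: that cl_mult_sum_right cl_mult_sum_left cl_mult_scale_right cl_mult_scale_left 1)
  show ?thesis
    by (subst (1 2) cl_vector_expansion[of x])
      (simp add: cl_mult_sum_left cl_mult_scale_left 2)
qed

lemma cl_one_mult: "cl_one \<odot> x = x"
  for x :: "('a::comm_ring_1, 'n::{finite,linorder}) clifford"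
  by (subst (1 2) cl_vector_expansion[of x])
    (simp add: cl_mult_sum_right cl_mult_scale_right cl_mult_one)

definition cl_inner :: "(complex, 'n::finite) clifford \<Rightarrow> (complex, 'n) clifford \<Rightarrow> complex"
  where "cl_inner u v = (\<Sum>A\<in>UNIV. cnj (u $ A) * v $ A)"

lemma cl_inner_self: "cl_inner u u = of_real ((norm u)\<^sup>2)"
  by (simp add: cl_inner_def norm_vec_def L2_set_def sum_nonneg mult.commute[of "cnj _"]
      complex_norm_square[symmetric] flip: of_real_power of_real_sum)

text \<open>The minus sign is (e_j e_k)^2 = -1, split off by multiplicativity of the sign in its
  second argument. It is what makes bivectors skew.\<close>

lemma cl_sign_pair:
  assumes "j \<noteq> k"
  shows "cl_sign {j, k} (sym_diff {j, k} D) = (- cl_sign {j, k} D :: 'a::comm_ring_1)"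
proof -
  have "cl_sign {j, k} {j, k} = (-1 :: 'a)"
    using assms by (cases "j < k") (auto simp: cl_sign_def)
  then show ?thesis
    by (simp only: cl_sign_sym_diff_right) simp
qed

lemma cnj_cl_sign: "cnj (cl_sign A B) = cl_sign A B"
  unfolding cl_sign_def cnj_prod by (intro prod.cong) auto

lemma cl_bivector_nth:
  assumes "j \<noteq> k"
  shows "(cl_gen j \<odot> cl_gen k \<odot> u) $ D =
    cl_sign {j} {k} * cl_sign {j, k} (sym_diff {j, k} D) * u $ sym_diff {j, k} D"
proof -
  have S: "sym_diff {j} {k} = {j, k}"
    using assms by auto
  have "(cl_basis S \<odot> u) $ D = cl_sign S (sym_diff S D) * u $ sym_diff S D" for S
  proof -
    have "(cl_basis S \<odot> u) $ D =
        (\<Sum>A\<in>UNIV. if A = S then cl_sign A (sym_diff A D) * u $ sym_diff A D else 0)"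
      unfolding cl_mult_nth by (intro sum.cong) (auto simp: cl_basis_def axis_def)
    then show ?thesis by simp
  qed
  then show ?thesis
    by (simp only: cl_mult_basis S cl_mult_scale_left vector_smult_component) (simp add: mult_ac)
qed

text \<open>Left multiplication by e_j e_k permutes the basis up to sign through the involution D to
  {j,k} \<triangle> D. Reindexing by it moves the bivector to the other argument, and
  \<open>cl_sign_pair\<close> supplies the sign.\<close>

lemma cl_inner_bivector:
  assumes "j \<noteq> k"
  shows "cl_inner (cl_gen j \<odot> cl_gen k \<odot> u) v = - cl_inner u (cl_gen j \<odot> cl_gen k \<odot> v)"
proof -
  let ?S = "{j, k}"
  have "cl_inner (cl_gen j \<odot> cl_gen k \<odot> u) v =
     (\<Sum>D\<in>UNIV. cl_sign {j} {k} * cl_sign ?S (sym_diff ?S D) * cnj (u $ sym_diff ?S D) * v $ D)"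
    unfolding cl_inner_def cl_bivector_nth[OF assms] by (simp add: cnj_cl_sign)
  also have "\<dots> = (\<Sum>D\<in>UNIV. cl_sign {j} {k} * cl_sign ?S D * cnj (u $ D) * v $ sym_diff ?S D)"
    by (rule sum.reindex_bij_witness[of _ "sym_diff ?S" "sym_diff ?S"])
      (auto intro!: arg_cong[where f = "vec_nth v"])
  also have "\<dots> = - cl_inner u (cl_gen j \<odot> cl_gen k \<odot> v)"
    unfolding cl_inner_def cl_bivector_nth[OF assms] cl_sign_pair[OF assms]
    by (simp add: sum_negf[symmetric] mult_ac)
  finally show ?thesis .
qed

section \<open>Tensors of rank n, the polynomials they represent, and \<Gamma> on them\<close>

definition multi_idx :: "nat \<Rightarrow> (nat \<Rightarrow> 'n::finite) set"
  where "multi_idx n = PiE {..<n} (\<lambda>_. UNIV)"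

lemma finite_multi_idx [simp]: "finite (multi_idx n :: (nat \<Rightarrow> 'n::finite) set)"
  by (simp add: multi_idx_def finite_PiE)

definition mon :: "nat \<Rightarrow> real ^ 'n \<Rightarrow> (nat \<Rightarrow> 'n) \<Rightarrow> real"
  where "mon n y \<phi> = (\<Prod>i<n. y $ \<phi> i)"

lemma sum_prod_multi_idx:
  fixes g :: "'n::finite \<Rightarrow> 'a::comm_semiring_1"
  shows "(\<Sum>\<phi>\<in>multi_idx n. \<Prod>i<n. g (\<phi> i)) = (\<Sum>j\<in>UNIV. g j) ^ n"
  using prod_sum_PiE[of "{..<n}" "\<lambda>_. UNIV" "\<lambda>_. g"] by (simp add: multi_idx_def)

text \<open>Because index tuples are ordered and repeated, no multinomial weights occur:
  \<open>mon n y\<close> is the n-th tensor power of y, and the case x = y gives its norm |y|^n. The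
  price is that a polynomial is represented by many tensors.\<close>

lemma sum_mon_mult: "(\<Sum>\<phi>\<in>multi_idx n. mon n x \<phi> * mon n y \<phi>) = (x \<bullet> y) ^ n"
  by (simp add: mon_def prod.distrib[symmetric] sum_prod_multi_idx[of "\<lambda>j. x $ j * y $ j"] inner_vec_def)

lemma abs_mon_le: "\<bar>mon n x \<phi>\<bar> \<le> norm x ^ n"
  unfolding mon_def abs_prod
  by (rule order_trans[OF prod_mono[where g = "\<lambda>_. norm x"]])
    (auto simp: component_le_norm_cart)

type_synonym ('a, 'n) tensor = "(nat \<Rightarrow> 'n) \<Rightarrow> ('a, 'n) clifford"

definition tensor_poly :: "nat \<Rightarrow> (complex, 'n::finite) tensor \<Rightarrow> real ^ 'n \<Rightarrow> (complex, 'n) clifford"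
  where "tensor_poly n T y = (\<Sum>\<phi>\<in>multi_idx n. mon n y \<phi> *\<^sub>R T \<phi>)"

text \<open>
  On tensors \<open>y\<^sub>j \<partial>\<^sub>k\<close> is the sum over all slots \<open>i\<close> of the operators \<open>slot_subst i j k\<close>.
\<close>

definition slot_subst :: "nat \<Rightarrow> 'n::finite \<Rightarrow> 'n \<Rightarrow> ('a::zero, 'n) tensor \<Rightarrow> ('a, 'n) tensor"
  where "slot_subst i j k T \<phi> = (if \<phi> i = j then T (\<phi>(i := k)) else 0)"

definition tensor_Gamma ::
    "nat \<Rightarrow> (complex, 'n::{finite,linorder}) tensor \<Rightarrow> (complex, 'n) tensor"
  where "tensor_Gamma n T \<phi> = - (\<Sum>(j, k)\<in>{(j, k). j < k}.
    cl_gen j \<odot> cl_gen k \<odot> (\<Sum>i<n. slot_subst i j k T \<phi> - slot_subst i k j T \<phi>))"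

text \<open>Overwriting slot i is a bijection between the tuples with j there and those with k
  there. This single change of variables serves both for the action of y_j \<partial>_k on
  coefficients and for its adjoint.\<close>

lemma sum_slot_reindex:
  fixes H :: "(nat \<Rightarrow> 'n::finite) \<Rightarrow> (nat \<Rightarrow> 'n) \<Rightarrow> 'b::comm_monoid_add"
  assumes "i < n"
  shows "(\<Sum>\<psi>\<in>multi_idx n. if \<psi> i = j then H \<psi> (\<psi>(i := k)) else 0) =
    (\<Sum>\<phi>\<in>multi_idx n. if \<phi> i = k then H (\<phi>(i := j)) \<phi> else 0)"
proof -
  have upd: "\<phi>(i := l) \<in> multi_idx n" if "\<phi> \<in> multi_idx n" for \<phi> :: "nat \<Rightarrow> 'n" and l
    using that assms by (auto simp: multi_idx_def PiE_iff extensional_def)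
  show ?thesis
    unfolding sum.inter_filter[OF finite_multi_idx, symmetric]
    by (rule sum.reindex_bij_witness[of _ "\<lambda>\<phi>. \<phi>(i := j)" "\<lambda>\<psi>. \<psi>(i := k)"]) (auto simp: upd)
qed

lemma has_derivative_mon:
  "((\<lambda>y. mon n y \<phi>) has_derivative
    (\<lambda>v. \<Sum>i<n. v $ \<phi> i * (\<Prod>l\<in>{..<n} - {i}. y $ \<phi> l))) (at y)"
  unfolding mon_def
  by (rule has_derivative_prod) (intro bounded_linear_imp_has_derivative bounded_linear_vec_nth)

lemma partial_deriv_tensor_poly:
  "partial_deriv k (tensor_poly n T) y =
    (\<Sum>\<phi>\<in>multi_idx n. \<Sum>i<n.
      if \<phi> i = k then (\<Prod>l\<in>{..<n} - {i}. y $ \<phi> l) *\<^sub>R T \<phi> else 0)"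
proof -
  have "(tensor_poly n T has_derivative (\<lambda>v. \<Sum>\<phi>\<in>multi_idx n.
      (\<Sum>i<n. v $ \<phi> i * (\<Prod>l\<in>{..<n} - {i}. y $ \<phi> l)) *\<^sub>R T \<phi>)) (at y)"
    unfolding tensor_poly_def[abs_def]
    by (intro has_derivative_sum has_derivative_scaleR_left has_derivative_mon)
  then have "partial_deriv k (tensor_poly n T) y = (\<Sum>\<phi>\<in>multi_idx n.
      (\<Sum>i<n. axis k 1 $ \<phi> i * (\<Prod>l\<in>{..<n} - {i}. y $ \<phi> l)) *\<^sub>R T \<phi>)"
    by (simp add: partial_deriv_def frechet_derivative_at[symmetric])
  also have "\<dots> = (\<Sum>\<phi>\<in>multi_idx n. \<Sum>i<n.
      if \<phi> i = k then (\<Prod>l\<in>{..<n} - {i}. y $ \<phi> l) *\<^sub>R T \<phi> else 0)"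
    by (simp add: scaleR_sum_left axis_def if_distrib[where f = "\<lambda>x. x * _"] 
        if_distrib[where f = "\<lambda>x. x *\<^sub>R _"] eq_commute[of k] cong: if_cong)
  finally show ?thesis .
qed

text \<open>By the product rule \<partial>_k deletes, one at a time, each slot that carries k, and
  the factor y_j refills that slot with j. Reindexing shifts this substitution from the monomials to
  the coefficients, where it goes the other way.\<close>

lemma mult_partial_deriv_tensor_poly:
  fixes T :: "(complex, 'n::{finite,linorder}) tensor"
  shows "y $ j *\<^sub>R partial_deriv k (tensor_poly n T) y = (\<Sum>i<n. tensor_poly n (slot_subst i j k T) y)"
proof -
  have "y $ j *\<^sub>R partial_deriv k (tensor_poly n T) y =
     (\<Sum>\<phi>\<in>multi_idx n. \<Sum>i<n. if \<phi> i = k then mon n y (\<phi>(i := j)) *\<^sub>R T \<phi> else 0)"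
    unfolding partial_deriv_tensor_poly scaleR_sum_right
  proof (intro sum.cong refl)
    fix \<phi> :: "nat \<Rightarrow> 'n" and i assume "i \<in> {..<n}"
    have "mon n y (\<phi>(i := j)) = y $ j * (\<Prod>l\<in>{..<n} - {i}. y $ \<phi> l)"
      unfolding mon_def using \<open>i \<in> {..<n}\<close>
      by (subst prod.remove[of _ i]) (auto intro!: prod.cong)
    then show "y $ j *\<^sub>R (if \<phi> i = k then (\<Prod>l\<in>{..<n} - {i}. y $ \<phi> l) *\<^sub>R T \<phi> else 0) =
        (if \<phi> i = k then mon n y (\<phi>(i := j)) *\<^sub>R T \<phi> else 0)"
      by simp
  qed
  also have "\<dots> = (\<Sum>i<n. \<Sum>\<phi>\<in>multi_idx n. if \<phi> i = k then mon n y (\<phi>(i := j)) *\<^sub>R T \<phi> else 0)"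
    by (rule sum.swap)
  also have "\<dots> = (\<Sum>i<n. \<Sum>\<psi>\<in>multi_idx n. if \<psi> i = j then mon n y \<psi> *\<^sub>R T (\<psi>(i := k)) else 0)"
    by (intro sum.cong refl sum_slot_reindex[symmetric, where H = "\<lambda>\<psi> \<phi>. mon n y \<psi> *\<^sub>R T \<phi>"]) simp
  also have "\<dots> = (\<Sum>i<n. tensor_poly n (slot_subst i j k T) y)"
    unfolding tensor_poly_def slot_subst_def by (intro sum.cong refl) auto
  finally show ?thesis .
qed

lemma cl_Gamma_tensor_poly:
  fixes T :: "(complex, 'n::{finite,linorder}) tensor"
  shows "cl_Gamma (tensor_poly n T) = tensor_poly n (tensor_Gamma n T)"
proof
  fix y :: "(real, 'n) vec"
  have diff: "tensor_poly n (\<lambda>\<phi>. f \<phi> - g \<phi>) y = tensor_poly n f y - tensor_poly n g y" for f g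
    by (simp add: tensor_poly_def scaleR_diff_right sum_subtractf)
  have sum: "tensor_poly n (\<lambda>\<phi>. \<Sum>i\<in>I. f i \<phi>) y = (\<Sum>i\<in>I. tensor_poly n (f i) y)" for f and I :: "'k set"
    by (simp add: tensor_poly_def scaleR_sum_right sum.swap[of _ I])
  have neg: "tensor_poly n (\<lambda>\<phi>. - f \<phi>) y = - tensor_poly n f y" for f
    by (simp add: tensor_poly_def sum_negf)
  have mult: "tensor_poly n (\<lambda>\<phi>. b \<odot> f \<phi>) y = b \<odot> tensor_poly n f y" for b f
    by (simp add: tensor_poly_def cl_mult.sum_right cl_mult.scaleR_right)
  show "cl_Gamma (tensor_poly n T) y = tensor_poly n (tensor_Gamma n T) y"
    unfolding cl_Gamma_def mult_partial_deriv_tensor_poly tensor_Gamma_def[abs_def] neg sum case_prod_unfold mult diff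
    by (simp add: sum_subtractf)
qed

lemma cl_Gamma_funpow_tensor_poly:
  "(cl_Gamma ^^ k) (tensor_poly n T) = tensor_poly n ((tensor_Gamma n ^^ k) T)"
  by (induction k) (simp_all add: cl_Gamma_tensor_poly)

definition tensor_inner :: "nat \<Rightarrow> (complex, 'n::finite) tensor \<Rightarrow> (complex, 'n) tensor \<Rightarrow> complex"
  where "tensor_inner n S T = (\<Sum>\<phi>\<in>multi_idx n. cl_inner (S \<phi>) (T \<phi>))"

lemma cl_inner_add_left: "cl_inner (u + v) w = cl_inner u w + cl_inner v w"
  and cl_inner_add_right: "cl_inner u (v + w) = cl_inner u v + cl_inner u w"
  and cl_inner_diff_left: "cl_inner (u - v) w = cl_inner u w - cl_inner v w"
  and cl_inner_diff_right: "cl_inner u (v - w) = cl_inner u v - cl_inner u w"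
  and cl_inner_minus_left: "cl_inner (- u) v = - cl_inner u v"
  and cl_inner_minus_right: "cl_inner u (- v) = - cl_inner u v"
  and cl_inner_zero_left [simp]: "cl_inner 0 v = 0"
  and cl_inner_zero_right [simp]: "cl_inner u 0 = 0"
  by (simp_all add: cl_inner_def sum.distrib sum_subtractf sum_negf algebra_simps)

lemma cl_inner_sum_left: "cl_inner (sum f I) v = (\<Sum>i\<in>I. cl_inner (f i) v)"
  and cl_inner_sum_right: "cl_inner u (sum f I) = (\<Sum>i\<in>I. cl_inner u (f i))"
  by (induction I rule: infinite_finite_induct) (simp_all add: cl_inner_add_left cl_inner_add_right)

lemma tensor_inner_slot_subst:
  assumes "i < n"
  shows "tensor_inner n (slot_subst i j k S) T = tensor_inner n S (slot_subst i k j T)"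
proof -
  have "tensor_inner n (slot_subst i j k S) T =
     (\<Sum>\<psi>\<in>multi_idx n. if \<psi> i = j then cl_inner (S (\<psi>(i := k))) (T \<psi>) else 0)"
    unfolding tensor_inner_def slot_subst_def by (intro sum.cong) auto
  also have "\<dots> = (\<Sum>\<phi>\<in>multi_idx n. if \<phi> i = k then cl_inner (S \<phi>) (T (\<phi>(i := j))) else 0)"
    by (rule sum_slot_reindex[OF assms, where H = "\<lambda>\<psi> \<phi>. cl_inner (S \<phi>) (T \<psi>)"])
  also have "\<dots> = tensor_inner n S (slot_subst i k j T)"
    unfolding tensor_inner_def slot_subst_def by (intro sum.cong) auto
  finally show ?thesis .
qed

text \<open>Two minus signs cancel. Bivectors are skew for \<open>cl_inner\<close>, and the
  difference of the two slot operators is skew because \<open>slot_subst i j k\<close> has adjoint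
  \<open>slot_subst i k j\<close>; the two kinds of operators commute.\<close>

lemma tensor_inner_Gamma:
  "tensor_inner n (tensor_Gamma n S) T = tensor_inner n S (tensor_Gamma n T)"
proof -
  let ?P = "{(j, k). j < k} :: ('a \<times> 'a) set"
  let ?B = "\<lambda>p v. cl_gen (fst p) \<odot> cl_gen (snd p) \<odot> v"
  have "tensor_inner n (tensor_Gamma n S) T = (\<Sum>p\<in>?P. \<Sum>i<n.
      tensor_inner n (slot_subst i (fst p) (snd p) S) (\<lambda>\<phi>. ?B p (T \<phi>))
      - tensor_inner n (slot_subst i (snd p) (fst p) S) (\<lambda>\<phi>. ?B p (T \<phi>)))"
    unfolding tensor_inner_def tensor_Gamma_def case_prod_unfold cl_inner_minus_left
      cl_inner_sum_left sum_subtractf[symmetric] sum_negf[symmetric] sum.swap[of _ _ "multi_idx n"]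
    by (intro sum.cong refl)
      (auto simp: cl_inner_bivector cl_inner_sum_left cl_inner_diff_left intro: sum.swap)
  also have "\<dots> = (\<Sum>p\<in>?P. \<Sum>i<n.
      tensor_inner n S (slot_subst i (snd p) (fst p) (\<lambda>\<phi>. ?B p (T \<phi>)))
      - tensor_inner n S (slot_subst i (fst p) (snd p) (\<lambda>\<phi>. ?B p (T \<phi>))))"
    by (simp add: tensor_inner_slot_subst)
  also have "\<dots> = tensor_inner n S (tensor_Gamma n T)"
    unfolding tensor_inner_def tensor_Gamma_def case_prod_unfold cl_inner_minus_right
      cl_inner_sum_right cl_mult.sum_right cl_mult.diff_right cl_inner_diff_right
      sum_subtractf[symmetric] sum_negf[symmetric] sum.swap[of _ _ "multi_idx n"]
    by (intro sum.cong refl) (auto simp: slot_subst_def cl_mult.zero_right intro!: sum.cong trans[OF sum.swap])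
  finally show ?thesis .
qed

lemma tensor_inner_Gamma_funpow:
  "tensor_inner n ((tensor_Gamma n ^^ k) S) ((tensor_Gamma n ^^ l) T) =
    tensor_inner n S ((tensor_Gamma n ^^ (k + l)) T)"
proof (induction k arbitrary: l)
  case (Suc k)
  then show ?case
    using Suc[of "Suc l"] by (simp add: tensor_inner_Gamma)
qed simp

lemma tensor_inner_self: "tensor_inner n T T = of_real (\<Sum>\<phi>\<in>multi_idx n. (norm (T \<phi>))\<^sup>2)"
  by (simp add: tensor_inner_def cl_inner_self)

text \<open>Cauchy-Schwarz against the n-th tensor power of y, whose norm is exactly |y|^n.\<close>

lemma norm_tensor_poly_le:
  "norm (tensor_poly n T y) \<le> norm y ^ n * sqrt (\<Sum>\<phi>\<in>multi_idx n. (norm (T \<phi>))\<^sup>2)"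
proof -
  have "norm (tensor_poly n T y) \<le> (\<Sum>\<phi>\<in>multi_idx n. \<bar>mon n y \<phi>\<bar> * \<bar>norm (T \<phi>)\<bar>)"
    unfolding tensor_poly_def by (rule order_trans[OF norm_sum]) simp
  also have "\<dots> \<le> L2_set (mon n y) (multi_idx n) * L2_set (\<lambda>\<phi>. norm (T \<phi>)) (multi_idx n)"
    by (rule L2_set_mult_ineq)
  also have "L2_set (mon n y) (multi_idx n) = norm y ^ n"
    using sum_mon_mult[of n y y]
    by (simp add: L2_set_def power2_eq_square norm_eq_sqrt_inner real_sqrt_power)
  finally show ?thesis by (simp add: L2_set_def)
qed

text \<open>An auxiliary norm for crude estimates at fixed rank, such as convergence of the
  exponential series. The estimates uniform in n use the Euclidean norm instead.\<close>

definition tensor_l1 :: "nat \<Rightarrow> (complex, 'n::finite) tensor \<Rightarrow> real"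
  where "tensor_l1 n T = (\<Sum>\<phi>\<in>multi_idx n. norm (T \<phi>))"

lemma norm_le_tensor_l1: "\<phi> \<in> multi_idx n \<Longrightarrow> norm (T \<phi>) \<le> tensor_l1 n T"
  unfolding tensor_l1_def by (rule member_le_sum) auto

lemma tensor_l1_nonneg: "tensor_l1 n T \<ge> 0"
  by (simp add: tensor_l1_def sum_nonneg)

lemma tensor_l1_Gamma_bound:
  "\<exists>M. M > 0 \<and> (\<forall>T :: (complex, 'n::{finite,linorder}) tensor.
    tensor_l1 n (tensor_Gamma n T) \<le> M * tensor_l1 n T)"
proof -
  let ?P = "{(j, k). j < k} :: ('n \<times> 'n) set"
  let ?\<Phi> = "multi_idx n :: (nat \<Rightarrow> 'n) set"
  obtain K where K: "K > 0" "\<And>u v :: (complex, 'n) clifford. norm (u \<odot> v) \<le> norm u * norm v * K"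
    using cl_mult.pos_bounded by blast
  define N where "N = (\<lambda>p :: 'n \<times> 'n. norm (cl_gen (fst p) \<odot> cl_gen (snd p) :: (complex, 'n) clifford))"
  define M where "M = real (card ?\<Phi>) * (\<Sum>p\<in>?P. N p * K * (real n * 2))"
  have M0: "M \<ge> 0"
    using K by (auto simp: M_def N_def intro!: mult_nonneg_nonneg sum_nonneg)
  show ?thesis
  \<comment> \<open>M vanishes for n = 0, while a positive constant is claimed.\<close>
  proof (intro exI[of _ "M + 1"] conjI allI)
    show "M + 1 > 0" using M0 by simp
    fix T :: "(complex, 'n) tensor"
    have subst: "norm (slot_subst i j k T \<phi>) \<le> tensor_l1 n T" if "\<phi> \<in> ?\<Phi>" "i < n" for i j k \<phi>
    proof -
      have "\<phi>(i := k) \<in> ?\<Phi>"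
        using that by (auto simp: multi_idx_def PiE_iff extensional_def)
      then show ?thesis
        by (auto simp: slot_subst_def tensor_l1_nonneg norm_le_tensor_l1)
    qed
    have "norm (tensor_Gamma n T \<phi>) \<le> (\<Sum>p\<in>?P. N p * K * (real n * 2)) * tensor_l1 n T"
      if \<phi>: "\<phi> \<in> ?\<Phi>" for \<phi>
      unfolding tensor_Gamma_def norm_minus_cancel case_prod_unfold sum_distrib_right
    proof (rule order_trans[OF norm_sum sum_mono])
      fix p
      let ?v = "\<Sum>i<n. slot_subst i (fst p) (snd p) T \<phi> - slot_subst i (snd p) (fst p) T \<phi>"
      have "norm ?v \<le> (\<Sum>i<n. 2 * tensor_l1 n T)"
        unfolding mult_2
        by (intro order_trans[OF norm_sum sum_mono] order_trans[OF norm_triangle_ineq4] add_mono subst[OF \<phi>]) auto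
      also have "\<dots> = real n * 2 * tensor_l1 n T" by simp
      finally have "N p * norm ?v * K \<le> N p * (real n * 2 * tensor_l1 n T) * K"
        using K(1) by (intro mult_right_mono mult_left_mono) (auto simp: N_def)
      then show "norm (cl_gen (fst p) \<odot> cl_gen (snd p) \<odot> ?v)
          \<le> N p * K * (real n * 2) * tensor_l1 n T"
        using K(2)[of "cl_gen (fst p) \<odot> cl_gen (snd p)" ?v] by (simp add: N_def mult_ac)
    qed
    then have "tensor_l1 n (tensor_Gamma n T) \<le>
        (\<Sum>\<phi>\<in>?\<Phi>. (\<Sum>p\<in>?P. N p * K * (real n * 2)) * tensor_l1 n T)"
      unfolding tensor_l1_def[of n "tensor_Gamma n T"] by (rule sum_mono)
    also have "\<dots> = M * tensor_l1 n T" by (simp add: M_def)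
    finally show "tensor_l1 n (tensor_Gamma n T) \<le> (M + 1) * tensor_l1 n T"
      using tensor_l1_nonneg[of n T] by (simp add: algebra_simps)
  qed
qed

definition Gamma_bound :: "'n::{finite,linorder} itself \<Rightarrow> nat \<Rightarrow> real"
  where "Gamma_bound _ n = (SOME M. M > 0 \<and>
    (\<forall>T :: (complex, 'n) tensor. tensor_l1 n (tensor_Gamma n T) \<le> M * tensor_l1 n T))"

lemma tensor_l1_Gamma_funpow:
  fixes T :: "(complex, 'n::{finite,linorder}) tensor"
  shows "tensor_l1 n ((tensor_Gamma n ^^ k) T) \<le> Gamma_bound TYPE('n) n ^ k * tensor_l1 n T"
    and Gamma_bound_pos: "Gamma_bound TYPE('n) n > 0"
proof -
  let ?M = "Gamma_bound TYPE('n) n"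
  have M: "?M > 0 \<and> (\<forall>T :: (complex, 'n) tensor. tensor_l1 n (tensor_Gamma n T) \<le> ?M * tensor_l1 n T)"
    unfolding Gamma_bound_def by (rule someI_ex) (metis tensor_l1_Gamma_bound)
  then show "?M > 0" by blast
  show "tensor_l1 n ((tensor_Gamma n ^^ k) T) \<le> ?M ^ k * tensor_l1 n T"
  proof (induction k)
    case (Suc k)
    have "tensor_l1 n ((tensor_Gamma n ^^ Suc k) T) \<le> ?M * tensor_l1 n ((tensor_Gamma n ^^ k) T)"
      using M by simp
    also have "\<dots> \<le> ?M * (?M ^ k * tensor_l1 n T)"
      using M Suc by (intro mult_left_mono) auto
    finally show ?case by (simp add: mult_ac)
  qed simp
qed

text \<open>
  Shifting the sequence differentiates its exponential generating function, so Taylor's formula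
  gives the group law of \<open>e\<^bsup>t\<Gamma>\<^esub>\<close>.
\<close>

definition egf :: "(nat \<Rightarrow> complex) \<Rightarrow> complex \<Rightarrow> complex"
  where "egf a t = (\<Sum>l. t ^ l / fact l * a l)"

definition geom_bounded :: "(nat \<Rightarrow> complex) \<Rightarrow> bool"
  where "geom_bounded a \<longleftrightarrow> (\<exists>C M. M \<ge> 0 \<and> (\<forall>j. norm (a j) \<le> C * M ^ j))"

lemma geom_bounded_shift:
  assumes "geom_bounded a"
  shows "geom_bounded (\<lambda>j. a (k + j))"
proof -
  obtain C M where "M \<ge> 0" "\<And>j. norm (a j) \<le> C * M ^ j"
    using assms by (auto simp: geom_bounded_def)
  then have "\<forall>j. norm (a (k + j)) \<le> (C * M ^ k) * M ^ j"
    by (metis power_add mult.assoc)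
  then show ?thesis
    using \<open>M \<ge> 0\<close> unfolding geom_bounded_def by blast
qed

lemma egf_norm_summable:
  assumes "geom_bounded a"
  shows "summable (\<lambda>l. norm (t ^ l / fact l * a l))"
proof -
  obtain C M where M: "M \<ge> 0" "\<And>j. norm (a j) \<le> C * M ^ j"
    using assms by (auto simp: geom_bounded_def)
  have "summable (\<lambda>l. C * ((norm t * M) ^ l /\<^sub>R fact l))"
    by (intro summable_mult summable_exp_generic)
  then show ?thesis
  proof (rule summable_comparison_test_ev[rotated], intro always_eventually allI)
    fix l
    have "norm t ^ l / fact l * norm (a l) \<le> norm t ^ l / fact l * (C * M ^ l)"
      by (intro mult_left_mono M) auto
    then show "norm (norm (t ^ l / fact l * a l)) \<le> C * ((norm t * M) ^ l /\<^sub>R fact l)"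
      by (simp add: norm_mult norm_divide norm_power power_mult_distrib field_simps)
  qed
qed

lemma egf_sums:
  "geom_bounded a \<Longrightarrow> (\<lambda>l. t ^ l / fact l * a l) sums egf a t"
  unfolding egf_def by (intro summable_sums summable_norm_cancel[OF egf_norm_summable])

lemma egf_0 [simp]: "egf a 0 = a 0"
  unfolding egf_def using suminf_finite[of "{0}" "\<lambda>l. 0 ^ l / fact l * a l"] by auto

lemma DERIV_egf:
  assumes "geom_bounded a"
  shows "(egf a has_field_derivative egf (\<lambda>j. a (Suc j)) t) (at t)"
proof -
  let ?c = "\<lambda>l. a l / fact l"
  have eq: "egf b = (\<lambda>t. \<Sum>l. b l / fact l * t ^ l)" for b
    by (auto simp: egf_def mult_ac fun_eq_iff)
  have "summable (\<lambda>l. ?c l * t ^ l)" for t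
    using summable_norm_cancel[OF egf_norm_summable[OF assms, of t]] by (simp add: mult_ac)
  then have "((\<lambda>t. \<Sum>l. ?c l * t ^ l) has_field_derivative (\<Sum>l. diffs ?c l * t ^ l)) (at t)"
    by (rule termdiffs_strong_converges_everywhere)
  also have "(\<lambda>l. diffs ?c l * t ^ l) = (\<lambda>l. t ^ l / fact l * a (Suc l))"
    by (auto simp: diffs_def fun_eq_iff field_simps simp del: of_nat_Suc)
  finally show ?thesis
    by (simp only: eq[of a] egf_def[of "\<lambda>j. a (Suc j)"])
qed

lemma higher_deriv_egf:
  assumes "geom_bounded a"
  shows "(deriv ^^ k) (egf a) = egf (\<lambda>j. a (k + j))"
proof (induction k)
  case (Suc k)
  have "deriv (egf (\<lambda>j. a (k + j))) = egf (\<lambda>j. a (k + Suc j))"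
    using DERIV_egf[OF geom_bounded_shift[OF assms, of k]] by (intro ext DERIV_imp_deriv)
  then show ?case using Suc by simp
qed simp

lemma egf_add_sums:
  assumes "geom_bounded a"
  shows "(\<lambda>k. s ^ k / fact k * egf (\<lambda>j. a (k + j)) t) sums egf a (s + t)"
proof -
  have hol: "egf a holomorphic_on ball t (norm s + 1)"
    unfolding holomorphic_on_def using DERIV_egf[OF assms]
    by (meson field_differentiable_at_within field_differentiable_def)
  have "(\<lambda>n. (deriv ^^ n) (egf a) t / fact n * (s + t - t) ^ n) sums egf a (s + t)"
    by (rule holomorphic_power_series[OF hol]) (simp add: dist_norm)
  then show ?thesis
    by (simp add: higher_deriv_egf[OF assms] mult_ac)
qed

section \<open>The exponential of \<Gamma> on tensors\<close>

definition tensor_exp ::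
    "complex \<Rightarrow> nat \<Rightarrow> (complex, 'n::{finite,linorder}) tensor \<Rightarrow> (complex, 'n) tensor"
  where "tensor_exp t n T \<phi> = (\<Sum>k. (t ^ k / fact k) *s (tensor_Gamma n ^^ k) T \<phi>)"

lemma norm_Gamma_funpow_le:
  fixes T :: "(complex, 'n::{finite,linorder}) tensor"
  assumes "\<phi> \<in> multi_idx n"
  shows "norm ((tensor_Gamma n ^^ k) T \<phi>) \<le> Gamma_bound TYPE('n) n ^ k * tensor_l1 n T"
  using norm_le_tensor_l1[OF assms] tensor_l1_Gamma_funpow order_trans by blast

lemma geom_bounded_Gamma:
  fixes T :: "(complex, 'n::{finite,linorder}) tensor"
  assumes "\<phi> \<in> multi_idx n"
  shows "geom_bounded (\<lambda>k. (tensor_Gamma n ^^ k) T \<phi> $ A)"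
proof -
  have "norm ((tensor_Gamma n ^^ k) T \<phi> $ A) \<le> tensor_l1 n T * Gamma_bound TYPE('n) n ^ k" for k
    using norm_Gamma_funpow_le[OF assms, of k T] Finite_Cartesian_Product.norm_nth_le[of "(tensor_Gamma n ^^ k) T \<phi>" A]
    by (simp add: mult_ac)
  then show ?thesis
    using Gamma_bound_pos[where 'n = 'n, of n] unfolding geom_bounded_def by (meson less_imp_le)
qed

lemma vec_sums_iff: "f sums v \<longleftrightarrow> (\<forall>A. (\<lambda>n. f n $ A) sums (v $ A))"
  for v :: "complex ^ 'k"
  unfolding sums_def
  by (auto intro: vec_tendstoI dest: tendsto_vec_nth simp flip: sum_component)

lemma tensor_exp_sums:
  assumes "\<phi> \<in> multi_idx n"
  shows "(\<lambda>k. (t ^ k / fact k) *s (tensor_Gamma n ^^ k) T \<phi>) sums tensor_exp t n T \<phi>"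
proof -
  have "(\<lambda>k. (t ^ k / fact k) *s (tensor_Gamma n ^^ k) T \<phi>) sums
      (\<chi> A. egf (\<lambda>k. (tensor_Gamma n ^^ k) T \<phi> $ A) t)"
    using egf_sums[OF geom_bounded_Gamma[OF assms]] by (simp add: vec_sums_iff)
  then show ?thesis
    by (simp add: tensor_exp_def sums_iff)
qed

lemma tensor_exp_nth:
  assumes "\<phi> \<in> multi_idx n"
  shows "tensor_exp t n T \<phi> $ A = egf (\<lambda>k. (tensor_Gamma n ^^ k) T \<phi> $ A) t"
  using tensor_exp_sums[OF assms, of t T] egf_sums[OF geom_bounded_Gamma[OF assms], of t T A]
  by (auto simp: vec_sums_iff dest!: spec[of _ A] intro: sums_unique2)

lemma tensor_poly_sums:
  assumes "\<And>\<phi>. \<phi> \<in> multi_idx n \<Longrightarrow> (\<lambda>k. c k *s f k \<phi>) sums T \<phi>"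
  shows "(\<lambda>k. c k *s tensor_poly n (f k) y) sums tensor_poly n T y"
proof -
  have "c k *s tensor_poly n (f k) y = (\<Sum>\<phi>\<in>multi_idx n. mon n y \<phi> *\<^sub>R (c k *s f k \<phi>))" for k
    by (simp add: tensor_poly_def vec_eq_iff sum_distrib_left)
  moreover have "(\<lambda>k. \<Sum>\<phi>\<in>multi_idx n. mon n y \<phi> *\<^sub>R (c k *s f k \<phi>)) sums tensor_poly n T y"
    unfolding tensor_poly_def
    by (intro sums_sum bounded_linear.sums[OF bounded_linear_scaleR_right] assms)
  ultimately show ?thesis by simp
qed

lemma tensor_poly_exp_sums:
  "(\<lambda>k. (t ^ k / fact k) *s tensor_poly n ((tensor_Gamma n ^^ k) T) y) sums
    tensor_poly n (tensor_exp t n T) y"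
  by (intro tensor_poly_sums tensor_exp_sums)

lemma cl_exp_Gamma_tensor_poly:
  "cl_exp_Gamma t (tensor_poly n T) y = tensor_poly n (tensor_exp t n T) y"
  using tensor_poly_exp_sums[of t n T y]
  by (simp add: cl_exp_Gamma_def cl_Gamma_funpow_tensor_poly sums_iff)

lemma tensor_inner_nth: "tensor_inner n S T = (\<Sum>\<phi>\<in>multi_idx n. \<Sum>A\<in>UNIV. cnj (S \<phi> $ A) * T \<phi> $ A)"
  by (simp add: tensor_inner_def cl_inner_def)

text \<open>\<open>\<Gamma>\<close> is hermitian for the inner product of tensors, so \<open>e\<^bsup>i\<theta>\<Gamma>\<^esub>\<close> is unitary.\<close>

lemma tensor_exp_isometry:
  fixes T :: "(complex, 'n::{finite,linorder}) tensor"
  assumes t: "Re t = 0"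
  shows "(\<Sum>\<phi>\<in>multi_idx n. (norm (tensor_exp t n T \<phi>))\<^sup>2) = (\<Sum>\<phi>\<in>multi_idx n. (norm (T \<phi>))\<^sup>2)"
proof -
  \<comment> \<open>Since \<Gamma> is hermitian, the inner product of \<Gamma>^k T and \<Gamma>^l T
    depends only on k + l. The squared norm of the exponential is therefore the generating function
    of \<open>a\<close> at \<open>cnj t + t\<close>, that is, at 0.\<close>
  define a where "a = (\<lambda>j. tensor_inner n T ((tensor_Gamma n ^^ j) T))"
  have exp_nth: "(\<lambda>k. t ^ k / fact k * (tensor_Gamma n ^^ k) T \<phi> $ A) sums (tensor_exp t n T \<phi> $ A)"
    if "\<phi> \<in> multi_idx n" for \<phi> A
    using tensor_exp_sums[OF that, of t T] by (simp add: vec_sums_iff)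
  have bounded: "geom_bounded a"
  proof -
    have "norm (a j) \<le> (\<Sum>\<phi>\<in>multi_idx n. \<Sum>A\<in>UNIV. norm (T \<phi> $ A) * tensor_l1 n T) * Gamma_bound TYPE('n) n ^ j" for j
      unfolding a_def tensor_inner_nth sum_distrib_right
    proof (intro order_trans[OF norm_sum sum_mono])
      fix \<phi> :: "nat \<Rightarrow> 'n" and A assume \<phi>: "\<phi> \<in> multi_idx n"
      have le: "norm ((tensor_Gamma n ^^ j) T \<phi> $ A) \<le> Gamma_bound TYPE('n) n ^ j * tensor_l1 n T"
        using norm_Gamma_funpow_le[OF \<phi>, of j T] Finite_Cartesian_Product.norm_nth_le[of "(tensor_Gamma n ^^ j) T \<phi>" A] by simp
      show "norm (cnj (T \<phi> $ A) * (tensor_Gamma n ^^ j) T \<phi> $ A)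
          \<le> norm (T \<phi> $ A) * tensor_l1 n T * Gamma_bound TYPE('n) n ^ j"
        using mult_left_mono[OF le, of "norm (T \<phi> $ A)"]
        by (simp add: norm_mult mult_ac)
    qed
    then show ?thesis
      using Gamma_bound_pos[where 'n = 'n, of n] unfolding geom_bounded_def by (meson less_imp_le)
  qed
  \<comment> \<open>Only the second argument is expanded here. Expanding the first one afterwards
    yields precisely the Taylor series at t with increment \<open>cnj t\<close>, so no double series
    is rearranged.\<close>
  have inner: "tensor_inner n ((tensor_Gamma n ^^ k) T) (tensor_exp t n T) = egf (\<lambda>l. a (k + l)) t" for k
  proof -
    have "(\<lambda>l. \<Sum>\<phi>\<in>multi_idx n. \<Sum>A\<in>UNIV. cnj ((tensor_Gamma n ^^ k) T \<phi> $ A) * (t ^ l / fact l * (tensor_Gamma n ^^ l) T \<phi> $ A))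
        sums tensor_inner n ((tensor_Gamma n ^^ k) T) (tensor_exp t n T)"
      unfolding tensor_inner_nth by (intro sums_sum sums_mult exp_nth)
    also have "(\<lambda>l. \<Sum>\<phi>\<in>multi_idx n. \<Sum>A\<in>UNIV. cnj ((tensor_Gamma n ^^ k) T \<phi> $ A) * (t ^ l / fact l * (tensor_Gamma n ^^ l) T \<phi> $ A))
        = (\<lambda>l. t ^ l / fact l * a (k + l))"
    proof
      fix l
      have "a (k + l) = tensor_inner n ((tensor_Gamma n ^^ k) T) ((tensor_Gamma n ^^ l) T)"
        by (simp add: a_def tensor_inner_Gamma_funpow)
      then show "(\<Sum>\<phi>\<in>multi_idx n. \<Sum>A\<in>UNIV. cnj ((tensor_Gamma n ^^ k) T \<phi> $ A) *
          (t ^ l / fact l * (tensor_Gamma n ^^ l) T \<phi> $ A)) = t ^ l / fact l * a (k + l)"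
        by (simp add: tensor_inner_nth sum_distrib_left mult_ac)
    qed
    finally show ?thesis
      using egf_sums[OF geom_bounded_shift[OF bounded]] sums_unique2 by blast
  qed
  have "(\<lambda>k. \<Sum>\<phi>\<in>multi_idx n. \<Sum>A\<in>UNIV. cnj (t ^ k / fact k * (tensor_Gamma n ^^ k) T \<phi> $ A) * tensor_exp t n T \<phi> $ A)
      sums tensor_inner n (tensor_exp t n T) (tensor_exp t n T)"
    unfolding tensor_inner_nth[of n "tensor_exp t n T"]
    by (intro sums_sum sums_mult2 sums_cnj[THEN iffD2] exp_nth)
  also have "(\<lambda>k. \<Sum>\<phi>\<in>multi_idx n. \<Sum>A\<in>UNIV. cnj (t ^ k / fact k * (tensor_Gamma n ^^ k) T \<phi> $ A) * tensor_exp t n T \<phi> $ A)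
      = (\<lambda>k. cnj t ^ k / fact k * egf (\<lambda>l. a (k + l)) t)"
    unfolding inner[symmetric] tensor_inner_nth by (simp add: sum_distrib_left mult_ac)
  finally have "tensor_inner n (tensor_exp t n T) (tensor_exp t n T) = egf a (cnj t + t)"
    using egf_add_sums[OF bounded, of "cnj t" t] sums_unique2 by blast
  also have "cnj t + t = 0" using t by (simp add: complex_eq_iff)
  finally have "tensor_inner n (tensor_exp t n T) (tensor_exp t n T) = tensor_inner n T T"
    by (simp add: a_def)
  then show ?thesis
    unfolding tensor_inner_self of_real_eq_iff .
qed

lemma norm_tensor_poly_exp_le:
  assumes "Re t = 0"
  shows "norm (tensor_poly n (tensor_exp t n T) y) \<le> norm y ^ n * sqrt (\<Sum>\<phi>\<in>multi_idx n. (norm (T \<phi>))\<^sup>2)"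
  using norm_tensor_poly_le[of n "tensor_exp t n T" y] tensor_exp_isometry[OF assms, of n T] by simp

text \<open>An entry of \<open>tensor_Gamma n T\<close> at an index in \<open>multi_idx n\<close>
  involves finitely many entries of T, all at such indices, so \<Gamma> passes through entrywise
  convergent series.\<close>

lemma tensor_Gamma_sums:
  fixes T :: "(complex, 'n::{finite,linorder}) tensor"
  assumes f: "\<And>\<phi>. \<phi> \<in> multi_idx n \<Longrightarrow> (\<lambda>k. c k *s f k \<phi>) sums T \<phi>" and \<phi>: "\<phi> \<in> multi_idx n"
  shows "(\<lambda>k. c k *s tensor_Gamma n (f k) \<phi>) sums tensor_Gamma n T \<phi>"
proof -
  have subst: "(\<lambda>k. c k *s slot_subst i j l (f k) \<phi>) sums slot_subst i j l T \<phi>" if "i < n" for i j l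
  proof -
    have "\<phi>(i := l) \<in> multi_idx n"
      using that \<phi> by (auto simp: multi_idx_def PiE_iff extensional_def)
    then show ?thesis by (auto simp: slot_subst_def f)
  qed
  have "(\<lambda>k. - (\<Sum>(j, l)\<in>{(j, l). j < l}. cl_gen j \<odot> cl_gen l \<odot>
      (\<Sum>i<n. c k *s slot_subst i j l (f k) \<phi> - c k *s slot_subst i l j (f k) \<phi>))) sums tensor_Gamma n T \<phi>"
    unfolding tensor_Gamma_def case_prod_unfold
    by (intro sums_minus sums_sum bounded_linear.sums[OF cl_mult.bounded_linear_right] sums_diff subst) auto
  also have "(\<lambda>k. - (\<Sum>(j, l)\<in>{(j, l). j < l}. cl_gen j \<odot> cl_gen l \<odot>
      (\<Sum>i<n. c k *s slot_subst i j l (f k) \<phi> - c k *s slot_subst i l j (f k) \<phi>))) =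
      (\<lambda>k. c k *s tensor_Gamma n (f k) \<phi>)"
    by (simp only: tensor_Gamma_def case_prod_unfold vec.scale_minus_right vec.scale_sum_right
        cl_mult_scale_right[symmetric] vec.scale_right_diff_distrib)
  finally show ?thesis .
qed

lemma tensor_Gamma_funpow_sums:
  fixes T :: "(complex, 'n::{finite,linorder}) tensor"
  assumes f: "\<And>\<phi>. \<phi> \<in> multi_idx n \<Longrightarrow> (\<lambda>k. c k *s f k \<phi>) sums T \<phi>" and \<phi>: "\<phi> \<in> multi_idx n"
  shows "(\<lambda>k. c k *s (tensor_Gamma n ^^ l) (f k) \<phi>) sums (tensor_Gamma n ^^ l) T \<phi>"
  using \<phi>
proof (induction l arbitrary: \<phi>)
  case (Suc l)
  show ?case
    unfolding funpow.simps o_def by (rule tensor_Gamma_sums[OF Suc.IH Suc.prems])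
qed (use f in simp)

text \<open>Since \<open>e\<^bsup>-t\<Gamma>\<^esub> e\<^bsup>t\<Gamma>\<^esub> = 1\<close>, a polynomial is recovered from the \<open>\<Gamma>\<close>-iterates of \<open>e\<^bsup>t\<Gamma>\<^esub> P\<close>.\<close>

lemma tensor_poly_eq_exp_if_killed:
  fixes T :: "(complex, 'n::{finite,linorder}) tensor"
  assumes "cl_Gamma (tensor_poly n (tensor_exp t n T)) = (\<lambda>_. 0)"
  shows "tensor_poly n (tensor_exp t n T) = tensor_poly n T"
proof
  fix y
  let ?R = "tensor_exp t n T"
  have zero: "cl_Gamma (\<lambda>_. 0) = (\<lambda>_ :: (real, 'n) vec. 0)"
    by (simp add: cl_Gamma_def partial_deriv_def cl_mult.zero_right fun_eq_iff)
  have killed: "tensor_poly n ((tensor_Gamma n ^^ Suc k) ?R) = (\<lambda>_. 0)" for k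
  proof (induction k)
    case 0
    then show ?case using assms by (simp add: cl_Gamma_tensor_poly)
  next
    case (Suc k)
    then show ?case
      using zero by (simp add: cl_Gamma_tensor_poly[symmetric])
  qed
  have "tensor_poly n ?R y $ A = tensor_poly n T y $ A" for A
  proof -
    \<comment> \<open>A scalar sequence for the polynomial at one point and one component. Working
      with values of polynomials is essential, since a tensor representing the zero polynomial may
      be nonzero.\<close>
    define b where "b = (\<lambda>j. tensor_poly n ((tensor_Gamma n ^^ j) T) y $ A)"
    have bounded: "geom_bounded b"
    proof -
      have "norm (b j) \<le> (\<Sum>\<phi>\<in>multi_idx n. \<bar>mon n y \<phi>\<bar> * tensor_l1 n T) * Gamma_bound TYPE('n) n ^ j" for j
      proof -
        have "norm (b j) \<le> norm (tensor_poly n ((tensor_Gamma n ^^ j) T) y)"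
          unfolding b_def by (rule Finite_Cartesian_Product.norm_nth_le)
        also have "\<dots> \<le> (\<Sum>\<phi>\<in>multi_idx n. \<bar>mon n y \<phi>\<bar> * (Gamma_bound TYPE('n) n ^ j * tensor_l1 n T))"
          unfolding tensor_poly_def
          by (rule order_trans[OF norm_sum sum_mono]) (auto intro!: mult_left_mono norm_Gamma_funpow_le)
        finally show ?thesis by (simp add: sum_distrib_left sum_distrib_right mult_ac)
      qed
      then show ?thesis
        using Gamma_bound_pos[where 'n = 'n, of n] unfolding geom_bounded_def by (meson less_imp_le)
    qed
    have shift: "tensor_poly n ((tensor_Gamma n ^^ k) ?R) y $ A = egf (\<lambda>j. b (k + j)) t" for k
    proof -
      have "(\<lambda>j. (t ^ j / fact j) *s tensor_poly n ((tensor_Gamma n ^^ k) ((tensor_Gamma n ^^ j) T)) y)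
          sums tensor_poly n ((tensor_Gamma n ^^ k) ?R) y"
        by (intro tensor_poly_sums tensor_Gamma_funpow_sums tensor_exp_sums)
      then have "(\<lambda>j. t ^ j / fact j * b (k + j)) sums (tensor_poly n ((tensor_Gamma n ^^ k) ?R) y $ A)"
        by (simp add: vec_sums_iff b_def funpow_add)
      then show ?thesis
        using egf_sums[OF geom_bounded_shift[OF bounded]] sums_unique2 by blast
    qed
    \<comment> \<open>Taylor expansion around t evaluated at 0. The sum is \<open>b 0\<close>, the
      value of the original polynomial, and by \<open>killed\<close> only the term k = 0, the value
      of its exponential, survives.\<close>
    have "(\<lambda>k. (- t) ^ k / fact k * egf (\<lambda>j. b (k + j)) t) sums egf b (- t + t)"
      by (rule egf_add_sums[OF bounded])
    moreover have "egf (\<lambda>j. b (k + j)) t = 0" if "k \<noteq> 0" for k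
      using that killed[of "k - 1"] shift[of k] by (cases k) auto
    then have "(\<lambda>k. (- t) ^ k / fact k * egf (\<lambda>j. b (k + j)) t) sums egf b t"
      using sums_finite[of "{0}" "\<lambda>k. (- t) ^ k / fact k * egf (\<lambda>j. b (k + j)) t"] by simp
    ultimately have "egf b t = b 0"
      using sums_unique2 by fastforce
    then show ?thesis
      using shift[of 0] by (simp add: b_def)
  qed
  then show "tensor_poly n ?R y = tensor_poly n T y"
    by (simp add: vec_eq_iff)
qed

section \<open>Gaussian integrals and injectivity of the Fourier transform\<close>

text \<open>The partial sums are dominated, not the single terms, because the available majorants
  are those of a whole exponential series. Integrability of the terms follows by taking
  differences.\<close>

lemma integral_sums_dominated:
  fixes f :: "nat \<Rightarrow> 'a \<Rightarrow> 'b::{banach, second_countable_topology}"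
  assumes f: "\<And>n. f n \<in> borel_measurable M" and w: "integrable M w"
    and sums: "\<And>x. (\<lambda>n. f n x) sums s x"
    and bound: "\<And>N x. norm (\<Sum>n<N. f n x) \<le> w x"
  shows "integrable M s" "(\<lambda>n. integral\<^sup>L M (f n)) sums integral\<^sup>L M s" "\<And>n. integrable M (f n)"
proof -
  have s: "s \<in> borel_measurable M"
    by (rule borel_measurable_LIMSEQ_metric[where f = "\<lambda>N x. \<Sum>n<N. f n x"])
      (use sums f in \<open>auto simp: sums_def\<close>)
  note dom = s borel_measurable_sum[OF f] w AE_I2[OF sums[unfolded sums_def]] AE_I2[OF bound]
  show "integrable M s"
    by (rule integrable_dominated_convergence[OF dom])
  show int: "integrable M (f n)" for n
  proof -
    have "integrable M (\<lambda>x. \<Sum>i<N. f i x)" for N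
      by (rule integrable_dominated_convergence2[OF dom])
    from Bochner_Integration.integrable_diff[OF this[of "Suc n"] this[of n]]
    show ?thesis by simp
  qed
  have "(\<lambda>N. \<integral>x. (\<Sum>n<N. f n x) \<partial>M) \<longlonglongrightarrow> integral\<^sup>L M s"
    by (rule integral_dominated_convergence[OF dom])
  then show "(\<lambda>n. integral\<^sup>L M (f n)) sums integral\<^sup>L M s"
    by (simp add: sums_def int)
qed

lemma exp_partial_sum_le:
  fixes t :: real
  assumes "t \<ge> 0"
  shows "(\<Sum>n<N. t ^ n /\<^sub>R fact n) \<le> exp t"
  unfolding exp_def by (rule sum_le_suminf[OF summable_exp_generic]) (use assms in auto)

text \<open>Written over all powers of z, with zero odd coefficients, so that it can be compared
  degree by degree with other power series.\<close>

lemma exp_square_sums: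
  fixes b z :: complex
  shows "(\<lambda>n. (if even n then b ^ (n div 2) / fact (n div 2) else 0) * z ^ n) sums exp (b * z\<^sup>2)"
proof -
  let ?f = "\<lambda>n. (if even n then b ^ (n div 2) / fact (n div 2) else 0) * z ^ n"
  have "(\<lambda>n. (b * z\<^sup>2) ^ n /\<^sub>R fact n) sums exp (b * z\<^sup>2)" by (rule exp_converges)
  also have "(\<lambda>n. (b * z\<^sup>2) ^ n /\<^sub>R fact n) = (\<lambda>n. ?f (2 * n))"
  proof
    fix n
    have "(b * z\<^sup>2) ^ n /\<^sub>R fact n = b ^ n / fact n * (z\<^sup>2) ^ n"
      by (simp add: power_mult_distrib scaleR_conv_of_real field_simps)
    also have "(z\<^sup>2) ^ n = z ^ (2 * n)" by (rule power_mult[symmetric])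
    finally show "(b * z\<^sup>2) ^ n /\<^sub>R fact n = ?f (2 * n)"
      by simp
  qed
  finally have 1: "(\<lambda>n. ?f (2 * n)) sums exp (b * z\<^sup>2)" .
  have "strict_mono (\<lambda>n :: nat. 2 * n)" by (simp add: strict_mono_def)
  moreover have "?f n = 0" if "n \<notin> range (\<lambda>n. 2 * n)" for n
    using that by (auto elim: evenE)
  ultimately show ?thesis
    using 1 sums_mono_reindex[of "\<lambda>n. 2 * n" ?f] by blast
qed

text \<open>The difference series converges in the whole plane and vanishes on the real line,
  whereas a power series with a nonzero coefficient has no zeros accumulating at 0.\<close>

lemma powser_unique_on_reals:
  fixes a b :: "nat \<Rightarrow> complex"
  assumes a: "\<And>r. (\<lambda>n. a n * of_real r ^ n) sums F r" and b: "\<And>r. (\<lambda>n. b n * of_real r ^ n) sums F r"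
  shows "a = b"
proof (rule ccontr)
  assume "a \<noteq> b"
  then obtain m0 where m0: "a m0 \<noteq> b m0" by auto
  define c where "c = (\<lambda>n. a n - b n)"
  have c: "(\<lambda>n. c n * of_real r ^ n) sums 0" for r
    using sums_diff[OF a[of r] b[of r]] by (simp add: c_def algebra_simps)
  have "c 0 = 0"
    using c[of 0] by simp
  then have m: "c m0 \<noteq> 0" "m0 > 0" using m0 by (auto simp: c_def intro!: gr0I)
  define f where "f = (\<lambda>z. \<Sum>n. c n * (z - 0) ^ n)"
  have f: "(\<lambda>n. c n * (z - 0) ^ n) sums f z" for z
    unfolding f_def
  proof (rule summable_sums)
    have "summable (\<lambda>n. c n * of_real (norm z + 1) ^ n)"
      using c[of "norm z + 1"] by (rule sums_summable)
    then show "summable (\<lambda>n. c n * (z - 0) ^ n)"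
      by (rule powser_inside) (simp del: of_real_add)
  qed
  have f0: "f (of_real r) = 0" for r
    using sums_unique2[OF f[of "of_real r"]] c[of r] by simp
  obtain s where s: "0 < s" "\<And>z. z \<in> cball 0 s - {0} \<Longrightarrow> f z \<noteq> 0"
    by (rule powser_0_nonzero[where a = c and \<xi> = 0 and r = 1 and f = f and m = m0])
      (use f f0[of 0] m in auto)
  then show False using f0[of s] s(2)[of "of_real s"] by simp
qed

section \<open>Gaussian integrals, moments and transforms\<close>

lemma gaussian_integrable_real:
  assumes "p > 0"
  shows "integrable lborel (\<lambda>x :: real. exp (- p * x\<^sup>2))"
proof -
  define \<sigma> where "\<sigma> = 1 / sqrt (2 * p)"
  have \<sigma>: "2 * \<sigma>\<^sup>2 = 1 / p" using assms by (simp add: \<sigma>_def power_divide)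
  have "integrable lborel (\<lambda>x. sqrt (2 * pi * \<sigma>\<^sup>2) * normal_density 0 \<sigma> x)"
    using assms by (intro integrable_mult_right integrable_normal_density) (simp add: \<sigma>_def)
  also have "(\<lambda>x. sqrt (2 * pi * \<sigma>\<^sup>2) * normal_density 0 \<sigma> x) = (\<lambda>x. exp (- p * x\<^sup>2))"
  proof
    fix x
    have "\<sigma> \<noteq> 0" using assms by (simp add: \<sigma>_def)
    then show "sqrt (2 * pi * \<sigma>\<^sup>2) * normal_density 0 \<sigma> x = exp (- p * x\<^sup>2)"
      by (simp add: normal_density_def \<sigma>)
  qed
  finally show ?thesis .
qed

lemma gaussian_integrable:
  assumes "p > 0"
  shows "integrable lborel (\<lambda>x :: 'a::euclidean_space. exp (- p * (norm x)\<^sup>2))"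
proof -
  interpret product_sigma_finite "\<lambda>_ :: 'a. lborel :: real measure" ..
  have "integrable (\<Pi>\<^sub>M b\<in>(Basis :: 'a set). lborel) (\<lambda>f. \<Prod>b\<in>Basis. exp (- p * (f b)\<^sup>2))"
    by (intro product_integrable_prod gaussian_integrable_real assms) auto
  also have "(\<lambda>f. \<Prod>b\<in>(Basis :: 'a set). exp (- p * (f b)\<^sup>2)) =
      (\<lambda>f. exp (- p * (norm (\<Sum>b\<in>Basis. f b *\<^sub>R b :: 'a))\<^sup>2))"
  proof
    fix f :: "'a \<Rightarrow> real"
    have "(norm (\<Sum>b\<in>Basis. f b *\<^sub>R b :: 'a))\<^sup>2 = (\<Sum>b\<in>Basis. (f b)\<^sup>2)"
      unfolding power2_norm_eq_inner by (subst euclidean_inner) (simp add: power2_eq_square)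
    then show "(\<Prod>b\<in>(Basis :: 'a set). exp (- p * (f b)\<^sup>2)) = exp (- p * (norm (\<Sum>b\<in>Basis. f b *\<^sub>R b :: 'a))\<^sup>2)"
      by (simp add: exp_sum sum_distrib_left flip: sum_negf)
  qed
  finally show ?thesis
    by (subst lborel_eq) (subst integrable_distr_eq; simp)
qed

text \<open>The total mass of a Gaussian, carried along as a positive symbol; the type argument
  fixes the space.\<close>

definition gauss_int :: "'a::euclidean_space itself \<Rightarrow> real \<Rightarrow> real"
  where "gauss_int _ p = (\<integral>(x :: 'a). exp (- p * (norm x)\<^sup>2) \<partial>lborel)"

lemma gauss_int_pos:
  assumes "p > 0"
  shows "gauss_int TYPE('a::euclidean_space) p > 0"
proof -
  have "gauss_int TYPE('a) p \<ge> 0" unfolding gauss_int_def by (rule Bochner_Integration.integral_nonneg) simp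
  moreover have "gauss_int TYPE('a) p \<noteq> 0"
  proof
    assume "gauss_int TYPE('a) p = 0"
    then have "AE x :: 'a in lborel. exp (- p * (norm x)\<^sup>2) = 0"
      unfolding gauss_int_def
      by (subst (asm) integral_nonneg_eq_0_iff_AE[OF gaussian_integrable[OF assms]]) auto
    then have "AE x :: 'a in lborel. False" by simp
    then have "ae_filter (lborel :: 'a measure) = bot" by (simp only: eventually_False)
    then show False by (simp add: ae_filter_eq_bot_iff emeasure_lborel_UNIV)
  qed
  ultimately show ?thesis by simp
qed

lemma integral_lborel_translate:
  fixes f :: "'a::euclidean_space \<Rightarrow> 'b::{banach, second_countable_topology}"
  assumes [measurable]: "f \<in> borel_measurable borel"
  shows "(\<integral>x. f (c + x) \<partial>lborel) = integral\<^sup>L lborel f"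
    and "integrable lborel (\<lambda>x. f (c + x)) \<longleftrightarrow> integrable lborel f"
proof -
  have "integral\<^sup>L lborel f = integral\<^sup>L (distr lborel borel ((+) c)) f"
    by (simp add: lborel_distr_plus)
  also have "\<dots> = (\<integral>x. f (c + x) \<partial>lborel)" by (rule integral_distr) auto
  finally show "(\<integral>x. f (c + x) \<partial>lborel) = integral\<^sup>L lborel f" by simp
  have "integrable (distr lborel borel ((+) c)) f \<longleftrightarrow> integrable lborel (\<lambda>x. f (c + x))"
    by (rule integrable_distr_eq) auto
  then show "integrable lborel (\<lambda>x. f (c + x)) \<longleftrightarrow> integrable lborel f"
    by (simp add: lborel_distr_plus)
qed

text \<open>Completing the square exhibits the integrand as a constant times the Gaussian translated
  by w/(2p).\<close>

lemma gaussian_laplace: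
  fixes w :: "'a::euclidean_space"
  assumes p: "p > 0"
  shows "integrable lborel (\<lambda>x. exp (x \<bullet> w) * exp (- p * (norm x)\<^sup>2))"
    and "(\<integral>x. exp (x \<bullet> w) * exp (- p * (norm x)\<^sup>2) \<partial>lborel) = exp ((norm w)\<^sup>2 / (4 * p)) * gauss_int TYPE('a) p"
proof -
  have eq: "exp (x \<bullet> w) * exp (- p * (norm x)\<^sup>2) =
      exp ((norm w)\<^sup>2 / (4 * p)) * exp (- p * (norm (- (1 / (2 * p)) *\<^sub>R w + x))\<^sup>2)" for x
  proof -
    have "(norm (- (1 / (2 * p)) *\<^sub>R w + x))\<^sup>2 = (norm x)\<^sup>2 - (x \<bullet> w) / p + (norm w)\<^sup>2 / (4 * p\<^sup>2)"
      unfolding power2_norm_eq_inner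
      by (simp add: inner_simps inner_commute[of w x] power2_eq_square algebra_simps)
    then have "(norm w)\<^sup>2 / (4 * p) + - p * (norm (- (1 / (2 * p)) *\<^sub>R w + x))\<^sup>2 =
        (norm w)\<^sup>2 / (4 * p) + - p * ((norm x)\<^sup>2 - (x \<bullet> w) / p + (norm w)\<^sup>2 / (4 * p\<^sup>2))"
      by simp
    also have "\<dots> = x \<bullet> w + - p * (norm x)\<^sup>2"
      using p by (simp add: algebra_simps power2_eq_square)
    finally have "(norm w)\<^sup>2 / (4 * p) + - p * (norm (- (1 / (2 * p)) *\<^sub>R w + x))\<^sup>2 = x \<bullet> w + - p * (norm x)\<^sup>2" .
    then show ?thesis by (simp only: exp_add[symmetric])
  qed
  show "integrable lborel (\<lambda>x. exp (x \<bullet> w) * exp (- p * (norm x)\<^sup>2))"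
    unfolding eq using gaussian_integrable[OF p]
      integral_lborel_translate(2)[of "\<lambda>x. exp (- p * (norm x)\<^sup>2)" "- (1 / (2 * p)) *\<^sub>R w"]
    by simp
  show "(\<integral>x. exp (x \<bullet> w) * exp (- p * (norm x)\<^sup>2) \<partial>lborel) = exp ((norm w)\<^sup>2 / (4 * p)) * gauss_int TYPE('a) p"
    unfolding eq gauss_int_def
    using integral_lborel_translate(1)[of "\<lambda>x. exp (- p * (norm x)\<^sup>2)" "- (1 / (2 * p)) *\<^sub>R w"]
    by simp
qed

text \<open>With t = |x|, rt - pt^2 = r^2/(4p) - p(t - r/(2p))^2. Beyond t = r/p the last square is
  at least (t/2)^2, which leaves a fixed Gaussian; the ball of radius r/p has volume of order r^m, m
  being the dimension. The rate 1/(4p) is thus kept exactly and the loss is polynomial.\<close>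

lemma radial_exp_gaussian:
  assumes p: "p > 0"
  shows "\<exists>D\<ge>0. \<forall>r\<ge>0. integrable lborel (\<lambda>x :: 'a::euclidean_space. exp (r * norm x) * exp (- p * (norm x)\<^sup>2)) \<and>
    (\<integral>(x :: 'a). exp (r * norm x) * exp (- p * (norm x)\<^sup>2) \<partial>lborel) \<le> D * (1 + r ^ DIM('a)) * exp (r\<^sup>2 / (4 * p))"
proof -
  define D1 where "D1 = unit_ball_vol (real DIM('a)) * (1 / p) ^ DIM('a)"
  define D2 where "D2 = gauss_int TYPE('a) (p / 4)"
  have D12: "D1 \<ge> 0" "D2 \<ge> 0"
    using p gauss_int_pos[of "p / 4", where 'a = 'a] by (auto simp: D1_def D2_def)
  have main: "integrable lborel (\<lambda>x :: 'a. exp (r * norm x) * exp (- p * (norm x)\<^sup>2)) \<and>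
    (\<integral>(x :: 'a). exp (r * norm x) * exp (- p * (norm x)\<^sup>2) \<partial>lborel) \<le> (D1 + D2) * (1 + r ^ DIM('a)) * exp (r\<^sup>2 / (4 * p))"
    if r: "r \<ge> 0" for r
  proof -
    define b where "b = r / p"
    define w :: "'a \<Rightarrow> real" where
      "w = (\<lambda>x. exp (r\<^sup>2 / (4 * p)) * (indicator (cball 0 b) x + exp (- (p / 4) * (norm x)\<^sup>2)))"
    have b: "b \<ge> 0" using r p by (simp add: b_def)
    have cball: "emeasure lborel (cball (0 :: 'a) b) = ennreal (unit_ball_vol (real DIM('a)) * b ^ DIM('a))"
      using b by (rule emeasure_cball)
    have int_w: "integrable lborel w"
      unfolding w_def using p
      by (intro integrable_mult_right Bochner_Integration.integrable_add gaussian_integrable integrable_real_indicator)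
        (auto simp: cball)
    have le: "exp (r * norm x) * exp (- p * (norm x)\<^sup>2) \<le> w x" for x
    proof -
      have "exp (r * norm x) * exp (- p * (norm x)\<^sup>2) = exp (r\<^sup>2 / (4 * p)) * exp (- p * (norm x - b / 2)\<^sup>2)"
      proof -
        have "r * u + - p * u\<^sup>2 = r\<^sup>2 / (4 * p) + - p * (u - b / 2)\<^sup>2" for u
          using p by (simp add: b_def power2_eq_square algebra_simps)
        then show ?thesis by (simp only: exp_add[symmetric])
      qed
      also have "exp (- p * (norm x - b / 2)\<^sup>2) \<le> indicator (cball 0 b) x + exp (- (p / 4) * (norm x)\<^sup>2)"
      proof (cases "norm x \<le> b")
        case True
        then show ?thesis using p by (auto simp: indicator_def add_increasing2)
      next
        case False
        then have "(norm x / 2)\<^sup>2 \<le> (norm x - b / 2)\<^sup>2" using b by (intro power_mono) auto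
        then have "p * (norm x / 2)\<^sup>2 \<le> p * (norm x - b / 2)\<^sup>2" using p by (intro mult_left_mono) auto
        then show ?thesis using False by (simp add: indicator_def power_divide)
      qed
      finally show ?thesis by (simp add: w_def)
    qed
    have int: "integrable lborel (\<lambda>x :: 'a. exp (r * norm x) * exp (- p * (norm x)\<^sup>2))"
      by (rule Bochner_Integration.integrable_bound[OF int_w]) (use le in \<open>auto intro: order_trans[OF _ abs_ge_self]\<close>)
    have "(\<integral>(x :: 'a). exp (r * norm x) * exp (- p * (norm x)\<^sup>2) \<partial>lborel) \<le> integral\<^sup>L lborel w"
      by (rule integral_mono[OF int int_w le])
    also have "integral\<^sup>L lborel w = exp (r\<^sup>2 / (4 * p)) * (D1 * r ^ DIM('a) + D2)"
    proof -
      have "integral\<^sup>L lborel w = exp (r\<^sup>2 / (4 * p)) * (measure lborel (cball (0 :: 'a) b) + D2)"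
        unfolding w_def D2_def gauss_int_def using gaussian_integrable[of "p / 4", where 'a = 'a] p
        by (subst integral_mult_right_zero, subst Bochner_Integration.integral_add)
          (simp_all add: integrable_real_indicator cball)
      also have "measure lborel (cball (0 :: 'a) b) = D1 * r ^ DIM('a)"
        using content_cball[OF b, where 'a = 'a] by (simp add: D1_def b_def power_divide)
      finally show ?thesis .
    qed
    also have "\<dots> \<le> (D1 + D2) * (1 + r ^ DIM('a)) * exp (r\<^sup>2 / (4 * p))"
    proof -
      have "D1 * r ^ DIM('a) + D2 \<le> (D1 + D2) * (1 + r ^ DIM('a))"
        using D12 r by (simp add: algebra_simps)
      then show ?thesis by (simp add: mult.commute mult_left_mono)
    qed
    finally show ?thesis using int by blast
  qed
  then show ?thesis using D12 by (intro exI[of _ "D1 + D2"]) auto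
qed

text \<open>The moments are the Taylor coefficients in r of the Laplace transform at ry, known in
  closed form from \<open>gaussian_laplace\<close>. Termwise integration and uniqueness of power
  series identify them.\<close>

lemma gaussian_moment:
  fixes y :: "'a::euclidean_space"
  assumes p: "p > 0"
  shows "(\<integral>x. (x \<bullet> y) ^ n * exp (- p * (norm x)\<^sup>2) \<partial>lborel) =
    fact n * (gauss_int TYPE('a) p *
      (if even n then ((norm y)\<^sup>2 / (4 * p)) ^ (n div 2) / fact (n div 2) else 0))"
proof -
  define I where "I = gauss_int TYPE('a) p"
  define b where "b = (norm y)\<^sup>2 / (4 * p)"
  define c where "c = (\<lambda>n. if even n then complex_of_real b ^ (n div 2) / fact (n div 2) else 0)"
  define M where "M = (\<lambda>n. \<integral>x. (x \<bullet> y) ^ n * exp (- p * (norm x)\<^sup>2) \<partial>lborel)"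
  have 1: "(\<lambda>n. complex_of_real (M n / fact n) * of_real r ^ n) sums (of_real I * exp (of_real b * (of_real r)\<^sup>2))" for r
  proof -
    have bound: "norm (\<Sum>n<N. r ^ n / fact n * ((x \<bullet> y) ^ n * exp (- p * (norm x)\<^sup>2)))
        \<le> exp (\<bar>r\<bar> * norm y * norm x) * exp (- p * (norm x)\<^sup>2)" for N x
    proof -
      have "norm (\<Sum>n<N. r ^ n / fact n * ((x \<bullet> y) ^ n * exp (- p * (norm x)\<^sup>2))) \<le>
          (\<Sum>n<N. (\<bar>r\<bar> * norm y * norm x) ^ n / fact n * exp (- p * (norm x)\<^sup>2))"
      proof (rule order_trans[OF norm_sum sum_mono])
        fix n
        have "\<bar>x \<bullet> y\<bar> ^ n \<le> (norm x * norm y) ^ n"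
          by (intro power_mono Cauchy_Schwarz_ineq2) simp
        then have "\<bar>r\<bar> ^ n / fact n * (\<bar>x \<bullet> y\<bar> ^ n * exp (- p * (norm x)\<^sup>2)) \<le>
           \<bar>r\<bar> ^ n / fact n * ((norm x * norm y) ^ n * exp (- p * (norm x)\<^sup>2))"
          by (intro mult_left_mono mult_right_mono) auto
        then show "norm (r ^ n / fact n * ((x \<bullet> y) ^ n * exp (- p * (norm x)\<^sup>2))) \<le>
            (\<bar>r\<bar> * norm y * norm x) ^ n / fact n * exp (- p * (norm x)\<^sup>2)"
          by (simp add: abs_mult power_abs power_mult_distrib mult_ac)
      qed
      also have "\<dots> = (\<Sum>n<N. (\<bar>r\<bar> * norm y * norm x) ^ n /\<^sub>R fact n) * exp (- p * (norm x)\<^sup>2)"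
        by (simp add: sum_distrib_right sum_distrib_left divide_inverse mult_ac)
      also have "\<dots> \<le> exp (\<bar>r\<bar> * norm y * norm x) * exp (- p * (norm x)\<^sup>2)"
        by (intro mult_right_mono exp_partial_sum_le) auto
      finally show ?thesis .
    qed
    have int: "integrable lborel (\<lambda>x :: 'a. exp (\<bar>r\<bar> * norm y * norm x) * exp (- p * (norm x)\<^sup>2))"
    proof -
      have "\<forall>r\<ge>0. integrable lborel (\<lambda>x :: 'a. exp (r * norm x) * exp (- p * (norm x)\<^sup>2))"
        using radial_exp_gaussian[OF p, where 'a = 'a] by blast
      then show ?thesis by simp
    qed
    have sums: "(\<lambda>n. r ^ n / fact n * ((x \<bullet> y) ^ n * exp (- p * (norm x)\<^sup>2))) sums
        (exp (x \<bullet> (r *\<^sub>R y)) * exp (- p * (norm x)\<^sup>2))" for x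
      using sums_mult2[OF exp_converges[of "x \<bullet> (r *\<^sub>R y)"], of "exp (- p * (norm x)\<^sup>2)"]
      by (simp add: power_mult_distrib divide_inverse mult_ac)
    have "(\<lambda>n. \<integral>x. r ^ n / fact n * ((x \<bullet> y) ^ n * exp (- p * (norm x)\<^sup>2)) \<partial>lborel) sums
        (\<integral>x. exp (x \<bullet> (r *\<^sub>R y)) * exp (- p * (norm x)\<^sup>2) \<partial>lborel)"
      by (rule integral_sums_dominated(2)[OF _ int sums bound]) measurable
    then have "(\<lambda>n. M n / fact n * r ^ n) sums (I * exp (b * r\<^sup>2))"
      unfolding gaussian_laplace(2)[OF p]
      by (simp add: M_def I_def b_def power_mult_distrib mult_ac)
    then have "(\<lambda>n. complex_of_real (M n / fact n * r ^ n)) sums of_real (I * exp (b * r\<^sup>2))"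
      by (simp only: sums_of_real_iff)
    also have "complex_of_real (I * exp (b * r\<^sup>2)) = of_real I * exp (of_real b * (of_real r)\<^sup>2)"
      by (simp add: exp_of_real[symmetric])
    finally show ?thesis by simp
  qed
  have 2: "(\<lambda>n. (of_real I * c n) * of_real r ^ n) sums (of_real I * exp (of_real b * (of_real r)\<^sup>2))" for r
    using sums_mult[OF exp_square_sums[of "of_real b" "of_real r"], of "of_real I"] by (simp add: c_def mult.assoc)
  have "complex_of_real (M n / fact n) = of_real I * c n"
    using fun_cong[OF powser_unique_on_reals[OF 1 2]] .
  also have "\<dots> = of_real (I * (if even n then b ^ (n div 2) / fact (n div 2) else 0))"
    by (simp add: c_def)
  finally have "M n / fact n = I * (if even n then b ^ (n div 2) / fact (n div 2) else 0)"
    by (simp only: of_real_eq_iff)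
  moreover have "u = fact n * v" if "u / fact n = v" for u v :: real
    using that by (simp add: field_simps)
  ultimately have "M n = fact n * (I * (if even n then b ^ (n div 2) / fact (n div 2) else 0))"
    by blast
  then show ?thesis by (simp only: M_def I_def b_def)
qed

lemma exp_minus_i_inner_sums:
  "(\<lambda>n. (- \<i>) ^ n / fact n * of_real ((x \<bullet> y) ^ n)) sums exp (- \<i> * of_real (x \<bullet> y))"
proof -
  have "(- \<i> * of_real (x \<bullet> y)) ^ n /\<^sub>R fact n = (- \<i>) ^ n / fact n * of_real ((x \<bullet> y) ^ n)" for n
    by (simp only: power_mult_distrib) (simp add: scaleR_conv_of_real divide_inverse)
  then show ?thesis
    using exp_converges[of "- \<i> * of_real (x \<bullet> y)"] by (simp only:)
qed

text \<open>The moment series is summed again with -i in place of the real parameter, which replaces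
  a shift of contour.\<close>

lemma gaussian_fourier:
  fixes y :: "'a::euclidean_space"
  assumes p: "p > 0"
  shows "(\<integral>x. exp (- \<i> * of_real (x \<bullet> y)) * of_real (exp (- p * (norm x)\<^sup>2)) \<partial>lborel) =
    of_real (exp (- (norm y)\<^sup>2 / (4 * p)) * gauss_int TYPE('a) p)"
proof -
  define I where "I = gauss_int TYPE('a) p"
  define b where "b = (norm y)\<^sup>2 / (4 * p)"
  define f :: "nat \<Rightarrow> 'a \<Rightarrow> complex" where
    "f = (\<lambda>n x. (- \<i>) ^ n / fact n * of_real ((x \<bullet> y) ^ n) * of_real (exp (- p * (norm x)\<^sup>2)))"
  have norm_f: "norm (f n x) \<le> (norm y * norm x) ^ n /\<^sub>R fact n * exp (- p * (norm x)\<^sup>2)" for n x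
  proof -
    have "\<bar>x \<bullet> y\<bar> ^ n \<le> (norm y * norm x) ^ n"
      using Cauchy_Schwarz_ineq2[of x y] by (intro power_mono) (simp_all add: mult.commute)
    then show ?thesis
      by (simp add: f_def norm_mult norm_divide norm_power power_abs divide_simps)
  qed
  have bound: "norm (\<Sum>n<N. f n x) \<le> exp (norm y * norm x) * exp (- p * (norm x)\<^sup>2)" for N x
  proof -
    have "norm (\<Sum>n<N. f n x) \<le> (\<Sum>n<N. (norm y * norm x) ^ n /\<^sub>R fact n) * exp (- p * (norm x)\<^sup>2)"
      unfolding sum_distrib_right by (rule order_trans[OF norm_sum sum_mono]) (rule norm_f)
    also have "\<dots> \<le> exp (norm y * norm x) * exp (- p * (norm x)\<^sup>2)"
      by (intro mult_right_mono exp_partial_sum_le) auto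
    finally show ?thesis .
  qed
  have int: "integrable lborel (\<lambda>x :: 'a. exp (norm y * norm x) * exp (- p * (norm x)\<^sup>2))"
  proof -
    have "\<forall>r\<ge>0. integrable lborel (\<lambda>x :: 'a. exp (r * norm x) * exp (- p * (norm x)\<^sup>2))"
      using radial_exp_gaussian[OF p, where 'a = 'a] by blast
    then show ?thesis by simp
  qed
  have "(\<lambda>n. \<integral>x. f n x \<partial>lborel) sums (\<integral>x. exp (- \<i> * of_real (x \<bullet> y)) * of_real (exp (- p * (norm x)\<^sup>2)) \<partial>lborel)"
  proof (rule integral_sums_dominated(2)[OF _ int _ bound])
    show "f n \<in> borel_measurable lborel" for n unfolding f_def by measurable
    show "(\<lambda>n. f n x) sums (exp (- \<i> * of_real (x \<bullet> y)) * of_real (exp (- p * (norm x)\<^sup>2)))" for x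
      unfolding f_def by (intro sums_mult2 exp_minus_i_inner_sums)
  qed
  also have "(\<lambda>n. \<integral>x. f n x \<partial>lborel) =
      (\<lambda>n. of_real I * ((if even n then of_real b ^ (n div 2) / fact (n div 2) else 0) * (- \<i>) ^ n))"
  proof
    fix n
    have "(\<integral>x. f n x \<partial>lborel) = (- \<i>) ^ n / fact n * (\<integral>x. of_real ((x \<bullet> y) ^ n * exp (- p * (norm x)\<^sup>2)) \<partial>lborel)"
      unfolding f_def of_real_mult mult.assoc by (rule integral_mult_right_zero)
    also have "(\<integral>x. complex_of_real ((x \<bullet> y) ^ n * exp (- p * (norm x)\<^sup>2)) \<partial>lborel) =
        of_real (fact n * (I * (if even n then b ^ (n div 2) / fact (n div 2) else 0)))"
      unfolding integral_complex_of_real gaussian_moment[OF p] I_def b_def ..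
    finally show "(\<integral>x. f n x \<partial>lborel) = of_real I * ((if even n then of_real b ^ (n div 2) / fact (n div 2) else 0) * (- \<i>) ^ n)"
      by simp
  qed
  finally have "(\<lambda>n. of_real I * ((if even n then of_real b ^ (n div 2) / fact (n div 2) else 0) * (- \<i>) ^ n))
    sums (\<integral>x. exp (- \<i> * of_real (x \<bullet> y)) * of_real (exp (- p * (norm x)\<^sup>2)) \<partial>lborel)" .
  moreover have "(\<lambda>n. of_real I * ((if even n then of_real b ^ (n div 2) / fact (n div 2) else 0) * (- \<i>) ^ n))
    sums (of_real I * exp (of_real b * (- \<i>)\<^sup>2))"
    by (intro sums_mult exp_square_sums)
  ultimately have "(\<integral>x. exp (- \<i> * of_real (x \<bullet> y)) * of_real (exp (- p * (norm x)\<^sup>2)) \<partial>lborel) = of_real I * exp (of_real b * (- \<i>)\<^sup>2)"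
    by (rule sums_unique2)
  also have "\<dots> = of_real (exp (- (norm y)\<^sup>2 / (4 * p)) * I)"
    by (simp add: b_def exp_of_real[symmetric])
  finally show ?thesis by (simp only: I_def)
qed

section \<open>Injectivity of the Fourier transform on integrable functions\<close>

lemma gaussian_average_eq_0:
  fixes h :: "'a::euclidean_space \<Rightarrow> real"
  assumes h: "integrable lborel h" and k: "k > 0"
    and zero: "\<And>y. (\<integral>x. exp (- \<i> * of_real (x \<bullet> y)) * of_real (h x) \<partial>lborel) = 0"
  shows "(\<integral>x. h x * exp (- k * (norm (x - y))\<^sup>2) \<partial>lborel) = 0"
proof -
  \<comment> \<open>With this p the transform of exp(-p |\<xi>|^2) at x - y is a multiple of exp(-k
    |x - y|^2). Inserting it and exchanging the integrals makes the inner integral a transform of h,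
    which is zero.\<close>
  define p where "p = 1 / (4 * k)"
  have p: "p > 0" using k by (simp add: p_def)
  let ?I = "gauss_int TYPE('a) p"
  define F :: "'a \<Rightarrow> 'a \<Rightarrow> complex" where
    "F = (\<lambda>x \<xi>. of_real (h x) * (exp (- \<i> * of_real (\<xi> \<bullet> (x - y))) * of_real (exp (- p * (norm \<xi>)\<^sup>2))))"
  have [measurable]: "h \<in> borel_measurable borel" using h by auto
  have norm_F: "norm (F x \<xi>) = \<bar>h x\<bar> * exp (- p * (norm \<xi>)\<^sup>2)" for x \<xi>
    by (simp add: F_def norm_mult norm_exp_eq_Re)
  have int: "integrable (lborel \<Otimes>\<^sub>M lborel) (case_prod F)"
  proof (rule lborel_pair.Fubini_integrable)
    show "case_prod F \<in> borel_measurable (lborel \<Otimes>\<^sub>M lborel)"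
      unfolding F_def by measurable
    show "integrable lborel (\<lambda>x. \<integral>\<xi>. norm (case_prod F (x, \<xi>)) \<partial>lborel)"
      using h by (simp add: norm_F)
    show "AE x in lborel. integrable lborel (\<lambda>\<xi>. case_prod F (x, \<xi>))"
    proof (intro AE_I2)
      fix x
      have "integrable lborel (\<lambda>\<xi>. \<bar>h x\<bar> * exp (- p * (norm \<xi>)\<^sup>2))"
        by (intro integrable_mult_right gaussian_integrable p)
      then show "integrable lborel (\<lambda>\<xi>. case_prod F (x, \<xi>))"
      proof (rule Bochner_Integration.integrable_bound)
        show "(\<lambda>\<xi>. case_prod F (x, \<xi>)) \<in> borel_measurable lborel"
          unfolding F_def prod.case by measurable
      qed (simp add: norm_F)
    qed
  qed
  have "(\<integral>x. h x * exp (- k * (norm (x - y))\<^sup>2) * ?I \<partial>lborel) = 0"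
  proof -
    have "(\<integral>\<xi>. F x \<xi> \<partial>lborel) = of_real (h x * exp (- k * (norm (x - y))\<^sup>2) * ?I)" for x
      unfolding F_def integral_mult_right_zero gaussian_fourier[OF p] by (simp add: p_def)
    then have "complex_of_real (\<integral>x. h x * exp (- k * (norm (x - y))\<^sup>2) * ?I \<partial>lborel) = (\<integral>x. \<integral>\<xi>. F x \<xi> \<partial>lborel \<partial>lborel)"
      by (simp only: integral_complex_of_real)
    also have "\<dots> = (\<integral>\<xi>. \<integral>x. F x \<xi> \<partial>lborel \<partial>lborel)"
      by (rule lborel_pair.Fubini_integral[OF int, symmetric])
    also have "\<dots> = 0"
    proof -
      have "(\<integral>x. F x \<xi> \<partial>lborel) = 0" for \<xi>
      proof -
        have "F x \<xi> = exp (\<i> * of_real (\<xi> \<bullet> y)) * of_real (exp (- p * (norm \<xi>)\<^sup>2)) * (exp (- \<i> * of_real (x \<bullet> \<xi>)) * of_real (h x))" for x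
          by (simp add: F_def inner_diff_right inner_commute[of \<xi> x] algebra_simps flip: exp_add)
        then show ?thesis by (simp only: integral_mult_right_zero zero mult_zero_right)
      qed
      then show ?thesis by simp
    qed
    finally show ?thesis by (simp only: of_real_eq_0_iff)
  qed
  then show ?thesis using gauss_int_pos[OF p, where 'a = 'a] by simp
qed

lemma integral_lborel_affine:
  fixes f :: "'a::euclidean_space \<Rightarrow> real"
  assumes [measurable]: "f \<in> borel_measurable borel" and t: "t > 0"
  shows "integral\<^sup>L lborel f = t ^ DIM('a) * (\<integral>v. f (x + t *\<^sub>R v) \<partial>lborel)"
proof -
  have "integral\<^sup>L lborel f = integral\<^sup>L (density (distr lborel borel (\<lambda>v. x + t *\<^sub>R v)) (\<lambda>_. ennreal (t ^ DIM('a)))) f"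
    using lborel_affine[of t x] t by simp
  also have "\<dots> = (\<integral>u. t ^ DIM('a) *\<^sub>R f u \<partial>distr lborel borel (\<lambda>v. x + t *\<^sub>R v))"
    using t by (intro integral_density) auto
  also have "\<dots> = (\<integral>v. t ^ DIM('a) *\<^sub>R f (x + t *\<^sub>R v) \<partial>lborel)"
    by (intro integral_distr) auto
  finally show ?thesis by simp
qed

text \<open>\<open>K t\<close> is, up to a constant, the indicator of the box smoothed by a Gaussian
  at scale t. By Fubini h integrates to 0 against it, since all Gaussian averages of h vanish. As t
  tends to 0 it converges to a multiple of the indicator off the boundary of the box, a null
  set.\<close>

lemma integral_cbox_eq_0_if_fourier_0:
  fixes h :: "'a::euclidean_space \<Rightarrow> real"
  assumes h: "integrable lborel h"
    and zero: "\<And>y. (\<integral>x. exp (- \<i> * of_real (x \<bullet> y)) * of_real (h x) \<partial>lborel) = 0"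
  shows "(\<integral>x. h x * indicator (cbox a b) x \<partial>lborel) = 0"
proof -
  let ?B = "cbox a b"
  have [measurable]: "h \<in> borel_measurable borel" using h by auto
  define K where "K = (\<lambda>t x. \<integral>v. indicator ?B (x + t *\<^sub>R v) * exp (- 1 * (norm (v :: 'a))\<^sup>2) \<partial>lborel)"
  let ?I = "gauss_int TYPE('a) 1"
  note g1 = gaussian_integrable[of 1, where 'a = 'a]
  have K_bound: "\<bar>K t x\<bar> \<le> ?I" for t x
  proof -
    have "\<bar>K t x\<bar> \<le> (\<integral>v. \<bar>indicator ?B (x + t *\<^sub>R v) * exp (- 1 * (norm (v :: 'a))\<^sup>2)\<bar> \<partial>lborel)"
      unfolding K_def by (rule integral_abs_bound)
    also have "\<dots> \<le> ?I"
      unfolding gauss_int_def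
      by (intro Bochner_Integration.integral_mono Bochner_Integration.integrable_bound[OF g1])
        (auto simp: indicator_def)
    finally show ?thesis .
  qed
  have K_meas [measurable]: "(\<lambda>x. K t x) \<in> borel_measurable borel" for t
    unfolding K_def by (rule lborel.borel_measurable_lebesgue_integral) measurable
  have K0: "(\<integral>x. h x * K t x \<partial>lborel) = 0" if t: "t > 0" for t
  proof -
    \<comment> \<open>The substitution y = x + tv then turns the Gaussian of parameter k into the
      fixed one in \<open>K\<close>.\<close>
    define k where "k = 1 / t\<^sup>2"
    have k: "k > 0" using t by (simp add: k_def)
    define F where "F = (\<lambda>x y. h x * (indicator ?B y * exp (- k * (norm (x - y))\<^sup>2)))"
    have eq: "(\<integral>y. indicator ?B y * exp (- k * (norm (x - y))\<^sup>2) \<partial>lborel) = t ^ DIM('a) * K t x" for x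
    proof -
      have "(\<integral>y. indicator ?B y * exp (- k * (norm (x - y))\<^sup>2) \<partial>lborel) =
          t ^ DIM('a) * (\<integral>v. indicator ?B (x + t *\<^sub>R v) * exp (- k * (norm (x - (x + t *\<^sub>R v)))\<^sup>2) \<partial>lborel)"
        by (rule integral_lborel_affine[OF _ t]) measurable
      then show ?thesis using t by (simp add: K_def k_def power_mult_distrib)
    qed
    have int: "integrable (lborel \<Otimes>\<^sub>M lborel) (case_prod F)"
    proof -
      define H :: "'a \<Rightarrow> 'a \<Rightarrow> real" where "H = (\<lambda>x y. h x * indicator ?B y)"
      have "integrable (lborel \<Otimes>\<^sub>M lborel) (case_prod H)"
      proof (rule lborel_pair.Fubini_integrable)
        show "case_prod H \<in> borel_measurable (lborel \<Otimes>\<^sub>M lborel)" unfolding H_def by measurable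
        show "integrable lborel (\<lambda>x. \<integral>y. norm (case_prod H (x, y)) \<partial>lborel)"
          using h by (simp add: H_def abs_mult)
        show "AE x in lborel. integrable lborel (\<lambda>y. case_prod H (x, y))"
          unfolding H_def prod.case using emeasure_lborel_cbox_finite[of a b]
          by (intro AE_I2 integrable_mult_right integrable_real_indicator) auto
      qed
      then show ?thesis
      proof (rule Bochner_Integration.integrable_bound)
        show "case_prod F \<in> borel_measurable (lborel \<Otimes>\<^sub>M lborel)" unfolding F_def by measurable
        show "AE z in lborel \<Otimes>\<^sub>M lborel. norm (case_prod F z) \<le> norm (case_prod H z)"
          using k by (intro AE_I2) (auto simp: F_def H_def abs_mult indicator_def intro!: mult_left_le)
      qed
    qed
    have "(\<integral>x. h x * (t ^ DIM('a) * K t x) \<partial>lborel) = (\<integral>x. \<integral>y. F x y \<partial>lborel \<partial>lborel)"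
      unfolding F_def integral_mult_right_zero eq ..
    also have "\<dots> = (\<integral>y. \<integral>x. F x y \<partial>lborel \<partial>lborel)"
      by (rule lborel_pair.Fubini_integral[OF int, symmetric])
    also have "\<dots> = (\<integral>y. indicator ?B y * (\<integral>x. h x * exp (- k * (norm (x - y))\<^sup>2) \<partial>lborel) \<partial>lborel)"
    proof -
      have "F x y = indicator ?B y * (h x * exp (- k * (norm (x - y))\<^sup>2))" for x y
        by (simp add: F_def)
      then show ?thesis by (simp only: integral_mult_right_zero)
    qed
    also have "\<dots> = 0"
      by (simp only: gaussian_average_eq_0[OF h k zero] mult_zero_right integral_zero)
    finally have "t ^ DIM('a) * (\<integral>x. h x * K t x \<partial>lborel) = 0"
      by (simp only: mult.left_commute[of "h _"] integral_mult_right_zero)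
    then show ?thesis using t by simp
  qed
  have lim_K: "(\<lambda>j. K (1 / real (Suc j)) x) \<longlonglongrightarrow> indicator ?B x * ?I" if x: "x \<notin> cbox a b - box a b" for x
  proof -
    have "(\<lambda>j. K (1 / real (Suc j)) x) \<longlonglongrightarrow> (\<integral>v. indicator ?B x * exp (- 1 * (norm (v :: 'a))\<^sup>2) \<partial>lborel)"
      unfolding K_def
    proof (rule integral_dominated_convergence[OF _ _ g1])
      show "AE v in lborel. (\<lambda>j. indicator ?B (x + (1 / real (Suc j)) *\<^sub>R v) * exp (- 1 * (norm (v :: 'a))\<^sup>2))
          \<longlonglongrightarrow> indicator ?B x * exp (- 1 * (norm v)\<^sup>2)"
      proof (intro AE_I2)
        fix v :: 'a
        have "(\<lambda>j. x + (1 / real (Suc j)) *\<^sub>R v) \<longlonglongrightarrow> x + 0 *\<^sub>R v"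
          by (intro tendsto_intros) real_asymp
        then have lim: "(\<lambda>j. x + (1 / real (Suc j)) *\<^sub>R v) \<longlonglongrightarrow> x" by simp
        have "eventually (\<lambda>j. indicator ?B (x + (1 / real (Suc j)) *\<^sub>R v) = (indicator ?B x :: real)) sequentially"
        proof (cases "x \<in> box a b")
          case True
          then have "eventually (\<lambda>j. x + (1 / real (Suc j)) *\<^sub>R v \<in> box a b) sequentially"
            using lim open_box topological_tendstoD by blast
          then show ?thesis
            by eventually_elim (use True box_subset_cbox in \<open>auto simp: indicator_def\<close>)
        next
          case False
          then have "x \<in> - ?B" using x by auto
          then have "eventually (\<lambda>j. x + (1 / real (Suc j)) *\<^sub>R v \<in> - ?B) sequentially"
            using lim topological_tendstoD[OF lim, of "- ?B"] by (simp add: closed_cbox open_Compl)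
          then show ?thesis
            by eventually_elim (use \<open>x \<in> - ?B\<close> in \<open>auto simp: indicator_def\<close>)
        qed
        then have "eventually (\<lambda>j. indicator ?B (x + (1 / real (Suc j)) *\<^sub>R v) * exp (- 1 * (norm v)\<^sup>2) =
            indicator ?B x * exp (- 1 * (norm v)\<^sup>2)) sequentially"
          by eventually_elim simp
        then show "(\<lambda>j. indicator ?B (x + (1 / real (Suc j)) *\<^sub>R v) * exp (- 1 * (norm v)\<^sup>2))
          \<longlonglongrightarrow> indicator ?B x * exp (- 1 * (norm v)\<^sup>2)"
          by (rule tendsto_eventually)
      qed
    qed (auto simp: indicator_def)
    then show ?thesis by (simp add: gauss_int_def)
  qed
  have "(\<lambda>j. \<integral>x. h x * K (1 / real (Suc j)) x \<partial>lborel) \<longlonglongrightarrow> (\<integral>x. h x * (indicator ?B x * ?I) \<partial>lborel)"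
  proof (rule integral_dominated_convergence[where w = "\<lambda>x. \<bar>h x\<bar> * ?I"])
    show "integrable lborel (\<lambda>x. \<bar>h x\<bar> * ?I)" using h by simp
    have "negligible (cbox a b - box a b)" by (rule negligible_frontier_interval)
    then have "cbox a b - box a b \<in> null_sets lborel"
      by (simp add: negligible_iff_null_sets null_sets_completion_iff)
    then have "AE x in lborel. x \<notin> cbox a b - box a b" by (rule AE_not_in)
    then show "AE x in lborel. (\<lambda>j. h x * K (1 / real (Suc j)) x) \<longlonglongrightarrow> h x * (indicator ?B x * ?I)"
      by eventually_elim (intro tendsto_mult tendsto_const lim_K)
    show "AE x in lborel. norm (h x * K (1 / real (Suc j)) x) \<le> \<bar>h x\<bar> * ?I" for j
      using K_bound by (intro AE_I2) (simp add: abs_mult mult_left_mono)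
  qed measurable
  moreover have "(\<integral>x. h x * K (1 / real (Suc j)) x \<partial>lborel) = 0" for j
    by (rule K0) simp
  ultimately have "(\<integral>x. h x * (indicator ?B x * ?I) \<partial>lborel) = 0"
    by (simp add: LIMSEQ_const_iff)
  then show ?thesis
    using gauss_int_pos[of 1, where 'a = 'a] by (simp add: mult.assoc[symmetric])
qed

text \<open>Integrals over all boxes vanish, so Lebesgue differentiation along shrinking cubes gives
  the value 0 outside a negligible set.\<close>

lemma fourier_injective_lborel:
  fixes h :: "'a::euclidean_space \<Rightarrow> real"
  assumes h: "integrable lborel h"
    and zero: "\<And>y. (\<integral>x. exp (- \<i> * of_real (x \<bullet> y)) * of_real (h x) \<partial>lborel) = 0"
  shows "AE x in lborel. h x = 0"
proof -
  have cbox: "(h has_integral 0) (cbox a b)" for a b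
  proof -
    have "integrable lborel (\<lambda>x. h x * indicator (cbox a b) x)"
      using h by (rule integrable_real_mult_indicator[rotated]) simp
    then have "((\<lambda>x. h x * indicator (cbox a b) x) has_integral 0) UNIV"
      using has_integral_integral_lborel[of "\<lambda>x. h x * indicator (cbox a b) x"]
        integral_cbox_eq_0_if_fourier_0[OF h zero] by simp
    also have "(\<lambda>x. h x * indicator (cbox a b) x) = (\<lambda>x. if x \<in> cbox a b then h x else 0)"
      by (auto simp: indicator_def)
    finally show ?thesis by (simp only: has_integral_restrict_UNIV)
  qed
  obtain N where N: "negligible N"
    "\<And>x e. x \<notin> N \<Longrightarrow> 0 < e \<Longrightarrow> \<exists>d>0. \<forall>t. 0 < t \<and> t < d \<longrightarrow>
       norm (integral (cbox x (x + t *\<^sub>R One)) h /\<^sub>R t ^ DIM('a) - h x) < e"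
    using integrable_ccontinuous_explicit[of h] cbox by (metis has_integral_integrable)
  have "h x = 0" if x: "x \<notin> N" for x
  proof (rule ccontr)
    assume "h x \<noteq> 0"
    then obtain d where d: "d > 0" "\<And>t. 0 < t \<Longrightarrow> t < d \<Longrightarrow>
        norm (integral (cbox x (x + t *\<^sub>R One)) h /\<^sub>R t ^ DIM('a) - h x) < \<bar>h x\<bar>"
      using N(2)[OF x, of "\<bar>h x\<bar>"] by auto
    from d(2)[of "d / 2"] d(1) show False
      using integral_unique[OF cbox] by simp
  qed
  then have "{x. h x \<noteq> 0} \<subseteq> N" by blast
  then have "negligible {x. h x \<noteq> 0}" using N(1) negligible_subset by blast
  moreover have "{x. h x \<noteq> 0} \<in> sets lborel"
    using h by measurable
  ultimately have "{x. h x \<noteq> 0} \<in> null_sets lborel"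
    by (simp add: negligible_iff_null_sets null_sets_completion_iff)
  then have "AE x in lborel. x \<notin> {x. h x \<noteq> 0}" by (rule AE_not_in)
  then show ?thesis by simp
qed

section \<open>The kernel as a series of exponentials of tensor powers\<close>

definition vector_tensor :: "nat \<Rightarrow> (complex, 'n::finite) clifford \<Rightarrow> real ^ 'n \<Rightarrow> (complex, 'n) tensor"
  where "vector_tensor n v x \<phi> = mon n x \<phi> *\<^sub>R v"

lemma tensor_poly_vector_tensor: "tensor_poly n (vector_tensor n v x) y = of_real ((x \<bullet> y) ^ n) *s v"
proof -
  have "tensor_poly n (vector_tensor n v x) y = (\<Sum>\<phi>\<in>multi_idx n. mon n x \<phi> * mon n y \<phi>) *\<^sub>R v"
    by (simp add: tensor_poly_def vector_tensor_def scaleR_sum_left mult.commute)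
  then show ?thesis by (simp only: sum_mon_mult scaleR_eq_scalar_mult)
qed

lemma sum_norm_vector_tensor:
  "sqrt (\<Sum>\<phi>\<in>multi_idx n. (norm (vector_tensor n v x \<phi>))\<^sup>2) = norm x ^ n * norm v"
proof -
  have "(norm (vector_tensor n v x \<phi>))\<^sup>2 = mon n x \<phi> * mon n x \<phi> * (norm v)\<^sup>2" for \<phi>
    by (simp add: vector_tensor_def power_mult_distrib power2_eq_square[of "mon n x \<phi>"])
  then have "(\<Sum>\<phi>\<in>multi_idx n. (norm (vector_tensor n v x \<phi>))\<^sup>2) = (x \<bullet> x) ^ n * (norm v)\<^sup>2"
    by (simp only: sum_distrib_right[symmetric] sum_mon_mult)
  also have "\<dots> = (norm x ^ n * norm v)\<^sup>2"
    by (simp add: power_mult_distrib dot_square_norm power_mult[symmetric] mult.commute)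
  finally show ?thesis by simp
qed

text \<open>\<Gamma> acts by left multiplications, so associativity lets it commute with right ones.
  This allows K(x,y) v to be treated as the exponential applied to <x,y>^n v in each degree.\<close>

lemma tensor_Gamma_mult_right:
  "tensor_Gamma n (\<lambda>\<phi>. T \<phi> \<odot> v) = (\<lambda>\<phi>. tensor_Gamma n T \<phi> \<odot> v)"
proof
  fix \<phi>
  have "slot_subst i j k (\<lambda>\<phi>. T \<phi> \<odot> v) \<phi> = slot_subst i j k T \<phi> \<odot> v" for i j k
    by (simp add: slot_subst_def cl_mult.zero_left)
  then show "tensor_Gamma n (\<lambda>\<phi>. T \<phi> \<odot> v) \<phi> = tensor_Gamma n T \<phi> \<odot> v"
    by (simp add: tensor_Gamma_def case_prod_unfold cl_mult.minus_left cl_mult.sum_left cl_mult_assoc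
        cl_mult.diff_left)
qed

lemma tensor_Gamma_funpow_mult_right:
  "(tensor_Gamma n ^^ k) (\<lambda>\<phi>. T \<phi> \<odot> v) = (\<lambda>\<phi>. (tensor_Gamma n ^^ k) T \<phi> \<odot> v)"
  by (induction k) (simp_all add: tensor_Gamma_mult_right)

lemma tensor_exp_mult_right:
  assumes "\<phi> \<in> multi_idx n"
  shows "tensor_exp t n (\<lambda>\<phi>. T \<phi> \<odot> v) \<phi> = tensor_exp t n T \<phi> \<odot> v"
proof -
  have "(\<lambda>k. ((t ^ k / fact k) *s (tensor_Gamma n ^^ k) T \<phi>) \<odot> v) sums (tensor_exp t n T \<phi> \<odot> v)"
    by (intro bounded_linear.sums[OF cl_mult.bounded_linear_left] tensor_exp_sums assms)
  then show ?thesis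
    using tensor_exp_sums[OF assms, of t "\<lambda>\<phi>. T \<phi> \<odot> v"]
    by (auto simp: tensor_Gamma_funpow_mult_right cl_mult_scale_left intro: sums_unique2)
qed

definition kernel_term ::
    "complex \<Rightarrow> nat \<Rightarrow> (complex, 'n::{finite,linorder}) clifford \<Rightarrow> (real, 'n) vec \<Rightarrow> (real, 'n) vec
      \<Rightarrow> (complex, 'n) clifford"
  where "kernel_term t n v x y = tensor_poly n (tensor_exp t n (vector_tensor n v x)) y"

text \<open>Unitarity of the exponential: the bound is the one that <x,y>^n v itself satisfies by
  Cauchy-Schwarz.\<close>

lemma norm_kernel_term_le:
  assumes "Re t = 0"
  shows "norm (kernel_term t n v x y) \<le> (norm x * norm y) ^ n * norm v"
  using norm_tensor_poly_exp_le[OF assms, of n "vector_tensor n v x" y]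
  by (simp add: kernel_term_def sum_norm_vector_tensor power_mult_distrib mult_ac)

lemma kernel_term_one_mult: "kernel_term t n cl_one x y \<odot> v = kernel_term t n v x y"
proof -
  have "vector_tensor n v x = (\<lambda>\<phi>. vector_tensor n cl_one x \<phi> \<odot> v)"
    by (simp add: vector_tensor_def cl_mult.scaleR_left cl_one_mult fun_eq_iff)
  then have "tensor_exp t n (vector_tensor n v x) \<phi> = tensor_exp t n (vector_tensor n cl_one x) \<phi> \<odot> v"
    if "\<phi> \<in> multi_idx n" for \<phi>
    using tensor_exp_mult_right[OF that] by simp
  then show ?thesis
    by (simp add: kernel_term_def tensor_poly_def cl_mult.sum_left cl_mult.scaleR_left)
qed

lemma kernel_term_0:
  fixes v :: "(complex, 'n::{finite,linorder}) clifford"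
  shows "kernel_term 0 n v x y = of_real ((x \<bullet> y) ^ n) *s v"
proof -
  have "tensor_exp 0 n T \<phi> = T \<phi>" if "\<phi> \<in> multi_idx n" for T :: "(complex, 'n) tensor" and \<phi>
    by (simp add: vec_eq_iff tensor_exp_nth[OF that])
  then have "kernel_term 0 n v x y = tensor_poly n (vector_tensor n v x) y"
    unfolding kernel_term_def tensor_poly_def by (intro sum.cong refl) simp
  then show ?thesis by (simp only: tensor_poly_vector_tensor)
qed

text \<open>Imaginary for every real s. Besides the two signs, s = 0 matters: it gives exponent 0,
  hence the classical kernel, so the ordinary Fourier transform is covered by the same
  lemmas.\<close>

definition kernel_exponent :: "real \<Rightarrow> complex"
  where "kernel_exponent s = - of_real s * \<i> * of_real pi / 2"

lemma Re_kernel_exponent [simp]: "Re (kernel_exponent s) = 0"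
  by (simp add: kernel_exponent_def)

text \<open>The scalar z plays the role of a complex dilation of y. Bounding sums of norms yields
  both absolute convergence and a majorant for all partial sums.\<close>

lemma sum_norm_kernel_term_le:
  assumes "Re t = 0"
  shows "(\<Sum>n<N. norm ((z ^ n * ((- \<i>) ^ n / fact n)) *s kernel_term t n v x y)) \<le>
    exp (norm z * norm y * norm x) * norm v"
proof -
  have "(\<Sum>n<N. norm ((z ^ n * ((- \<i>) ^ n / fact n)) *s kernel_term t n v x y)) \<le>
      (\<Sum>n<N. (norm z * norm y * norm x) ^ n /\<^sub>R fact n * norm v)"
  proof (rule sum_mono)
    fix n
    have "norm z ^ n / fact n * norm (kernel_term t n v x y) \<le>
        norm z ^ n / fact n * ((norm x * norm y) ^ n * norm v)"
      by (intro mult_left_mono norm_kernel_term_le assms) auto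
    moreover have "norm (z ^ n * ((- \<i>) ^ n / fact n)) = norm z ^ n / fact n"
      by (simp add: norm_mult norm_divide norm_power)
    ultimately show "norm ((z ^ n * ((- \<i>) ^ n / fact n)) *s kernel_term t n v x y) \<le>
        (norm z * norm y * norm x) ^ n /\<^sub>R fact n * norm v"
      by (simp add: norm_scalar_mult power_mult_distrib divide_inverse mult_ac)
  qed
  also have "\<dots> \<le> exp (norm z * norm y * norm x) * norm v"
    unfolding sum_distrib_right[symmetric] by (intro mult_right_mono exp_partial_sum_le) auto
  finally show ?thesis .
qed

lemma cl_kernel_mult_sums:
  "(\<lambda>n. ((- \<i>) ^ n / fact n) *s kernel_term (kernel_exponent s) n v x y) sums (cl_kernel s x y \<odot> v)"
proof -
  let ?t = "kernel_exponent s"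
  have "cl_exp_Gamma ?t (\<lambda>y. of_real ((x \<bullet> y) ^ n) *s cl_one) y = kernel_term ?t n cl_one x y" for n
  proof -
    have "(\<lambda>y. of_real ((x \<bullet> y) ^ n) *s cl_one) = tensor_poly n (vector_tensor n cl_one x)"
      by (rule ext) (simp only: tensor_poly_vector_tensor)
    then show ?thesis by (simp only: cl_exp_Gamma_tensor_poly kernel_term_def)
  qed
  then have kernel: "cl_kernel s x y = (\<Sum>n. ((- \<i>) ^ n / fact n) *s kernel_term ?t n cl_one x y)"
    by (simp only: cl_kernel_def kernel_exponent_def)
  define c where "c = (\<lambda>n. norm (((- \<i>) ^ n / fact n) *s kernel_term ?t n (cl_one :: (complex, 'a) clifford) x y))"
  have "(\<Sum>n<N. c n) \<le> exp (norm y * norm x) * norm (cl_one :: (complex, 'a) clifford)" for N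
    using sum_norm_kernel_term_le[where z = 1 and N = N and t = ?t and x = x and y = y
        and v = "cl_one :: (complex, 'a) clifford", OF Re_kernel_exponent]
    by (simp only: c_def power_one mult_1_left norm_one)
  then have "summable c"
    by (rule summableI_nonneg_bounded[rotated]) (simp add: c_def)
  then have "(\<lambda>n. ((- \<i>) ^ n / fact n) *s kernel_term ?t n cl_one x y) sums cl_kernel s x y"
    unfolding kernel c_def by (rule summable_sums[OF summable_norm_cancel])
  from bounded_linear.sums[OF cl_mult.bounded_linear_left this, of v]
  show ?thesis by (simp only: cl_mult_scale_left kernel_term_one_mult)
qed

lemma cl_kernel_0_mult: "cl_kernel 0 x y \<odot> v = exp (- \<i> * of_real (x \<bullet> y)) *s v"
proof -
  have "(\<lambda>n. ((- \<i>) ^ n / fact n) *s (of_real ((x \<bullet> y) ^ n) *s v)) sums (exp (- \<i> * of_real (x \<bullet> y)) *s v)"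
    unfolding vec_sums_iff
  proof (intro allI)
    fix A
    show "(\<lambda>n. (((- \<i>) ^ n / fact n) *s (of_real ((x \<bullet> y) ^ n) *s v)) $ A) sums
        ((exp (- \<i> * of_real (x \<bullet> y)) *s v) $ A)"
      using sums_mult2[OF exp_minus_i_inner_sums[of x y], of "v $ A"]
      by (simp only: vector_smult_component mult.assoc)
  qed
  moreover have "kernel_exponent 0 = 0" by (simp add: kernel_exponent_def)
  then have "(\<lambda>n. ((- \<i>) ^ n / fact n) *s (of_real ((x \<bullet> y) ^ n) *s v)) sums (cl_kernel 0 x y \<odot> v)"
    using cl_kernel_mult_sums[where s = 0] by (simp only: kernel_term_0)
  ultimately show ?thesis by (rule sums_unique2[rotated])
qed

section \<open>The Clifford-Fourier transform of a function with Gaussian decay\<close>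

lemma integral_tensor_Gamma:
  fixes T :: "'b \<Rightarrow> (complex, 'n::{finite,linorder}) tensor"
  assumes int: "\<And>\<phi>. \<phi> \<in> multi_idx n \<Longrightarrow> integrable M (\<lambda>x. T x \<phi>)" and \<phi>: "\<phi> \<in> multi_idx n"
  shows "integrable M (\<lambda>x. tensor_Gamma n (T x) \<phi>)"
    and "(\<integral>x. tensor_Gamma n (T x) \<phi> \<partial>M) = tensor_Gamma n (\<lambda>\<phi>. \<integral>x. T x \<phi> \<partial>M) \<phi>"
proof -
  have subst: "integrable M (\<lambda>x. slot_subst i j k (T x) \<phi>)"
    "(\<integral>x. slot_subst i j k (T x) \<phi> \<partial>M) = slot_subst i j k (\<lambda>\<phi>. \<integral>x. T x \<phi> \<partial>M) \<phi>" if "i < n" for i j k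
  proof -
    have "\<phi>(i := k) \<in> multi_idx n"
      using that \<phi> by (auto simp: multi_idx_def PiE_iff extensional_def)
    then show "integrable M (\<lambda>x. slot_subst i j k (T x) \<phi>)"
      "(\<integral>x. slot_subst i j k (T x) \<phi> \<partial>M) = slot_subst i j k (\<lambda>\<phi>. \<integral>x. T x \<phi> \<partial>M) \<phi>"
      using int by (cases "\<phi> i = j"; simp add: slot_subst_def)+
  qed
  let ?D = "\<lambda>p x. \<Sum>i<n. slot_subst i (fst p) (snd p) (T x) \<phi> - slot_subst i (snd p) (fst p) (T x) \<phi>"
  have D: "integrable M (?D p)" for p
    by (intro Bochner_Integration.integrable_sum Bochner_Integration.integrable_diff subst) auto
  have intD: "(\<integral>x. ?D p x \<partial>M) = (\<Sum>i<n. slot_subst i (fst p) (snd p) (\<lambda>\<phi>. \<integral>x. T x \<phi> \<partial>M) \<phi>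
      - slot_subst i (snd p) (fst p) (\<lambda>\<phi>. \<integral>x. T x \<phi> \<partial>M) \<phi>)" for p
    by (subst Bochner_Integration.integral_sum)
      (auto simp: subst intro!: sum.cong Bochner_Integration.integrable_diff)
  have B: "integrable M (\<lambda>x. b \<odot> ?D p x)" "(\<integral>x. b \<odot> ?D p x \<partial>M) = b \<odot> (\<integral>x. ?D p x \<partial>M)" for b p
    using integrable_bounded_linear[OF cl_mult.bounded_linear_right D[of p]]
      integral_bounded_linear[OF cl_mult.bounded_linear_right D[of p]] by blast+
  show "integrable M (\<lambda>x. tensor_Gamma n (T x) \<phi>)"
    unfolding tensor_Gamma_def case_prod_unfold
    by (intro Bochner_Integration.integrable_minus Bochner_Integration.integrable_sum B)
  show "(\<integral>x. tensor_Gamma n (T x) \<phi> \<partial>M) = tensor_Gamma n (\<lambda>\<phi>. \<integral>x. T x \<phi> \<partial>M) \<phi>"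
    unfolding tensor_Gamma_def case_prod_unfold
    by (subst Bochner_Integration.integral_minus, subst Bochner_Integration.integral_sum)
      (simp_all only: B intD)
qed

lemma integral_tensor_Gamma_funpow:
  fixes T :: "'b \<Rightarrow> (complex, 'n::{finite,linorder}) tensor"
  assumes int: "\<And>\<phi>. \<phi> \<in> multi_idx n \<Longrightarrow> integrable M (\<lambda>x. T x \<phi>)" and \<phi>: "\<phi> \<in> multi_idx n"
  shows "integrable M (\<lambda>x. (tensor_Gamma n ^^ k) (T x) \<phi>) \<and>
    (\<integral>x. (tensor_Gamma n ^^ k) (T x) \<phi> \<partial>M) = (tensor_Gamma n ^^ k) (\<lambda>\<phi>. \<integral>x. T x \<phi> \<partial>M) \<phi>"
  using \<phi>
proof (induction k arbitrary: \<phi>)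
  case 0
  then show ?case using int by simp
next
  case (Suc k)
  have int': "integrable M (\<lambda>x. (tensor_Gamma n ^^ k) (T x) \<phi>)" if "\<phi> \<in> multi_idx n" for \<phi>
    using Suc.IH[OF that] by blast
  \<comment> \<open>The induction hypothesis gives equality on \<open>multi_idx n\<close> only, so
    the two tensors cannot be rewritten as functions; \<Gamma> reads them just at such
    indices.\<close>
  have "tensor_Gamma n (\<lambda>\<phi>. \<integral>x. (tensor_Gamma n ^^ k) (T x) \<phi> \<partial>M) \<phi> =
      tensor_Gamma n ((tensor_Gamma n ^^ k) (\<lambda>\<phi>. \<integral>x. T x \<phi> \<partial>M)) \<phi>"
  proof -
    have "slot_subst i j l (\<lambda>\<phi>. \<integral>x. (tensor_Gamma n ^^ k) (T x) \<phi> \<partial>M) \<phi> =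
        slot_subst i j l ((tensor_Gamma n ^^ k) (\<lambda>\<phi>. \<integral>x. T x \<phi> \<partial>M)) \<phi>" if "i < n" for i j l
    proof -
      have "\<phi>(i := l) \<in> multi_idx n"
        using that Suc.prems by (auto simp: multi_idx_def PiE_iff extensional_def)
      from conjunct2[OF Suc.IH[OF this]] show ?thesis by (simp only: slot_subst_def)
    qed
    then show ?thesis by (simp add: tensor_Gamma_def)
  qed
  then show ?case
    using integral_tensor_Gamma[OF int' Suc.prems] by simp
qed

lemma integral_tensor_exp:
  fixes T :: "'b \<Rightarrow> (complex, 'n::{finite,linorder}) tensor"
  assumes int: "\<And>\<phi>. \<phi> \<in> multi_idx n \<Longrightarrow> integrable M (\<lambda>x. T x \<phi>)" and \<phi>: "\<phi> \<in> multi_idx n"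
  shows "integrable M (\<lambda>x. tensor_exp t n (T x) \<phi>)"
    and "(\<integral>x. tensor_exp t n (T x) \<phi> \<partial>M) = tensor_exp t n (\<lambda>\<phi>. \<integral>x. T x \<phi> \<partial>M) \<phi>"
proof -
  let ?B = "Gamma_bound TYPE('n) n"
  define f where "f = (\<lambda>k x. (t ^ k / fact k) *s (tensor_Gamma n ^^ k) (T x) \<phi>)"
  note G = integral_tensor_Gamma_funpow[where T = T, OF int \<phi>]
  have int_f: "integrable M (f k)" "(\<integral>x. f k x \<partial>M) = (t ^ k / fact k) *s (tensor_Gamma n ^^ k) (\<lambda>\<phi>. \<integral>x. T x \<phi> \<partial>M) \<phi>" for k
    unfolding f_def
    using integrable_bounded_linear[OF bounded_linear_scalar_mult conjunct1[OF G[of k]]]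
      integral_bounded_linear[OF bounded_linear_scalar_mult conjunct1[OF G[of k]]] conjunct2[OF G[of k]]
    by (simp_all only:)
  have w: "integrable M (\<lambda>x. exp (norm t * ?B) * tensor_l1 n (T x))"
    unfolding tensor_l1_def using int
    by (intro integrable_mult_right Bochner_Integration.integrable_sum Bochner_Integration.integrable_norm) auto
  have bound: "norm (\<Sum>k<N. f k x) \<le> exp (norm t * ?B) * tensor_l1 n (T x)" for N x
  proof -
    have "norm (\<Sum>k<N. f k x) \<le> (\<Sum>k<N. (norm t * ?B) ^ k /\<^sub>R fact k * tensor_l1 n (T x))"
    proof (rule order_trans[OF norm_sum sum_mono])
      fix k
      have "norm t ^ k / fact k * norm ((tensor_Gamma n ^^ k) (T x) \<phi>) \<le>
          norm t ^ k / fact k * (?B ^ k * tensor_l1 n (T x))"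
        by (intro mult_left_mono norm_Gamma_funpow_le[OF \<phi>]) auto
      moreover have "norm (t ^ k / fact k) = norm t ^ k / fact k"
        by (simp add: norm_divide norm_power)
      ultimately show "norm (f k x) \<le> (norm t * ?B) ^ k /\<^sub>R fact k * tensor_l1 n (T x)"
        by (simp add: f_def norm_scalar_mult power_mult_distrib divide_inverse mult_ac)
    qed
    also have "\<dots> \<le> exp (norm t * ?B) * tensor_l1 n (T x)"
      unfolding sum_distrib_right[symmetric]
      by (intro mult_right_mono exp_partial_sum_le tensor_l1_nonneg mult_nonneg_nonneg)
        (auto intro: less_imp_le Gamma_bound_pos)
    finally show ?thesis .
  qed
  have sums: "(\<lambda>k. f k x) sums tensor_exp t n (T x) \<phi>" for x
    unfolding f_def by (rule tensor_exp_sums[OF \<phi>])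
  note dom = integral_sums_dominated[OF borel_measurable_integrable[OF int_f(1)] w sums bound]
  show "integrable M (\<lambda>x. tensor_exp t n (T x) \<phi>)" by (rule dom(1))
  have "(\<lambda>k. (t ^ k / fact k) *s (tensor_Gamma n ^^ k) (\<lambda>\<phi>. \<integral>x. T x \<phi> \<partial>M) \<phi>) sums (\<integral>x. tensor_exp t n (T x) \<phi> \<partial>M)"
    using dom(2) by (simp only: int_f(2))
  then show "(\<integral>x. tensor_exp t n (T x) \<phi> \<partial>M) = tensor_exp t n (\<lambda>\<phi>. \<integral>x. T x \<phi> \<partial>M) \<phi>"
    using tensor_exp_sums[OF \<phi>] sums_unique2 by blast
qed

lemma integral_tensor_poly:
  assumes "\<And>\<phi>. \<phi> \<in> multi_idx n \<Longrightarrow> integrable M (\<lambda>x. T x \<phi>)"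
  shows "integrable M (\<lambda>x. tensor_poly n (T x) y)"
    and "(\<integral>x. tensor_poly n (T x) y \<partial>M) = tensor_poly n (\<lambda>\<phi>. \<integral>x. T x \<phi> \<partial>M) y"
  unfolding tensor_poly_def using assms
  by (auto intro!: Bochner_Integration.integrable_sum sum.cong simp: Bochner_Integration.integral_sum)

text \<open>Since the exponential acts in y alone, it can be applied after integrating over x. In
  each degree the transform therefore depends on F only through this tensor, whichever kernel is
  used.\<close>

definition moment_tensor :: "nat \<Rightarrow> ((real, 'n::finite) vec \<Rightarrow> (complex, 'n) clifford) \<Rightarrow> (complex, 'n) tensor"
  where "moment_tensor n F \<phi> = (\<integral>x. vector_tensor n (F x) x \<phi> \<partial>lebesgue)"

lemma integral_kernel_term:
  fixes F :: "(real, 'n::{finite,linorder}) vec \<Rightarrow> (complex, 'n) clifford"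
  assumes "\<And>\<phi>. \<phi> \<in> multi_idx n \<Longrightarrow> integrable lebesgue (\<lambda>x. vector_tensor n (F x) x \<phi>)"
  shows "integrable lebesgue (\<lambda>x. kernel_term t n (F x) x y)"
    and "(\<integral>x. kernel_term t n (F x) x y \<partial>lebesgue) = tensor_poly n (tensor_exp t n (moment_tensor n F)) y"
proof -
  note E = integral_tensor_exp[where T = "\<lambda>x. vector_tensor n (F x) x" and M = lebesgue, OF assms]
  show "integrable lebesgue (\<lambda>x. kernel_term t n (F x) x y)"
    unfolding kernel_term_def by (rule integral_tensor_poly(1)) (rule E(1))
  have "(\<integral>x. kernel_term t n (F x) x y \<partial>lebesgue) =
      tensor_poly n (\<lambda>\<phi>. \<integral>x. tensor_exp t n (vector_tensor n (F x) x) \<phi> \<partial>lebesgue) y"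
    unfolding kernel_term_def by (rule integral_tensor_poly(2)) (rule E(1))
  also have "\<dots> = tensor_poly n (tensor_exp t n (moment_tensor n F)) y"
    unfolding tensor_poly_def using E(2) by (intro sum.cong refl) (simp add: moment_tensor_def[abs_def])
  finally show "(\<integral>x. kernel_term t n (F x) x y \<partial>lebesgue) = tensor_poly n (tensor_exp t n (moment_tensor n F)) y" .
qed

text \<open>For j = 0 the factor \<open>real j\<close> makes the truncated exponent
  \<open>j - 1\<close> harmless.\<close>

lemma partial_deriv_radial:
  fixes v :: "(complex, 'n::{finite,linorder}) clifford"
  shows "partial_deriv k (\<lambda>y. of_real ((y \<bullet> y) ^ j) *s v) y =
    y $ k *\<^sub>R ((2 * real j * (y \<bullet> y) ^ (j - 1)) *\<^sub>R v)"
proof -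
  have "((\<lambda>y. (y \<bullet> y) ^ j *\<^sub>R v) has_derivative
      (\<lambda>h. (real j * (y \<bullet> h + h \<bullet> y) * (y \<bullet> y) ^ (j - 1)) *\<^sub>R v)) (at y)"
    by (auto intro!: derivative_eq_intros)
  then have "partial_deriv k (\<lambda>y. (y \<bullet> y) ^ j *\<^sub>R v) y =
      (real j * (y \<bullet> axis k 1 + axis k 1 \<bullet> y) * (y \<bullet> y) ^ (j - 1)) *\<^sub>R v"
    by (simp add: partial_deriv_def frechet_derivative_at[symmetric])
  also have "\<dots> = y $ k *\<^sub>R ((2 * real j * (y \<bullet> y) ^ (j - 1)) *\<^sub>R v)"
    by (simp add: inner_axis inner_axis' mult_ac)
  finally show ?thesis by (simp only: scaleR_eq_scalar_mult)
qed

text \<open>The k-th derivative of a radial function is y_k times a factor independent of k, so each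
  infinitesimal rotation y_j \<partial>_k - y_k \<partial>_j cancels.\<close>

lemma cl_Gamma_radial: "cl_Gamma (\<lambda>y. of_real ((y \<bullet> y) ^ j) *s v) = (\<lambda>_. 0)"
  by (rule ext) (simp add: cl_Gamma_def partial_deriv_radial cl_mult.zero_right mult.left_commute
      del: of_real_power)

lemma tensor_poly_scale: "tensor_poly n T (r *\<^sub>R y) = of_real (r ^ n) *s tensor_poly n T y"
proof -
  have "mon n (r *\<^sub>R y) \<phi> = r ^ n * mon n y \<phi>" for \<phi>
    by (simp add: mon_def prod.distrib)
  then have "tensor_poly n T (r *\<^sub>R y) = r ^ n *\<^sub>R tensor_poly n T y"
    by (simp add: tensor_poly_def scaleR_sum_right)
  then show ?thesis by (simp only: scaleR_eq_scalar_mult)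
qed

text \<open>The counterpart of \<open>tensor_poly_eq_exp_if_killed\<close>: here \<Gamma> is known
  to annihilate the polynomial itself, so the series stops after its first term. It serves for
  explicit Gaussians, whose moments are known.\<close>

lemma tensor_poly_exp_if_killed:
  fixes T :: "(complex, 'n::{finite,linorder}) tensor"
  assumes "cl_Gamma (tensor_poly n T) = (\<lambda>_. 0)"
  shows "tensor_poly n (tensor_exp t n T) = tensor_poly n T"
proof
  fix y
  have zero: "cl_Gamma (\<lambda>_. 0) = (\<lambda>_ :: (real, 'n) vec. 0)"
    by (simp add: cl_Gamma_def partial_deriv_def cl_mult.zero_right fun_eq_iff)
  have "tensor_poly n ((tensor_Gamma n ^^ Suc k) T) = (\<lambda>_. 0)" for k
    by (induction k) (use assms zero in \<open>simp_all add: cl_Gamma_tensor_poly[symmetric]\<close>)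
  then have killed: "tensor_poly n ((tensor_Gamma n ^^ k) T) y = 0" if "k \<noteq> 0" for k
    using that by (cases k) (auto simp: fun_eq_iff)
  have "(\<lambda>k. (t ^ k / fact k) *s tensor_poly n ((tensor_Gamma n ^^ k) T) y) sums
      (\<Sum>k\<in>{0}. (t ^ k / fact k) *s tensor_poly n ((tensor_Gamma n ^^ k) T) y)"
    by (rule sums_finite) (auto simp: killed)
  then show "tensor_poly n (tensor_exp t n T) y = tensor_poly n T y"
    using sums_unique2[OF tensor_poly_exp_sums] by fastforce
qed

lemma integral_vec_component:
  fixes f :: "'b \<Rightarrow> complex ^ 'k"
  assumes "integrable M f"
  shows "(\<integral>x. f x \<partial>M) $ A = (\<integral>x. f x $ A \<partial>M)" "integrable M (\<lambda>x. f x $ A)"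
  using integral_bounded_linear[OF bounded_linear_vec_nth assms]
    integrable_bounded_linear[OF bounded_linear_vec_nth assms] by auto

section \<open>The integral transform and its extension to complex multiples of y\<close>

locale gaussian_decay =
  fixes F :: "(real, 'n::{finite,linorder}) vec \<Rightarrow> (complex, 'n) clifford" and p C :: real
  assumes measurable_F [measurable]: "F \<in> borel_measurable lebesgue"
    and p: "p > 0" and decay: "norm (F x) \<le> C * exp (- p * (norm x)\<^sup>2)"
begin

lemma C_nonneg: "C \<ge> 0"
  using order_trans[OF norm_ge_zero decay[of 0]] by simp

lemma radial_integral:
  "\<exists>D\<ge>0. \<forall>r\<ge>0. integrable lebesgue (\<lambda>x. exp (r * norm x) * norm (F x)) \<and>
    (\<integral>x. exp (r * norm x) * norm (F x) \<partial>lebesgue) \<le> D * (1 + r ^ CARD('n)) * exp (r\<^sup>2 / (4 * p))"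
proof -
  let ?g = "\<lambda>r (x :: (real, 'n) vec). exp (r * norm x) * exp (- p * (norm x)\<^sup>2)"
  obtain D where D: "D \<ge> 0" "\<And>r. r \<ge> 0 \<Longrightarrow> integrable lborel (?g r) \<and>
      (\<integral>x. ?g r x \<partial>lborel) \<le> D * (1 + r ^ DIM((real, 'n) vec)) * exp (r\<^sup>2 / (4 * p))"
    using radial_exp_gaussian[OF p, where 'a = "(real, 'n) vec"] by blast
  have "integrable lebesgue (\<lambda>x. exp (r * norm x) * norm (F x)) \<and>
    (\<integral>x. exp (r * norm x) * norm (F x) \<partial>lebesgue) \<le> (C * D) * (1 + r ^ CARD('n)) * exp (r\<^sup>2 / (4 * p))"
    if r: "r \<ge> 0" for r
  proof -
    have meas: "?g r \<in> borel_measurable lborel" by measurable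
    have g: "integrable lebesgue (\<lambda>x. C * ?g r x)"
      using D(2)[OF r] integrable_completion[OF meas] by (intro integrable_mult_right) simp
    have le: "exp (r * norm x) * norm (F x) \<le> C * ?g r x" for x
      using mult_left_mono[OF decay[of x], of "exp (r * norm x)"] by (simp add: mult_ac)
    have "(\<lambda>x :: (real, 'n) vec. exp (r * norm x)) \<in> borel_measurable lebesgue"
      by (intro measurable_completion) measurable
    then have m: "(\<lambda>x. exp (r * norm x) * norm (F x)) \<in> borel_measurable lebesgue"
      by measurable
    have "norm (exp (r * norm x) * norm (F x)) \<le> norm (C * ?g r x)" for x
    proof -
      have "norm (exp (r * norm x) * norm (F x)) = exp (r * norm x) * norm (F x)" by simp
      then show ?thesis using le[of x] by (simp only: real_norm_def)
    qed
    then have int: "integrable lebesgue (\<lambda>x. exp (r * norm x) * norm (F x))"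
      by (intro Bochner_Integration.integrable_bound[OF g m] AE_I2)
    have "(\<integral>x. exp (r * norm x) * norm (F x) \<partial>lebesgue) \<le> (\<integral>x. C * ?g r x \<partial>lebesgue)"
      by (rule Bochner_Integration.integral_mono[OF int g le])
    also have "\<dots> = C * (\<integral>x. ?g r x \<partial>lborel)"
      using integral_completion[OF meas] by simp
    also have "\<dots> \<le> C * (D * (1 + r ^ CARD('n)) * exp (r\<^sup>2 / (4 * p)))"
      using D(2)[OF r] C_nonneg by (intro mult_left_mono) auto
    finally show ?thesis using int by (simp add: mult_ac)
  qed
  then show ?thesis
    using C_nonneg D(1) by (intro exI[of _ "C * D"]) auto
qed

lemma integrable_exp_norm:
  "r \<ge> 0 \<Longrightarrow> integrable lebesgue (\<lambda>x. exp (r * norm x) * norm (F x))"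
  using radial_integral by blast

lemma integrable_vector_tensor: "integrable lebesgue (\<lambda>x. vector_tensor n (F x) x \<phi>)"
proof -
  have g: "integrable lebesgue (\<lambda>x. fact n * (exp (1 * norm x) * norm (F x)))"
    by (intro integrable_mult_right integrable_exp_norm) simp
  show ?thesis
  proof (rule Bochner_Integration.integrable_bound[OF g])
    have "(\<lambda>x :: (real, 'n) vec. mon n x \<phi>) \<in> borel_measurable lebesgue"
      unfolding mon_def
      by (intro measurable_completion) (auto intro!: borel_measurable_continuous_onI continuous_intros)
    then show "(\<lambda>x. vector_tensor n (F x) x \<phi>) \<in> borel_measurable lebesgue"
      unfolding vector_tensor_def by measurable
    show "AE x in lebesgue. norm (vector_tensor n (F x) x \<phi>) \<le> norm (fact n * (exp (1 * norm x) * norm (F x)))"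
    proof (intro AE_I2)
      fix x :: "(real, 'n) vec"
      \<comment> \<open>A single term of the exponential series absorbs the polynomial weight into
        exp |x|, against which F is integrable.\<close>
      have "norm x ^ n /\<^sub>R fact n \<le> (\<Sum>k<Suc n. norm x ^ k /\<^sub>R fact k)"
        by (rule member_le_sum) auto
      also have "\<dots> \<le> exp (norm x)" by (rule exp_partial_sum_le) simp
      finally have "norm x ^ n \<le> fact n * exp (norm x)" by (simp add: field_simps)
      then have "\<bar>mon n x \<phi>\<bar> \<le> fact n * exp (norm x)"
        using abs_mon_le[of n x \<phi>] by linarith
      then have "\<bar>mon n x \<phi>\<bar> * norm (F x) \<le> fact n * exp (norm x) * norm (F x)"
        by (rule mult_right_mono) simp
      then show "norm (vector_tensor n (F x) x \<phi>) \<le> norm (fact n * (exp (1 * norm x) * norm (F x)))"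
        by (simp add: vector_tensor_def abs_mult mult.assoc)
    qed
  qed
qed

text \<open>For \<open>t = kernel_exponent s\<close>, and up to the factor (-i)^n/n!, the
  homogeneous part of degree n of the integral of K(x,y)F(x); t = 0 gives the classical one.\<close>

definition moment_poly :: "complex \<Rightarrow> nat \<Rightarrow> (real, 'n) vec \<Rightarrow> (complex, 'n) clifford"
  where "moment_poly t n = tensor_poly n (tensor_exp t n (moment_tensor n F))"

lemma integral_kernel_term_moment:
  "integrable lebesgue (\<lambda>x. kernel_term t n (F x) x y)"
  "(\<integral>x. kernel_term t n (F x) x y \<partial>lebesgue) = moment_poly t n y"
  using integral_kernel_term[OF integrable_vector_tensor, where n = n and t = t and y = y] by (simp_all add: moment_poly_def)

lemma moment_poly_scale: "moment_poly t n (r *\<^sub>R y) = of_real (r ^ n) *s moment_poly t n y"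
  by (simp only: moment_poly_def tensor_poly_scale)

text \<open>For \<open>t = kernel_exponent s\<close>, \<open>S z x y\<close> plays the role of K(x,
  zy)F(x). It is given by the series because zy is not a real vector for general z; the third claim
  is the growth estimate of the entire extension.\<close>

lemma moment_poly_sums_aux:
  assumes t: "Re t = 0"
  defines "S \<equiv> \<lambda>z x y. \<Sum>n. (z ^ n * ((- \<i>) ^ n / fact n)) *s kernel_term t n (F x) x y"
  shows "integrable lebesgue (\<lambda>x. S z x y)"
    and "(\<lambda>n. (z ^ n * ((- \<i>) ^ n / fact n)) *s moment_poly t n y) sums (\<integral>x. S z x y \<partial>lebesgue)"
    and "norm (\<integral>x. S z x y \<partial>lebesgue) \<le> (\<integral>x. exp (norm z * norm y * norm x) * norm (F x) \<partial>lebesgue)"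
proof -
  let ?c = "\<lambda>n. z ^ n * ((- \<i>) ^ n / fact n)"
  define f where "f = (\<lambda>n x. ?c n *s kernel_term t n (F x) x y)"
  let ?w = "\<lambda>x. exp (norm z * norm y * norm x) * norm (F x)"
  have w: "integrable lebesgue ?w" by (intro integrable_exp_norm) simp
  have f: "integrable lebesgue (f n)" "(\<integral>x. f n x \<partial>lebesgue) = ?c n *s moment_poly t n y" for n
    unfolding f_def integral_kernel_term_moment(2)[symmetric]
    by (rule integrable_bounded_linear[OF bounded_linear_scalar_mult integral_kernel_term_moment(1)],
      rule integral_bounded_linear[OF bounded_linear_scalar_mult integral_kernel_term_moment(1)])
  have sum_norm: "(\<Sum>n<N. norm (f n x)) \<le> ?w x" for N x
    unfolding f_def by (rule sum_norm_kernel_term_le[OF t])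
  have summable: "summable (\<lambda>n. norm (f n x))" for x
    by (rule summableI_nonneg_bounded[OF _ sum_norm]) simp
  have sums: "(\<lambda>n. f n x) sums S z x y" for x
    unfolding S_def f_def[symmetric]
    using summable_sums[OF summable_norm_cancel[OF summable[of x]]] by (simp add: f_def)
  have bound: "norm (\<Sum>n<N. f n x) \<le> ?w x" for N x
    using norm_sum sum_norm by (rule order_trans)
  note dom = integral_sums_dominated[OF borel_measurable_integrable[OF f(1)] w sums bound]
  show "integrable lebesgue (\<lambda>x. S z x y)" by (rule dom(1))
  show "(\<lambda>n. ?c n *s moment_poly t n y) sums (\<integral>x. S z x y \<partial>lebesgue)"
    using dom(2) by (simp only: f(2))
  have "norm (S z x y) \<le> ?w x" for x
  proof (rule LIMSEQ_le_const2)
    show "(\<lambda>N. norm (\<Sum>n<N. f n x)) \<longlonglongrightarrow> norm (S z x y)"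
      using sums[of x] unfolding sums_def by (rule tendsto_norm)
  qed (use bound in auto)
  then have "(\<integral>x. norm (S z x y) \<partial>lebesgue) \<le> (\<integral>x. ?w x \<partial>lebesgue)"
    by (intro Bochner_Integration.integral_mono w Bochner_Integration.integrable_norm dom(1))
  with integral_norm_bound show "norm (\<integral>x. S z x y \<partial>lebesgue) \<le> (\<integral>x. ?w x \<partial>lebesgue)"
    by (rule order_trans)
qed

lemma integrable_cl_kernel: "integrable lebesgue (\<lambda>x. cl_kernel s x y \<odot> F x)"
  and cl_kernel_integral_sums: "(\<lambda>n. ((- \<i>) ^ n / fact n) *s moment_poly (kernel_exponent s) n y) sums
    (\<integral>x. cl_kernel s x y \<odot> F x \<partial>lebesgue)"
proof -
  have "(\<Sum>n. (1 ^ n * ((- \<i>) ^ n / fact n)) *s kernel_term (kernel_exponent s) n (F x) x y) = cl_kernel s x y \<odot> F x" for x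
    using sums_unique[OF cl_kernel_mult_sums[of s "F x" x y]] by simp
  then show "integrable lebesgue (\<lambda>x. cl_kernel s x y \<odot> F x)"
    "(\<lambda>n. ((- \<i>) ^ n / fact n) *s moment_poly (kernel_exponent s) n y) sums
      (\<integral>x. cl_kernel s x y \<odot> F x \<partial>lebesgue)"
    using moment_poly_sums_aux(1,2)[of "kernel_exponent s" 1 y] by simp_all
qed

text \<open>Along the line spanned by y, \<open>hardy_entire\<close> determines each component of
  the transform up to its value at 0. Coefficients of z^n are compared, and the degree 0 part is
  independent of y.\<close>

lemma moment_poly_of_hardy_bound:
  assumes q: "q \<ge> 1 / (4 * p)" and K: "K > 0"
    and bound: "\<And>y. norm (\<integral>x. cl_kernel s x y \<odot> F x \<partial>lebesgue) \<le> K * exp (- q * (norm y)\<^sup>2)"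
  shows "((- \<i>) ^ n / fact n) *s moment_poly (kernel_exponent s) n y =
    (if even n then of_real (- ((norm y)\<^sup>2 / (4 * p))) ^ (n div 2) / fact (n div 2) else 0)
      *s moment_poly (kernel_exponent s) 0 0"
proof -
  let ?t = "kernel_exponent s"
  let ?U = "moment_poly ?t"
  define a where "a = (norm y)\<^sup>2 / (4 * p)"
  have a: "a \<ge> 0" using p by (simp add: a_def)
  have U0: "?U 0 y = ?U 0 0"
    using moment_poly_scale[of ?t 0 0 y] by simp
  define G where "G = (\<lambda>z. \<integral>x. (\<Sum>n. (z ^ n * ((- \<i>) ^ n / fact n)) *s kernel_term ?t n (F x) x y) \<partial>lebesgue)"
  have G_sums: "(\<lambda>n. (z ^ n * ((- \<i>) ^ n / fact n)) *s ?U n y) sums G z" for z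
    unfolding G_def by (rule moment_poly_sums_aux(2)) simp
  have G_bound: "norm (G z) \<le> (\<integral>x. exp (norm z * norm y * norm x) * norm (F x) \<partial>lebesgue)" for z
    unfolding G_def by (rule moment_poly_sums_aux(3)) simp
  have G_real: "G (of_real r) = (\<integral>x. cl_kernel s x (r *\<^sub>R y) \<odot> F x \<partial>lebesgue)" for r
  proof -
    have "(\<lambda>n. (of_real r ^ n * ((- \<i>) ^ n / fact n)) *s ?U n y) sums (\<integral>x. cl_kernel s x (r *\<^sub>R y) \<odot> F x \<partial>lebesgue)"
      using cl_kernel_integral_sums[of s "r *\<^sub>R y"] by (simp add: moment_poly_scale mult.commute vector_smult_assoc)
    with G_sums show ?thesis by (rule sums_unique2)
  qed
  have "(((- \<i>) ^ n / fact n) *s ?U n y) $ A =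
      (if even n then of_real (- a) ^ (n div 2) / fact (n div 2) else 0) * ?U 0 0 $ A" for A
  proof -
    define g where "g = (\<lambda>z. G z $ A)"
    define c where "c = (\<lambda>n. ((- \<i>) ^ n / fact n) * ?U n y $ A)"
    have g_sums: "(\<lambda>n. c n * z ^ n) sums g z" for z
      using G_sums[of z] by (simp add: vec_sums_iff g_def c_def mult_ac)
    have hol: "g holomorphic_on UNIV"
    proof -
      have "g holomorphic_on ball 0 (real N)" for N
        by (rule power_series_holomorphic[where a = c]) (use g_sums in simp)
      then have "g holomorphic_on (\<Union>N. ball 0 (real N))"
        by (intro holomorphic_on_UN_open) auto
      also have "(\<Union>N. ball 0 (real N)) = (UNIV :: complex set)"
        using reals_Archimedean2 by (auto simp: dist_norm)
      finally show ?thesis .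
    qed
    obtain D where D: "D \<ge> 0" "\<And>r. r \<ge> 0 \<Longrightarrow>
       (\<integral>x. exp (r * norm x) * norm (F x) \<partial>lebesgue) \<le> D * (1 + r ^ CARD('n)) * exp (r\<^sup>2 / (4 * p))"
      using radial_integral by blast
    \<comment> \<open>Chosen through 1 + (uv)^m \<le> (1 + u^m)(1 + v^m), so that only powers of |z|
      remain outside the constant.\<close>
    define D' where "D' = D * (1 + norm y ^ CARD('n))"
    have growth: "norm (g z) \<le> D' * (1 + norm z ^ CARD('n)) * exp (a * (norm z)\<^sup>2)" for z
    proof -
      have "norm (g z) \<le> D * (1 + (norm z * norm y) ^ CARD('n)) * exp ((norm z * norm y)\<^sup>2 / (4 * p))"
        using Finite_Cartesian_Product.norm_nth_le[of "G z" A] G_bound[of z] D(2)[of "norm z * norm y"]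
        by (simp add: g_def)
      also have "\<dots> \<le> D' * (1 + norm z ^ CARD('n)) * exp ((norm z * norm y)\<^sup>2 / (4 * p))"
      proof -
        have "1 + (norm z * norm y) ^ CARD('n) \<le> (1 + norm y ^ CARD('n)) * (1 + norm z ^ CARD('n))"
          by (simp add: algebra_simps power_mult_distrib)
        then show ?thesis
          using D(1) by (auto simp: D'_def mult.assoc intro!: mult_left_mono mult_right_mono)
      qed
      finally show ?thesis by (simp add: a_def power_mult_distrib mult_ac)
    qed
    have real: "norm (g (of_real r)) \<le> K * exp (- a * r\<^sup>2)" for r
    proof -
      have "norm (g (of_real r)) \<le> K * exp (- q * (norm (r *\<^sub>R y))\<^sup>2)"
        using Finite_Cartesian_Product.norm_nth_le[of "G (of_real r)" A] bound[of "r *\<^sub>R y"] by (simp add: g_def G_real)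
      also have "\<dots> \<le> K * exp (- a * r\<^sup>2)"
      proof -
        \<comment> \<open>The decay is deliberately weakened to the critical rate, where it matches
          the growth rate a. Any surplus in q is exploited only after the transform is
          known.\<close>
        have "1 / (4 * p) * (norm (r *\<^sub>R y))\<^sup>2 \<le> q * (norm (r *\<^sub>R y))\<^sup>2"
          by (rule mult_right_mono[OF q]) simp
        also have "1 / (4 * p) * (norm (r *\<^sub>R y))\<^sup>2 = a * r\<^sup>2"
          by (simp add: a_def power_mult_distrib)
        finally show ?thesis using K by simp
      qed
      finally show ?thesis .
    qed
    have g: "g z = g 0 * exp (- of_real a * z\<^sup>2)" for z
      by (rule hardy_entire[OF hol a K _ growth real]) (use D(1) in \<open>simp add: D'_def\<close>)
    have "c 0 = g 0" using g_sums[of 0] by simp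
    then have g0: "g 0 = ?U 0 0 $ A" by (simp add: c_def U0)
    have "c = (\<lambda>n. g 0 * (if even n then of_real (- a) ^ (n div 2) / fact (n div 2) else 0))"
    proof (rule powser_unique_on_reals[where F = "\<lambda>r. g (of_real r)"])
      show "(\<lambda>n. c n * of_real r ^ n) sums g (of_real r)" for r by (rule g_sums)
      show "(\<lambda>n. g 0 * (if even n then of_real (- a) ^ (n div 2) / fact (n div 2) else 0) * of_real r ^ n)
          sums g (of_real r)" for r
        using sums_mult[OF exp_square_sums[of "of_real (- a)" "of_real r"], of "g 0"]
        by (subst g) (simp only: mult.assoc of_real_minus)
    qed
    then have "c n = g 0 * (if even n then of_real (- a) ^ (n div 2) / fact (n div 2) else 0)"
      by (rule fun_cong)
    then show ?thesis by (simp add: c_def g0 mult.commute)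
  qed
  then show ?thesis unfolding vec_eq_iff a_def by simp
qed

lemma kernel_integrals_eq:
  assumes "\<And>n. moment_poly (kernel_exponent s) n = moment_poly 0 n"
  shows "(\<integral>x. cl_kernel s x y \<odot> F x \<partial>lebesgue) = (\<integral>x. exp (- \<i> * of_real (x \<bullet> y)) *s F x \<partial>lebesgue)"
proof -
  have "kernel_exponent 0 = 0" by (simp add: kernel_exponent_def)
  then have "(\<integral>x. cl_kernel s x y \<odot> F x \<partial>lebesgue) = (\<integral>x. cl_kernel 0 x y \<odot> F x \<partial>lebesgue)"
    using sums_unique2[OF cl_kernel_integral_sums[of s y]] cl_kernel_integral_sums[of 0 y] assms by simp
  then show ?thesis by (simp only: cl_kernel_0_mult)
qed

lemma moment_poly_0: "moment_poly 0 n = tensor_poly n (moment_tensor n F)"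
proof
  fix y
  have "tensor_exp 0 n (moment_tensor n F) \<phi> = moment_tensor n F \<phi>" if "\<phi> \<in> multi_idx n" for \<phi>
    by (simp add: vec_eq_iff tensor_exp_nth[OF that])
  then show "moment_poly 0 n y = tensor_poly n (moment_tensor n F) y"
    unfolding moment_poly_def tensor_poly_def by (intro sum.cong refl) simp
qed

lemma hardy_transform:
  assumes q: "q \<ge> 1 / (4 * p)" and K: "K > 0"
    and bound: "\<And>y. norm (\<integral>x. cl_kernel s x y \<odot> F x \<partial>lebesgue) \<le> K * exp (- q * (norm y)\<^sup>2)"
  shows "(\<integral>x. cl_kernel s x y \<odot> F x \<partial>lebesgue) = (\<integral>x. exp (- \<i> * of_real (x \<bullet> y)) *s F x \<partial>lebesgue)"
    and "(\<integral>x. cl_kernel s x y \<odot> F x \<partial>lebesgue) = of_real (exp (- ((norm y)\<^sup>2 / (4 * p)))) *s (\<integral>x. F x \<partial>lebesgue)"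
proof -
  let ?t = "kernel_exponent s"
  let ?U = "moment_poly ?t"
  define V where "V = ?U 0 0"
  note U = moment_poly_of_hardy_bound[OF q K bound, folded V_def]
  have killed: "cl_Gamma (?U n) = (\<lambda>_. 0)" for n
  proof -
    \<comment> \<open>What remains after dividing by (-i)^n/n! and splitting off |y|^n from
      (-|y|^2/(4p))^{n/2}; the part of degree n is thereby visibly radial.\<close>
    define v where "v = (if even n then (fact n / (- \<i>) ^ n * (of_real (- 1 / (4 * p)) ^ (n div 2) / fact (n div 2))) *s V else 0)"
    have "?U n = (\<lambda>y. of_real ((y \<bullet> y) ^ (n div 2)) *s v)"
    proof
      fix y
      have "?U n y = (fact n / (- \<i>) ^ n) *s (((- \<i>) ^ n / fact n) *s ?U n y)"
        by (simp add: vec_eq_iff)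
      also have "\<dots> = of_real ((y \<bullet> y) ^ (n div 2)) *s v"
      proof (cases "even n")
        case True
        have "complex_of_real (- ((norm y)\<^sup>2 / (4 * p))) ^ (n div 2) =
            of_real ((y \<bullet> y) ^ (n div 2)) * of_real (- 1 / (4 * p)) ^ (n div 2)"
          unfolding power2_norm_eq_inner of_real_power[symmetric] of_real_mult[symmetric] power_mult_distrib[symmetric]
          by simp
        then show ?thesis
          unfolding U v_def using True by (simp add: vec_eq_iff)
      next
        case False
        then show ?thesis unfolding U v_def by (simp add: vec_eq_iff)
      qed
      finally show "?U n y = of_real ((y \<bullet> y) ^ (n div 2)) *s v" .
    qed
    then show ?thesis by (simp only: cl_Gamma_radial)
  qed
  have eq: "?U n = moment_poly 0 n" for n
    unfolding moment_poly_0 unfolding moment_poly_def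
    by (rule tensor_poly_eq_exp_if_killed) (use killed[of n] in \<open>simp only: moment_poly_def\<close>)
  show 1: "(\<integral>x. cl_kernel s x y \<odot> F x \<partial>lebesgue) = (\<integral>x. exp (- \<i> * of_real (x \<bullet> y)) *s F x \<partial>lebesgue)" for y
    by (rule kernel_integrals_eq[OF eq])
  have 2: "(\<integral>x. cl_kernel s x y \<odot> F x \<partial>lebesgue) = exp (of_real (- ((norm y)\<^sup>2 / (4 * p)))) *s V" for y
  proof -
    have "(\<lambda>n. (if even n then of_real (- ((norm y)\<^sup>2 / (4 * p))) ^ (n div 2) / fact (n div 2) else 0) *s V) sums
      (exp (of_real (- ((norm y)\<^sup>2 / (4 * p)))) *s V)"
      unfolding vec_sums_iff
    proof
      fix A
      show "(\<lambda>n. ((if even n then of_real (- ((norm y)\<^sup>2 / (4 * p))) ^ (n div 2) / fact (n div 2) else 0) *s V) $ A) sums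
        ((exp (of_real (- ((norm y)\<^sup>2 / (4 * p)))) *s V) $ A)"
        using sums_mult2[OF exp_square_sums[of "of_real (- ((norm y)\<^sup>2 / (4 * p)))" 1], of "V $ A"]
        by (simp only: power_one mult_1_right vector_smult_component)
    qed
    with cl_kernel_integral_sums[of s y, unfolded U] show ?thesis
      by (rule sums_unique2)
  qed
  \<comment> \<open>At y = 0 both the classical kernel and the Gaussian factor are 1.\<close>
  have "V = (\<integral>x. F x \<partial>lebesgue)"
    using 1[of 0] 2[of 0] by simp
  then show "(\<integral>x. cl_kernel s x y \<odot> F x \<partial>lebesgue) = of_real (exp (- ((norm y)\<^sup>2 / (4 * p)))) *s (\<integral>x. F x \<partial>lebesgue)"
    using 2[of y] by (simp only: exp_of_real)
qed

end

section \<open>From the transform back to f, and explicit Gaussians\<close>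

lemma bounded_linear_scalar_mult_left: "bounded_linear (\<lambda>c. c *s v)" for v :: "complex ^ 'k"
  by (auto intro!: bounded_linear_intro[where K = "norm v"]
      simp: norm_scalar_mult vec_eq_iff algebra_simps)

lemma integral_scalar_mult_one:
  fixes g :: "'b \<Rightarrow> complex"
  assumes "integrable M (\<lambda>x. g x *s (cl_one :: (complex, 'n::{finite,linorder}) clifford))"
  shows "(\<integral>x. g x *s cl_one \<partial>M) = (\<integral>x. g x \<partial>M) *s (cl_one :: (complex, 'n) clifford)"
proof -
  have "integrable M g"
    using integral_vec_component(2)[OF assms, of "{}"] by (simp add: cl_basis_def)
  then show ?thesis by (rule integral_bounded_linear[OF bounded_linear_scalar_mult_left])
qed

lemma norm_cl_of_real: "norm (cl_of_real v) = norm v"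
  by (simp add: cl_of_real_def norm_vec_def)

lemma bounded_linear_cl_of_real: "bounded_linear cl_of_real"
  by (rule bounded_linear_intro[where K = 1])
    (simp_all add: norm_cl_of_real, simp_all add: cl_of_real_def vec_eq_iff scaleR_conv_of_real[where 'a = complex])

lemma lborel_integral_lebesgue:
  fixes f :: "'a::euclidean_space \<Rightarrow> 'b::{banach, second_countable_topology}"
  assumes "f \<in> borel_measurable borel"
  shows "integral\<^sup>L lebesgue f = integral\<^sup>L lborel f" "integrable lebesgue f \<longleftrightarrow> integrable lborel f"
  using assms by (auto intro!: integral_completion integrable_completion)

text \<open>The function minus the Gaussian with the same transform has zero transform. Injectivity
  concerns Borel functions, so a Borel representative of the Lebesgue measurable g is used.\<close>

lemma gaussian_if_fourier_gaussian:
  fixes g :: "'a::euclidean_space \<Rightarrow> real"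
  assumes g: "integrable lebesgue g" and p: "p > 0"
    and transform: "\<And>y. (\<integral>x. exp (- \<i> * of_real (x \<bullet> y)) * of_real (g x) \<partial>lebesgue) =
      of_real (exp (- (norm y)\<^sup>2 / (4 * p)) * c)"
  shows "AE x in lebesgue. g x = exp (- p * (norm x)\<^sup>2) * (c / gauss_int TYPE('a) p)"
proof -
  let ?I = "gauss_int TYPE('a) p"
  have I: "?I > 0" by (rule gauss_int_pos[OF p])
  obtain g' where g' [measurable]: "g' \<in> borel_measurable lborel" and ae: "AE x in lborel. g x = g' x"
    using completion_ex_borel_measurable_real[OF borel_measurable_integrable[OF g]] by blast
  have [measurable]: "g' \<in> borel_measurable borel" using g' by simp
  have ae': "AE x in lebesgue. g x = g' x" using ae by (rule AE_completion)
  have [measurable]: "g \<in> borel_measurable lebesgue" using g by auto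
  have meas' [measurable]: "g' \<in> borel_measurable lebesgue" using g' by (rule measurable_completion)
  have int_g': "integrable lborel g'"
    using integrable_cong_AE[of g lebesgue g'] ae' g by (simp add: lborel_integral_lebesgue(2)[symmetric])
  define h where "h = (\<lambda>x. g' x - exp (- p * (norm x)\<^sup>2) * (c / ?I))"
  let ?e = "\<lambda>(y :: 'a) x. exp (- \<i> * of_real (x \<bullet> y))"
  have int_e: "integrable lborel (\<lambda>x. ?e y x * of_real (u x))" if "integrable lborel u" for y and u :: "'a \<Rightarrow> real"
  proof (rule Bochner_Integration.integrable_bound[OF that])
    have "u \<in> borel_measurable borel" using that by auto
    then show "(\<lambda>x. ?e y x * of_real (u x)) \<in> borel_measurable lborel" by measurable
  qed (simp add: norm_mult norm_exp_eq_Re)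
  have "AE x in lborel. h x = 0"
  proof (rule fourier_injective_lborel)
    show "integrable lborel h"
      unfolding h_def by (intro Bochner_Integration.integrable_diff int_g' integrable_mult_left gaussian_integrable p)
    fix y
    have "(\<integral>x. ?e y x * of_real (h x) \<partial>lborel) =
        (\<integral>x. ?e y x * of_real (g' x) - ?e y x * of_real (exp (- p * (norm x)\<^sup>2)) * of_real (c / ?I) \<partial>lborel)"
      by (simp only: h_def of_real_diff of_real_mult right_diff_distrib mult.assoc)
    also have "\<dots> = (\<integral>x. ?e y x * of_real (g' x) \<partial>lborel) -
        (\<integral>x. ?e y x * of_real (exp (- p * (norm x)\<^sup>2)) * of_real (c / ?I) \<partial>lborel)"
      by (intro Bochner_Integration.integral_diff integrable_mult_left int_e int_g' gaussian_integrable p)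
    also have "(\<integral>x. ?e y x * of_real (g' x) \<partial>lborel) = (\<integral>x. ?e y x * of_real (g' x) \<partial>lebesgue)"
      by (rule lborel_integral_lebesgue(1)[symmetric]) measurable
    also have "\<dots> = (\<integral>x. ?e y x * of_real (g x) \<partial>lebesgue)"
    proof (rule integral_cong_AE)
      have e: "?e y \<in> borel_measurable lebesgue"
        by (intro measurable_completion) measurable
      show "(\<lambda>x. ?e y x * of_real (g' x)) \<in> borel_measurable lebesgue"
        "(\<lambda>x. ?e y x * of_real (g x)) \<in> borel_measurable lebesgue"
        using e by measurable
      show "AE x in lebesgue. ?e y x * of_real (g' x) = ?e y x * of_real (g x)"
        using ae' by eventually_elim simp
    qed
    also have "\<dots> - (\<integral>x. ?e y x * of_real (exp (- p * (norm x)\<^sup>2)) * of_real (c / ?I) \<partial>lborel) = 0"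
      unfolding transform integral_mult_left_zero gaussian_fourier[OF p] using I by simp
    finally show "(\<integral>x. ?e y x * of_real (h x) \<partial>lborel) = 0" .
  qed
  then have "AE x in lebesgue. h x = 0" by (rule AE_completion)
  with ae' show ?thesis
    by eventually_elim (simp add: h_def)
qed

lemma hardy_class_gaussian_decay:
  assumes "f \<in> hardy_class s p q C" "p > 0"
  shows "gaussian_decay (\<lambda>x. cl_of_real (f x)) p C"
proof
  have "integrable lebesgue f" using assms by (simp add: hardy_class_def cl_B_def)
  from integrable_bounded_linear[OF bounded_linear_cl_of_real this]
  show "(\<lambda>x. cl_of_real (f x)) \<in> borel_measurable lebesgue" by (rule borel_measurable_integrable)
qed (use assms in \<open>auto simp: hardy_class_def norm_cl_of_real\<close>)

text \<open>The transform is now classical and a scalar operation on components. As f has real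
  coefficients, real-valued injectivity applies to each e_A-component, and the finitely many null
  sets are merged.\<close>

lemma hardy_class_is_gaussian:
  fixes f :: "(real, 'n::{finite,linorder}) vec \<Rightarrow> (real, 'n) clifford"
  assumes f: "f \<in> hardy_class s p q C" and p: "p > 0" and C: "C > 0" and pq: "p * q \<ge> 1 / 4"
  shows "\<exists>A. (AE x in lebesgue. f x = exp (- p * (norm x)\<^sup>2) *\<^sub>R A) \<and> (p * q > 1 / 4 \<longrightarrow> A = 0)"
proof -
  define F where "F = (\<lambda>x. cl_of_real (f x))"
  interpret gaussian_decay F p C
    unfolding F_def by (rule hardy_class_gaussian_decay[OF f p])
  define \<kappa> where "\<kappa> = (2 * pi) powr (- real CARD('n) / 2)"
  have \<kappa>: "\<kappa> > 0" by (simp add: \<kappa>_def)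
  have q: "q \<ge> 1 / (4 * p)" using pq p by (simp add: field_simps)
  have int_f: "integrable lebesgue f" using f by (simp add: hardy_class_def cl_B_def)
  have bound: "norm (\<integral>x. cl_kernel s x y \<odot> F x \<partial>lebesgue) \<le> C / \<kappa> * exp (- q * (norm y)\<^sup>2)" for y
  proof -
    have "norm (cl_Fourier s f y) \<le> C * exp (- q * (norm y)\<^sup>2)"
      using f by (simp add: hardy_class_def)
    moreover have "cl_Fourier s f y = \<kappa> *\<^sub>R (\<integral>x. cl_kernel s x y \<odot> F x \<partial>lebesgue)"
      by (simp only: cl_Fourier_def F_def \<kappa>_def)
    ultimately show ?thesis
      using \<kappa> by (simp add: field_simps)
  qed
  have K: "C / \<kappa> > 0" using C \<kappa> by simp
  note transform = hardy_transform[OF q K bound]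
  define V where "V = (\<integral>x. F x \<partial>lebesgue)"
  define v where "v = (\<lambda>A. \<integral>x. f x $ A \<partial>lebesgue)"
  let ?I = "gauss_int TYPE((real, 'n) vec) p"
  have int_F: "integrable lebesgue F"
    unfolding F_def by (rule integrable_bounded_linear[OF bounded_linear_cl_of_real int_f])
  have V_nth: "V $ A = of_real (v A)" for A
  proof -
    have "V $ A = (\<integral>x. complex_of_real (f x $ A) \<partial>lebesgue)"
      unfolding V_def integral_vec_component(1)[OF int_F] by (simp add: F_def cl_of_real_def)
    then show ?thesis by (simp add: v_def)
  qed
  have comp: "AE x in lebesgue. f x $ A = exp (- p * (norm x)\<^sup>2) * (v A / ?I)" for A
  proof (rule gaussian_if_fourier_gaussian[OF _ p])
    show "integrable lebesgue (\<lambda>x. f x $ A)"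
      using integrable_bounded_linear[OF bounded_linear_vec_nth int_f] .
    fix y :: "(real, 'n) vec"
    have int: "integrable lebesgue (\<lambda>x. exp (- \<i> * of_real (x \<bullet> y)) *s F x)"
      using integrable_cl_kernel[of 0 y] by (simp only: cl_kernel_0_mult)
    have "(\<integral>x. exp (- \<i> * of_real (x \<bullet> y)) *s F x \<partial>lebesgue) = of_real (exp (- ((norm y)\<^sup>2 / (4 * p)))) *s V"
      using transform[of y] by (simp add: V_def)
    then have "(\<integral>x. exp (- \<i> * of_real (x \<bullet> y)) *s F x \<partial>lebesgue) $ A = of_real (exp (- ((norm y)\<^sup>2 / (4 * p)))) * V $ A"
      by simp
    then show "(\<integral>x. exp (- \<i> * of_real (x \<bullet> y)) * of_real (f x $ A) \<partial>lebesgue) = of_real (exp (- (norm y)\<^sup>2 / (4 * p)) * v A)"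
      unfolding integral_vec_component(1)[OF int] by (simp add: F_def cl_of_real_def V_nth)
  qed
  define A0 where "A0 = (\<chi> A. v A / ?I)"
  have "AE x in lebesgue. \<forall>A\<in>UNIV. f x $ A = exp (- p * (norm x)\<^sup>2) * (v A / ?I)"
    by (rule AE_finite_allI) (use comp in auto)
  then have "AE x in lebesgue. f x = exp (- p * (norm x)\<^sup>2) *\<^sub>R A0"
    by eventually_elim (simp add: A0_def vec_eq_iff)
  moreover have "A0 = 0" if pq: "p * q > 1 / 4"
  proof -
    \<comment> \<open>The surplus decay. The transform equals e^{-|y|^2/(4p)} V, so the hypothesis
      leaves |V| bounded by a multiple of e^{-d r^2} along a ray of vectors of length r, which
      forces V = 0.\<close>
    define d where "d = q - 1 / (4 * p)"
    have d: "d > 0" using pq p by (simp add: d_def field_simps)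
    have le: "norm V \<le> C / \<kappa> * exp (- d * r\<^sup>2)" for r
    proof -
      define y :: "(real, 'n) vec" where "y = r *\<^sub>R axis undefined 1"
      have y: "(norm y)\<^sup>2 = r\<^sup>2" by (simp add: y_def power_mult_distrib)
      have "exp (- (r\<^sup>2 / (4 * p))) * norm V \<le> C / \<kappa> * exp (- q * r\<^sup>2)"
        using bound[of y] unfolding transform(2)[of y] by (simp add: norm_scalar_mult V_def y)
      then have "exp (r\<^sup>2 / (4 * p)) * (exp (- (r\<^sup>2 / (4 * p))) * norm V) \<le> exp (r\<^sup>2 / (4 * p)) * (C / \<kappa> * exp (- q * r\<^sup>2))"
        by (rule mult_left_mono) simp
      also have "exp (r\<^sup>2 / (4 * p)) * (exp (- (r\<^sup>2 / (4 * p))) * norm V) = norm V"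
        by (simp add: exp_minus)
      also have "exp (r\<^sup>2 / (4 * p)) * (C / \<kappa> * exp (- q * r\<^sup>2)) = C / \<kappa> * (exp (r\<^sup>2 / (4 * p)) * exp (- q * r\<^sup>2))"
        by simp
      also have "exp (r\<^sup>2 / (4 * p)) * exp (- q * r\<^sup>2) = exp (- d * r\<^sup>2)"
        by (simp add: d_def algebra_simps flip: exp_add)
      finally show ?thesis .
    qed
    have "((\<lambda>r. C / \<kappa> * exp (- d * r\<^sup>2)) \<longlongrightarrow> 0) at_top"
      using d by real_asymp
    then have "norm V \<le> 0"
      by (rule tendsto_lowerbound) (use le in auto)
    then have "v A = 0" for A using V_nth[of A] by simp
    then show ?thesis by (simp add: A0_def vec_eq_iff)
  qed
  ultimately show ?thesis by blast
qed

text \<open>A Gaussian of parameter b has a transform of parameter 1/(4b), so p \<le> b and q \<le>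
  1/(4b) give the two rates, while c is taken small enough for both constants. The transform is
  computable because its homogeneous parts are radial and the Clifford kernel acts like the
  classical one.\<close>

lemma gaussian_in_hardy_class:
  fixes p q C b c s :: real
  assumes m: "CARD('n::{finite,linorder}) \<ge> 2" and p: "p > 0" and b: "p \<le> b" "q \<le> 1 / (4 * b)"
    and c: "c > 0" "c \<le> C"
    and cI: "(2 * pi) powr (- real CARD('n) / 2) * (c * gauss_int TYPE((real, 'n) vec) b) \<le> C"
  shows "(\<lambda>x. (c * exp (- b * (norm x)\<^sup>2)) *\<^sub>R cl_one) \<in>
    (hardy_class s p q C :: ((real, 'n) vec \<Rightarrow> (real, 'n) clifford) set)"
proof -
  have b0: "b > 0" using p b by simp
  define f :: "(real, 'n) vec \<Rightarrow> (real, 'n) clifford" where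
    "f = (\<lambda>x. (c * exp (- b * (norm x)\<^sup>2)) *\<^sub>R cl_one)"
  define F where "F = (\<lambda>x. cl_of_real (f x))"
  let ?I = "gauss_int TYPE((real, 'n) vec) b"
  have norm_one: "norm (cl_one :: (real, 'n) clifford) = 1" "norm (cl_one :: (complex, 'n) clifford) = 1"
    by (simp_all add: cl_basis_def norm_axis_1)
  have norm_f: "norm (f x) = c * exp (- b * (norm x)\<^sup>2)" for x
    using c by (simp add: f_def norm_one abs_mult)
  have F_eq: "F x = of_real (c * exp (- b * (norm x)\<^sup>2)) *s cl_one" for x
    by (simp add: F_def f_def cl_of_real_def vec_eq_iff cl_basis_def axis_def)
  have f_meas: "f \<in> borel_measurable borel"
    unfolding f_def by measurable
  have f_meas': "f \<in> borel_measurable lebesgue"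
    by (intro measurable_completion) (simp add: f_meas)
  have int_f: "integrable lebesgue f"
    unfolding lborel_integral_lebesgue(2)[OF f_meas] unfolding f_def
    by (intro integrable_scaleR_left integrable_mult_right gaussian_integrable b0)
  interpret gaussian_decay F b c
  proof
    show "F \<in> borel_measurable lebesgue"
      unfolding F_def using integrable_bounded_linear[OF bounded_linear_cl_of_real int_f] by auto
  qed (use b0 norm_f in \<open>auto simp: F_def norm_cl_of_real\<close>)
  have "f \<in> cl_B"
  proof -
    define e where "e = (real CARD('n) - 2) / 2"
    have e: "e \<ge> 0" using m by (simp add: e_def)
    have meas: "(\<lambda>y. (1 + norm y) powr e * norm (f y)) \<in> borel_measurable lebesgue"
    proof -
      have "(\<lambda>y :: (real, 'n) vec. (1 + norm y) powr e) \<in> borel_measurable lebesgue"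
        by (intro measurable_completion) measurable
      then show ?thesis using f_meas' by measurable
    qed
    have "integrable lebesgue (\<lambda>y. (1 + norm y) powr e * norm (f y))"
    proof (rule Bochner_Integration.integrable_bound[OF integrable_exp_norm[OF e] meas], rule AE_I2)
      fix y :: "(real, 'n) vec"
      \<comment> \<open>The weight of the class is absorbed into an exponential; its exponent is
        nonnegative from dimension 2 on.\<close>
      have "(1 + norm y) powr e \<le> exp (norm y) powr e"
        using e by (intro powr_mono2) (auto simp: exp_ge_add_one_self)
      also have "\<dots> = exp (e * norm y)" by (simp add: powr_def)
      finally show "norm ((1 + norm y) powr e * norm (f y)) \<le> norm (exp (e * norm y) * norm (F y))"
        by (simp add: F_def norm_cl_of_real mult_right_mono)
    qed
    then show ?thesis using int_f by (simp add: cl_B_def e_def)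
  qed
  moreover have "norm (f x) \<le> C * exp (- p * (norm x)\<^sup>2)" for x
    unfolding norm_f using b c by (intro mult_mono) (auto intro: mult_right_mono)
  moreover have "norm (cl_Fourier s f y) \<le> C * exp (- q * (norm y)\<^sup>2)" for y
  proof -
    have moment: "moment_poly 0 n y = of_real (c * (\<integral>x. (x \<bullet> y) ^ n * exp (- b * (norm x)\<^sup>2) \<partial>lborel)) *s cl_one" for n y
    proof -
      have "moment_poly 0 n y = (\<integral>x. of_real ((x \<bullet> y) ^ n) *s F x \<partial>lebesgue)"
        unfolding integral_kernel_term_moment(2)[symmetric] kernel_term_0 ..
      also have "\<dots> = (\<integral>x. complex_of_real (c * ((x \<bullet> y) ^ n * exp (- b * (norm x)\<^sup>2))) *s cl_one \<partial>lebesgue)"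
        unfolding F_eq vector_smult_assoc of_real_mult[symmetric] mult.left_commute[of "(_ \<bullet> _) ^ n" c] ..
      also have "\<dots> = (\<integral>x. complex_of_real (c * ((x \<bullet> y) ^ n * exp (- b * (norm x)\<^sup>2))) \<partial>lebesgue) *s cl_one"
        using integral_kernel_term_moment(1)[of 0 n y]
        unfolding kernel_term_0 F_eq vector_smult_assoc of_real_mult[symmetric] mult.left_commute[of "(_ \<bullet> _) ^ n" c]
        by (rule integral_scalar_mult_one)
      also have "(\<integral>x. complex_of_real (c * ((x \<bullet> y) ^ n * exp (- b * (norm x)\<^sup>2))) \<partial>lebesgue) =
          (\<integral>x. complex_of_real (c * ((x \<bullet> y) ^ n * exp (- b * (norm x)\<^sup>2))) \<partial>lborel)"
        by (rule lborel_integral_lebesgue(1)) measurable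
      finally show ?thesis by (simp only: integral_complex_of_real integral_mult_right_zero)
    qed
    have "cl_Gamma (moment_poly 0 n) = (\<lambda>_. 0)" for n
    proof -
      \<comment> \<open>The value from \<open>gaussian_moment\<close> with |y|^n split off.\<close>
      define v where "v = (if even n then of_real (c * (fact n * (?I * ((1 / (4 * b)) ^ (n div 2) / fact (n div 2))))) *s (cl_one :: (complex, 'n) clifford) else 0)"
      have "moment_poly 0 n = (\<lambda>y. of_real ((y \<bullet> y) ^ (n div 2)) *s v)"
        unfolding moment gaussian_moment[OF b0] v_def
        by (rule ext) (simp add: vec_eq_iff power_divide dot_square_norm mult_ac)
      then show ?thesis by (simp only: cl_Gamma_radial)
    qed
    then have "moment_poly (kernel_exponent s) n = moment_poly 0 n" for n
      unfolding moment_poly_0 by (simp add: moment_poly_def tensor_poly_exp_if_killed)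
    then have "(\<integral>x. cl_kernel s x y \<odot> F x \<partial>lebesgue) = (\<integral>x. exp (- \<i> * of_real (x \<bullet> y)) *s F x \<partial>lebesgue)"
      by (rule kernel_integrals_eq)
    also have "\<dots> = (\<integral>x. exp (- \<i> * of_real (x \<bullet> y)) * complex_of_real (c * exp (- b * (norm x)\<^sup>2)) \<partial>lebesgue) *s cl_one"
      using integrable_cl_kernel[of 0 y]
      unfolding cl_kernel_0_mult F_eq vector_smult_assoc by (rule integral_scalar_mult_one)
    also have "(\<integral>x. exp (- \<i> * of_real (x \<bullet> y)) * complex_of_real (c * exp (- b * (norm x)\<^sup>2)) \<partial>lebesgue) =
        (\<integral>x. of_real c * (exp (- \<i> * of_real (x \<bullet> y)) * complex_of_real (exp (- b * (norm x)\<^sup>2))) \<partial>lborel)"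
      unfolding of_real_mult mult.left_commute[of "exp _" "of_real c"]
      by (rule lborel_integral_lebesgue(1)) measurable
    also have "\<dots> = of_real (c * (exp (- (norm y)\<^sup>2 / (4 * b)) * ?I))"
      unfolding integral_mult_right_zero gaussian_fourier[OF b0] by simp
    finally have "cl_Fourier s f y = (2 * pi) powr (- real CARD('n) / 2) *\<^sub>R (of_real (c * (exp (- (norm y)\<^sup>2 / (4 * b)) * ?I)) *s cl_one)"
      by (simp only: cl_Fourier_def F_def)
    then have "norm (cl_Fourier s f y) = (2 * pi) powr (- real CARD('n) / 2) * (c * ?I) * exp (- (norm y)\<^sup>2 / (4 * b))"
      using c gauss_int_pos[OF b0, where 'a = "(real, 'n) vec"] by (simp add: norm_scalar_mult norm_one norm_mult abs_mult)
    also have "\<dots> \<le> C * exp (- q * (norm y)\<^sup>2)"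
    proof (rule mult_mono[OF cI])
      have "q * (norm y)\<^sup>2 \<le> 1 / (4 * b) * (norm y)\<^sup>2" using b by (intro mult_right_mono) auto
      then show "exp (- (norm y)\<^sup>2 / (4 * b)) \<le> exp (- q * (norm y)\<^sup>2)" by simp
    qed (use c in auto)
    finally show ?thesis .
  qed
  ultimately show ?thesis
    by (simp add: hardy_class_def f_def)
qed

text \<open>The last Gaussian decays slowest. After multiplication by exp(b_N r^2) all others tend
  to 0 as r grows, so its coefficient vanishes and induction applies.\<close>

lemma gaussians_independent:
  fixes c \<gamma> b :: "nat \<Rightarrow> real"
  assumes \<gamma>: "\<And>k. \<gamma> k > 0" and b: "\<And>i j. i < j \<Longrightarrow> b j < b i"
    and zero: "\<And>r. (\<Sum>k<N. c k * (\<gamma> k * exp (- b k * r\<^sup>2))) = 0"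
  shows "\<forall>k<N. c k = 0"
  using zero
proof (induction N)
  case (Suc N)
  have "(\<Sum>k<N. c k * \<gamma> k * exp (- (b k - b N) * r\<^sup>2)) + c N * \<gamma> N = 0" for r
  proof -
    have "0 = exp (b N * r\<^sup>2) * (\<Sum>k<Suc N. c k * (\<gamma> k * exp (- b k * r\<^sup>2)))"
      using Suc.prems[of r] by simp
    also have "\<dots> = (\<Sum>k<Suc N. c k * \<gamma> k * (exp (b N * r\<^sup>2) * exp (- b k * r\<^sup>2)))"
      by (simp only: sum_distrib_left mult_ac)
    also have "\<dots> = (\<Sum>k<Suc N. c k * \<gamma> k * exp (- (b k - b N) * r\<^sup>2))"
      by (intro sum.cong refl) (simp add: algebra_simps flip: exp_add)
    finally show ?thesis by simp
  qed
  moreover have "((\<lambda>r. (\<Sum>k<N. c k * \<gamma> k * exp (- (b k - b N) * r\<^sup>2)) + c N * \<gamma> N) \<longlongrightarrow> (\<Sum>k<N. c k * \<gamma> k * 0) + c N * \<gamma> N) at_top"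
  proof (intro tendsto_intros)
    fix k assume "k \<in> {..<N}"
    then have "b k - b N > 0" using b[of k N] by simp
    then show "((\<lambda>r. exp (- (b k - b N) * r\<^sup>2)) \<longlongrightarrow> 0) at_top"
      by real_asymp
  qed
  ultimately have "c N * \<gamma> N = 0"
    by (simp add: tendsto_const_iff)
  then have cN: "c N = 0" using \<gamma>[of N] by simp
  then have "\<forall>k<N. c k = 0"
    using Suc.prems by (intro Suc.IH) simp
  with cN show ?case by (auto simp: less_Suc_eq)
qed simp

lemma continuous_AE_0_imp_0:
  fixes u :: "'a::euclidean_space \<Rightarrow> 'b::real_normed_vector"
  assumes cont: "continuous_on UNIV u" and ae: "AE x in lebesgue. u x = 0"
  shows "u x = 0"
proof (rule ccontr)
  assume "u x \<noteq> 0"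
  have op: "open {x. u x \<noteq> 0}"
    using open_Collect_neq[OF cont continuous_on_const, of 0] .
  then have "{x. u x \<noteq> 0} \<in> sets lebesgue" by simp
  with ae have "{x. u x \<noteq> 0} \<in> null_sets lebesgue"
    by (subst (asm) AE_iff_null) (auto simp: null_sets_def)
  then have "negligible {x. u x \<noteq> 0}" by (simp add: negligible_iff_null_sets)
  with op open_not_negligible[OF op] \<open>u x \<noteq> 0\<close> show False by blast
qed

text \<open>Equalities hold almost everywhere because the class is stable under changes on null sets
  that respect the pointwise bound. At pq = 1/4 the Gaussian has exponent p, its transform having
  exponent 1/(4p) = q; it is e^{-|x|^2/2} exactly for p = 1/2. The plural in the third case is read
  as an infinite sequence that is linearly independent modulo null functions.\<close>

theorem theorem5p1:
  fixes p q C s :: real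
  assumes "p > 0" and "q > 0" and "C > 0"
    and "even CARD('n::{finite,linorder})" and "CARD('n) > 2"
    and "s \<in> {1, -1}"
  shows "(p * q > 1 / 4 \<longrightarrow>
      (\<forall>f :: real ^ 'n::{finite,linorder} \<Rightarrow> (real, 'n) clifford. f \<in> hardy_class s p q C \<longrightarrow>
        (AE x in lebesgue. f x = 0))) \<and>
    (p * q = 1 / 4 \<longrightarrow>
      (\<forall>f :: real ^ 'n::{finite,linorder} \<Rightarrow> (real, 'n) clifford. f \<in> hardy_class s p q C \<longrightarrow>
        (\<exists>A. AE x in lebesgue. f x = exp (- p * (norm x)\<^sup>2) *\<^sub>R A))) \<and>
    (p * q < 1 / 4 \<longrightarrow>
      (\<exists>F :: nat \<Rightarrow> real ^ 'n::{finite,linorder} \<Rightarrow> (real, 'n) clifford.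
        (\<forall>k. F k \<in> hardy_class s p q C) \<and>
        (\<forall>N c. (AE x in lebesgue. (\<Sum>k<N. c k *\<^sub>R F k x) = 0) \<longrightarrow> (\<forall>k<N. c k = 0))))"
proof (intro conjI impI allI)
  fix f :: "real ^ 'n::{finite,linorder} \<Rightarrow> (real, 'n) clifford"
  assume pq: "p * q > 1 / 4" and f: "f \<in> hardy_class s p q C"
  then show "AE x in lebesgue. f x = 0"
    using hardy_class_is_gaussian[OF f \<open>p > 0\<close> \<open>C > 0\<close>] by auto
next
  fix f :: "real ^ 'n::{finite,linorder} \<Rightarrow> (real, 'n) clifford"
  assume pq: "p * q = 1 / 4" and f: "f \<in> hardy_class s p q C"
  then show "\<exists>A. AE x in lebesgue. f x = exp (- p * (norm x)\<^sup>2) *\<^sub>R A"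
    using hardy_class_is_gaussian[OF f \<open>p > 0\<close> \<open>C > 0\<close>] by auto
next
  assume pq: "p * q < 1 / 4"
  \<comment> \<open>The length of the interval of admissible parameters, from p to 1/(4q). The
    sequence \<open>b\<close> starts at its right end and decreases strictly towards p.\<close>
  define d where "d = 1 / (4 * q) - p"
  have d: "d > 0" using pq assms by (simp add: d_def field_simps)
  define b where "b = (\<lambda>k. p + d / real (Suc k))"
  have b: "p \<le> b k" "b k > 0" "q \<le> 1 / (4 * b k)" for k
  proof -
    show "p \<le> b k" using d by (simp add: b_def)
    then show "b k > 0" using assms by simp
    have "d / real (Suc k) \<le> d" using d by (simp add: divide_le_eq)
    then have "b k \<le> 1 / (4 * q)" by (simp add: b_def d_def)
    then show "q \<le> 1 / (4 * b k)" using \<open>b k > 0\<close> assms by (simp add: field_simps)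
  qed
  have b_less: "b j < b i" if "i < j" for i j
    using d that by (simp add: b_def divide_strict_left_mono)
  define \<kappa> where "\<kappa> = (\<lambda>k. (2 * pi) powr (- real CARD('n) / 2) * gauss_int TYPE((real, 'n) vec) (b k))"
  have \<kappa>: "\<kappa> k > 0" for k using gauss_int_pos[OF b(2), where 'a = "(real, 'n) vec"] by (simp add: \<kappa>_def)
  \<comment> \<open>\<open>\<kappa> k\<close> is the factor between the amplitudes of a Gaussian and
    of its transform, so this amplitude meets both bounds with the prescribed C.\<close>
  define \<gamma> where "\<gamma> = (\<lambda>k. min C (C / \<kappa> k))"
  have \<gamma>: "\<gamma> k > 0" "\<gamma> k \<le> C" "\<kappa> k * \<gamma> k \<le> C" for k
  proof -
    show "\<gamma> k > 0" "\<gamma> k \<le> C" using \<kappa>[of k] assms by (auto simp: \<gamma>_def)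
    have "\<gamma> k \<le> C / \<kappa> k" by (simp add: \<gamma>_def)
    then show "\<kappa> k * \<gamma> k \<le> C" using \<kappa>[of k] by (simp add: field_simps)
  qed
  define F :: "nat \<Rightarrow> real ^ 'n::{finite,linorder} \<Rightarrow> (real, 'n) clifford" where
    "F = (\<lambda>k x. (\<gamma> k * exp (- b k * (norm x)\<^sup>2)) *\<^sub>R cl_one)"
  show "\<exists>F :: nat \<Rightarrow> real ^ 'n::{finite,linorder} \<Rightarrow> (real, 'n) clifford.
        (\<forall>k. F k \<in> hardy_class s p q C) \<and>
        (\<forall>N c. (AE x in lebesgue. (\<Sum>k<N. c k *\<^sub>R F k x) = 0) \<longrightarrow> (\<forall>k<N. c k = 0))"
  proof (intro exI[of _ F] conjI allI impI)
    show "F k \<in> hardy_class s p q C" for k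
      unfolding F_def
      by (rule gaussian_in_hardy_class)
        (use assms b \<gamma> in \<open>auto simp: \<kappa>_def mult_ac\<close>)
  next
    fix N k and c :: "nat \<Rightarrow> real"
    assume ae: "AE x in lebesgue. (\<Sum>k<N. c k *\<^sub>R F k x) = 0" and "k < N"
    have "(\<Sum>k<N. c k *\<^sub>R F k x) = 0" for x
      by (rule continuous_AE_0_imp_0[OF _ ae]) (auto simp: F_def intro!: continuous_intros)
    then have sum0: "(\<Sum>k<N. c k *\<^sub>R F k x) $ {} = 0" for x by simp
    have "(\<Sum>k<N. c k * (\<gamma> k * exp (- b k * r\<^sup>2))) = 0" for r
      \<comment> \<open>Any unit vector will do; on its multiples the scalar component reduces the
        relation to one in r.\<close>
      using sum0[of "r *\<^sub>R axis undefined 1"]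
      by (simp add: F_def cl_basis_def power_mult_distrib)
    with gaussians_independent[of \<gamma> b, OF \<gamma>(1) b_less] \<open>k < N\<close> show "c k = 0" by blast
  qed
qed

end
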